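(* Let $q\in\mathbb N$, $d\in(0,1/2)$, and let $w:\mathbb T\to\mathbb C^{q\times q}$ be of the form $w(e^{i\theta})=|1-e^{i\theta}|^{-2d}g(e^{i\theta})g(e^{i\theta})^*$, where the entries of $g(z)$ are rational functions of $z$ with no poles in the closed unit disk and $\det g(z)$ has no zeros in the closed unit disk. Let $\rho\in(1-2d,\infty)$ and let $\mathbf y=(y_1^\top,y_2^\top,\dots)^\top$ with $y_k\in\mathbb C^{q\times q}$ satisfy $\sup_{k\in\mathbb N}k^\rho\|y_k\|<\infty$. Let $\mathbf z=(z_1^\top,z_2^\top,\dots)^\top$, $z_k\in\mathbb C^{q\times q}$, be the solution to $T_\infty(w)\mathbf z=\mathbf y$, and for $n\in\mathbb N$ let $\mathbf z_n=(z_{1,n}^\top,\dots,z_{n,n}^\top)^\top$, $z_{k,n}\in\mathbb C^{q\times q}$, be the solution to $T_n(w)\mathbf z_n=\mathbf y_n$, where $\mathbf y_n=(y_1^\top,\dots,y_n^\top)^\top$. Then, as $n\to\infty$, $$\sum_{k=1}^n\|z_k-z_{k,n}\|=\begin{cases}O(n^{1-2d-\rho}) & (1-2d<\rho<1-d),\\ O(n^{-d}\log n) & (\rho=1-d),\\ O(n^{-d}) & (\rho>1-d).\end{cases}$$ In particular, $\lim_{n\to\infty}\sum_{k=1}^n\|z_k-z_{k,n}\|=0$.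
   Context: $\mathbb N=\{1,2,\dots\}$; $\mathbb T$ is the unit circle and $\mathbb D$ the open unit disk in $\mathbb C$; $\|a\|$ is the spectral norm and $a^*$ the Hermitian conjugate of a matrix $a$. Put $\gamma(k)=\int_{-\pi}^{\pi}e^{-ik\theta}w(e^{i\theta})\frac{d\theta}{2\pi}\in\mathbb C^{q\times q}$ for $k\in\mathbb Z$, $T_n(w)=(\gamma(s-t))_{1\le s,t\le n}\in\mathbb C^{qn\times qn}$ (which is invertible) and $T_\infty(w)=(\gamma(s-t))_{s,t\ge1}$. For a finite or semi-infinite block matrix $A$, $A^{s,t}\in\mathbb C^{q\times q}$ denotes its $(s,t)$ block. The inverse $T_\infty(w)^{-1}$ is the following semi-infinite block matrix. There is a rational $g_\sharp:\mathbb T\to\mathbb C^{q\times q}$ with the same two properties as $g$ (entries rational without poles in the closed unit disk, determinant without zeros there) such that $g(e^{i\theta})g(e^{i\theta})^*=g_\sharp(e^{i\theta})^*g_\sharp(e^{i\theta})$ for all $\theta$; fix one. Put $h_\sharp(z)=(1-z)^{-d}g_\sharp(z)$ (principal branch), $\tilde h(z)=\{h_\sharp(\overline z)\}^*$, and define $\{\tilde a_k\}_{k\ge0}\subset\mathbb C^{q\times q}$ by $-\tilde h(z)^{-1}=\sum_{k=0}^\infty z^k\tilde a_k$, $z\in\mathbb D$. Then $(T_\infty(w)^{-1})^{s,t}=\sum_{\ell=1}^{\min(s,t)}\tilde a_{s-\ell}^*\tilde a_{t-\ell}$ for $s,t\in\mathbb N$. "The solution" $\mathbf z$ to $T_\infty(w)\mathbf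 z=\mathbf y$ means $\mathbf z=T_\infty(w)^{-1}\mathbf y$, i.e. $z_s=\sum_{t=1}^\infty(T_\infty(w)^{-1})^{s,t}y_t$ for $s\in\mathbb N$ (absolutely convergent); likewise $z_{s,n}=\sum_{t=1}^n(T_n(w)^{-1})^{s,t}y_t$ for $s\in\{1,\dots,n\}$. *)

theory Defs
  imports
    "HOL-Analysis.Analysis"
    "HOL-Library.Landau_Symbols"
    "HOL-Computational_Algebra.Polynomial"
begin

type_synonym 'q cmat = "complex^'q^'q"

definition herm :: "'q::finite cmat \<Rightarrow> 'q cmat" where
  "herm a = (\<chi> i j. cnj (a $ j $ i))"

definition cscale :: "complex \<Rightarrow> 'q::finite cmat \<Rightarrow> 'q cmat" where
  "cscale c a = (\<chi> i j. c * a $ i $ j)"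

text \<open>
  The operator norm for the Euclidean norm on vectors; the type-class \<^const>\<open>norm\<close> on matrices
  is the Frobenius norm.
\<close>
definition spectral_norm :: "'q::finite cmat \<Rightarrow> real" where
  "spectral_norm a = onorm (\<lambda>x. a *v x)"

text \<open>
  Only the values on the closed unit disk are constrained. A rational function has no pole there iff
  it is a quotient of polynomials whose denominator does not vanish there.
\<close>
definition rational_nopole_closed_disk :: "(complex \<Rightarrow> 'q::finite cmat) \<Rightarrow> bool" where
  "rational_nopole_closed_disk g \<longleftrightarrow>
     (\<forall>i j. \<exists>p r :: complex poly. \<forall>z\<in>cball 0 1.
        poly r z \<noteq> 0 \<and> g z $ i $ j = poly p z / poly r z)"

definition det_nonzero_closed_disk :: "(complex \<Rightarrow> 'q::finite cmat) \<Rightarrow> bool" where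
  "det_nonzero_closed_disk g \<longleftrightarrow> (\<forall>z\<in>cball 0 1. det (g z) \<noteq> 0)"

definition fourier_coeff :: "(complex \<Rightarrow> 'q::finite cmat) \<Rightarrow> int \<Rightarrow> 'q cmat" where
  "fourier_coeff w k =
     (\<chi> i j. (LBINT \<theta>:{-pi..pi}. exp (- \<i> * of_int k * of_real \<theta>) * w (cis \<theta>) $ i $ j) / (2 * of_real pi))"

text \<open>
  Block matrices are functions of two natural numbers, used at indices \<open>\<ge> 1\<close> only. The finite
  Toeplitz matrix of size \<open>n\<close> is the restriction of \<open>toeplitz w\<close> to indices in \<open>{1..n}\<close>.
\<close>
definition toeplitz :: "(complex \<Rightarrow> 'q::finite cmat) \<Rightarrow> nat \<Rightarrow> nat \<Rightarrow> 'q cmat" where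
  "toeplitz w s t = fourier_coeff w (int s - int t)"

text \<open>
  The blocks of the inverse of the \<open>n\<close> by \<open>n\<close> block matrix \<open>A\<close>; the value zero outside \<open>{1..n}\<close> makes
  the description unique.
\<close>
definition block_inverse :: "nat \<Rightarrow> (nat \<Rightarrow> nat \<Rightarrow> 'q::finite cmat) \<Rightarrow> nat \<Rightarrow> nat \<Rightarrow> 'q cmat" where
  "block_inverse n A = (THE B.
     (\<forall>s\<in>{1..n}. \<forall>t\<in>{1..n}.
        (\<Sum>u=1..n. A s u ** B u t) = (if s = t then mat 1 else 0) \<and>
        (\<Sum>u=1..n. B s u ** A u t) = (if s = t then mat 1 else 0)) \<and>
     (\<forall>s t. s \<notin> {1..n} \<or> t \<notin> {1..n} \<longrightarrow> B s t = 0))"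

definition finite_solution ::
  "(complex \<Rightarrow> 'q::finite cmat) \<Rightarrow> (nat \<Rightarrow> 'q cmat) \<Rightarrow> nat \<Rightarrow> nat \<Rightarrow> 'q cmat" where
  "finite_solution w y n s = (\<Sum>t=1..n. block_inverse n (toeplitz w) s t ** y t)"

definition h_sharp :: "real \<Rightarrow> (complex \<Rightarrow> 'q::finite cmat) \<Rightarrow> complex \<Rightarrow> 'q cmat" where
  "h_sharp d g' z = cscale ((1 - z) powr (- complex_of_real d)) (g' z)"

definition h_tilde :: "real \<Rightarrow> (complex \<Rightarrow> 'q::finite cmat) \<Rightarrow> complex \<Rightarrow> 'q cmat" where
  "h_tilde d g' z = herm (h_sharp d g' (cnj z))"

definition a_tilde :: "real \<Rightarrow> (complex \<Rightarrow> 'q::finite cmat) \<Rightarrow> nat \<Rightarrow> 'q cmat" where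
  "a_tilde d g' = (THE a. \<forall>z\<in>ball 0 1. (\<lambda>k. cscale (z ^ k) (a k)) sums (- matrix_inv (h_tilde d g' z)))"

text \<open>
  The inverse of the semi-infinite block Toeplitz matrix whose symbol is
  \<open>\<bar>1 - z\<bar> powr (-2 * d)\<close> times \<open>herm (g' z) ** g' z\<close>.
\<close>
definition toeplitz_inf_inverse ::
  "real \<Rightarrow> (complex \<Rightarrow> 'q::finite cmat) \<Rightarrow> nat \<Rightarrow> nat \<Rightarrow> 'q cmat" where
  "toeplitz_inf_inverse d g' s t =
     (\<Sum>l=1..min s t. herm (a_tilde d g' (s - l)) ** a_tilde d g' (t - l))"

definition infinite_solution ::
  "real \<Rightarrow> (complex \<Rightarrow> 'q::finite cmat) \<Rightarrow> (nat \<Rightarrow> 'q cmat) \<Rightarrow> nat \<Rightarrow> 'q cmat" where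
  "infinite_solution d g' y s = (\<Sum>\<^sub>\<infinity>t\<in>{1..}. toeplitz_inf_inverse d g' s t ** y t)"

end

theory Submission
  imports Defs "HOL-Complex_Analysis.Complex_Analysis"
begin

text \<open>
  Let \<open>h = (1 - z) powr (-d) * g\<close> and \<open>h\<^sub>\<sharp>\<close> be the two outer factors of the symbol, and let
  \<open>V\<close> be the Fourier coefficients of the unitary function \<open>(h\<^sub>\<sharp>\<^sup>*)\<^sup>-\<^sup>1 h\<close>. Extend a solution \<open>x\<close> of the
  section of size \<open>n\<close> by zero and apply the Laurent operator: the result agrees with \<open>y\<close> on
  \<open>{1..n}\<close>, and multiplying it by \<open>h\<^sup>-\<^sup>1\<close> and by \<open>(h\<^sub>\<sharp>\<^sup>*)\<^sup>-\<^sup>1\<close> shows that its parts to the right of \<open>n\<close> and to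
  the left of \<open>1\<close> determine each other through the blocks of \<open>V\<close> whose indices differ by at least
  \<open>n\<close>. There \<open>V (- m)\<close> is \<open>sin (pi d) / (pi m)\<close> times a unitary matrix, up to \<open>O(m\<^sup>-\<^sup>2)\<close>, so by
  Hilbert's inequality with weight \<open>m powr (-1/2)\<close> these blocks are contractions with a
  factor below 1 for large \<open>n\<close>, since \<open>sin (pi d) < 1\<close>. This bounds both parts, and hence the
  difference between \<open>x\<close> and the truncation of \<open>T\<^sub>\<infinity>(w)\<^sup>-\<^sup>1 y\<close>, by weighted sums over \<open>y\<close>; the contribution
  of the \<open>y\<^sub>t\<close> with \<open>t > n\<close> is estimated from the decay of the entries of \<open>T\<^sub>\<infinity>(w)\<^sup>-\<^sup>1\<close>.
\<close>

text \<open>The constant comes from an exact formula: correlating the coefficients of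
  \<open>(1 - z) powr d\<close> and \<open>(1 - z) powr (- d)\<close> gives
  \<open>sin (pi d) / (pi (k + d))\<close>. To leading order the rational factors modify this only
  by their values at the singular point 1, where the phase is unitary. With the weight
  \<open>m powr (- p)\<close> the kernel \<open>1 / (m + M)\<close> has the constant
  \<open>pi / sin (pi p)\<close>, least for \<open>p = 1/2\<close>; the margin left over is that
  between \<open>sin (pi d)\<close> and 1. Since a sum of norms is to be estimated, the contraction
  is set up in weighted l1. The obstacle throughout is that the coefficients of \<open>h\<close> and
  of \<open>w\<close> are controlled only by non-summable powers, so every interchange of sums is
  paid for by the summable inverse factors, by causality or by square summability. The two rates
  have two sources: what \<open>y\<close> sends directly across the end \<open>n\<close>, together
  with the tail of \<open>y\<close>, yields \<open>n powr (1 - 2 d - \<rho>)\<close>; what is first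
  reflected at the left end yields \<open>n powr (- d)\<close> times the partial sums of
  \<open>t powr (- \<rho> - d)\<close>.\<close>

unbundle no fps_syntax

section \<open>Families of reals with bounded partial sums\<close>

lemma has_sum_finite_sum:
  fixes f :: "'s \<Rightarrow> 'a \<Rightarrow> 'b::topological_comm_monoid_add"
  assumes "\<And>s. s \<in> S \<Longrightarrow> (f s has_sum c s) A"
  shows "((\<lambda>x. \<Sum>s\<in>S. f s x) has_sum (\<Sum>s\<in>S. c s)) A"
  using assms by (induction S rule: infinite_finite_induct) (auto intro!: has_sum_add)

text \<open>Meant for nonnegative families, where it combines summability with a bound for the sum.
  It passes through majorants, reindexing, unions and products without separate summability proofs,
  and convergence is extracted from it only at the end.\<close>

definition psum_le :: "('a \<Rightarrow> real) \<Rightarrow> 'a set \<Rightarrow> real \<Rightarrow> bool" where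
  "psum_le f A c \<longleftrightarrow> (\<forall>F. finite F \<longrightarrow> F \<subseteq> A \<longrightarrow> sum f F \<le> c)"

lemma psum_leD: "psum_le f A c \<Longrightarrow> finite F \<Longrightarrow> F \<subseteq> A \<Longrightarrow> sum f F \<le> c"
  by (auto simp: psum_le_def)

lemma psum_le_mono:
  assumes "psum_le g A c" "\<And>x. x \<in> A \<Longrightarrow> f x \<le> g x" "c \<le> c'"
  shows "psum_le f A c'"
  unfolding psum_le_def
proof (intro allI impI)
  fix F assume "finite F" "F \<subseteq> A"
  then have "sum f F \<le> sum g F" "sum g F \<le> c"
    using assms by (auto intro!: sum_mono psum_leD)
  then show "sum f F \<le> c'" using assms(3) by linarith
qed

lemma psum_le_subset: "psum_le f A c \<Longrightarrow> B \<subseteq> A \<Longrightarrow> psum_le f B c"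
  by (auto simp: psum_le_def)

lemma psum_le_add: "psum_le f A c \<Longrightarrow> psum_le g A c' \<Longrightarrow> psum_le (\<lambda>x. f x + g x) A (c + c')"
  by (auto simp: psum_le_def sum.distrib intro!: add_mono)

lemma psum_le_cmult: "psum_le f A c \<Longrightarrow> 0 \<le> k \<Longrightarrow> psum_le (\<lambda>x. k * f x) A (k * c)"
  by (auto simp: psum_le_def sum_distrib_left[symmetric] intro!: mult_left_mono)

lemma psum_le_finite: "finite A \<Longrightarrow> (\<And>x. x \<in> A \<Longrightarrow> 0 \<le> f x) \<Longrightarrow> psum_le f A (sum f A)"
  by (auto simp: psum_le_def intro!: sum_mono2)

lemma psum_le_sum:
  "finite S \<Longrightarrow> (\<And>s. s \<in> S \<Longrightarrow> psum_le (f s) A (c s)) \<Longrightarrow> psum_le (\<lambda>x. \<Sum>s\<in>S. f s x) A (\<Sum>s\<in>S. c s)"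
  unfolding psum_le_def by (auto simp: sum.swap[of _ S] intro!: sum_mono)

lemma psum_le_reindex:
  assumes "inj_on h A" "psum_le f B c" "h ` A \<subseteq> B"
  shows "psum_le (\<lambda>x. f (h x)) A c"
  unfolding psum_le_def
proof (intro allI impI)
  fix F assume F: "finite F" "F \<subseteq> A"
  have "(\<Sum>x\<in>F. f (h x)) = sum f (h ` F)"
    using F assms(1) by (subst sum.reindex) (auto intro: inj_on_subset)
  also have "\<dots> \<le> c" using F assms by (intro psum_leD) auto
  finally show "(\<Sum>x\<in>F. f (h x)) \<le> c" .
qed

lemma psum_le_union:
  assumes "psum_le f A c" "psum_le f B c'" "\<And>x. x \<in> A \<union> B \<Longrightarrow> 0 \<le> f x"
  shows "psum_le f (A \<union> B) (c + c')"
  unfolding psum_le_def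
proof (intro allI impI)
  fix F assume F: "finite F" "F \<subseteq> A \<union> B"
  have "sum f F = sum f ((F \<inter> A) \<union> (F - A))" by (rule arg_cong[where f = "sum f"]) auto
  also have "\<dots> = sum f (F \<inter> A) + sum f (F - A)" using F by (intro sum.union_disjoint) auto
  also have "\<dots> \<le> c + c'" using F assms by (intro add_mono psum_leD) auto
  finally show "sum f F \<le> c + c'" .
qed

lemma psum_le_abs:
  assumes "psum_le f A c" "\<And>x. x \<in> A \<Longrightarrow> norm (g x) \<le> f x"
  shows "(\<lambda>x. norm (g x)) summable_on A"
  unfolding Infinite_Sum.abs_summable_iff_bdd_above
proof (rule bdd_aboveI2[where M = c])
  fix F assume F: "F \<in> {F. F \<subseteq> A \<and> finite F}"
  then have "(\<Sum>x\<in>F. norm (g x)) \<le> sum f F" "sum f F \<le> c"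
    using assms by (auto intro!: sum_mono psum_leD)
  then show "(\<Sum>x\<in>F. norm (g x)) \<le> c" by linarith
qed

lemma psum_le_infsum_le:
  assumes "psum_le f A c" "\<And>x. x \<in> A \<Longrightarrow> norm (g x) \<le> f x"
  shows "norm (infsum g A) \<le> c"
proof -
  have s: "(\<lambda>x. norm (g x)) summable_on A" using assms by (rule psum_le_abs)
  have "infsum (\<lambda>x. norm (g x)) A \<le> c"
  proof (rule infsum_le_finite_sums)
    show "(\<lambda>x. norm (g x)) summable_on A" using s .
    fix F assume F: "finite F" "F \<subseteq> A"
    then have "(\<Sum>x\<in>F. norm (g x)) \<le> sum f F" "sum f F \<le> c"
      using assms by (auto intro!: sum_mono psum_leD)
    then show "(\<Sum>x\<in>F. norm (g x)) \<le> c" by linarith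
  qed
  with norm_infsum_bound[OF s] show ?thesis by linarith
qed

lemma psum_le_summable:
  fixes g :: "'a \<Rightarrow> 'b::banach"
  assumes "psum_le f A c" "\<And>x. x \<in> A \<Longrightarrow> norm (g x) \<le> f x"
  shows "g summable_on A"
  using psum_le_abs[OF assms] by (rule abs_summable_summable)

lemma psum_le_real:
  fixes f :: "'a \<Rightarrow> real"
  assumes "psum_le f A c" "\<And>x. x \<in> A \<Longrightarrow> 0 \<le> f x"
  shows "f summable_on A" "infsum f A \<le> c"
  using psum_le_summable[OF assms(1), of f] psum_le_infsum_le[OF assms(1), of f] assms(2)
  by auto

lemma psum_le_infsum:
  fixes f :: "'a \<Rightarrow> real"
  assumes "f summable_on A" "\<And>x. x \<in> A \<Longrightarrow> 0 \<le> f x"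
  shows "psum_le f A (infsum f A)"
  unfolding psum_le_def using assms by (auto intro!: finite_sum_le_infsum)

text \<open>This and \<open>psum_le_iterate\<close> are the two directions of Tonelli's theorem in
  terms of bounds.\<close>

lemma psum_le_prodI:
  assumes "\<And>x. x \<in> A \<Longrightarrow> psum_le (f x) B (g x)" "psum_le g A c"
    "\<And>x y. x \<in> A \<Longrightarrow> y \<in> B \<Longrightarrow> 0 \<le> f x y"
  shows "psum_le (\<lambda>(x, y). f x y) (A \<times> B) c"
  unfolding psum_le_def
proof (intro allI impI)
  fix F assume F: "finite F" "F \<subseteq> A \<times> B"
  have "(\<Sum>(x, y)\<in>F. f x y) \<le> (\<Sum>(x, y)\<in>fst ` F \<times> snd ` F. f x y)"
  proof (intro sum_mono2)
    show "F \<subseteq> fst ` F \<times> snd ` F" by (force intro: rev_image_eqI)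
    show "0 \<le> (case b of (x, y) \<Rightarrow> f x y)" if "b \<in> fst ` F \<times> snd ` F - F" for b
      using that F by (auto intro!: assms(3))
  qed (use F in auto)
  also have "\<dots> = (\<Sum>x\<in>fst ` F. \<Sum>y\<in>snd ` F. f x y)"
    by (simp add: sum.cartesian_product)
  also have "\<dots> \<le> (\<Sum>x\<in>fst ` F. g x)"
    using F assms(1) by (intro sum_mono psum_leD[where A = B]) auto
  also have "\<dots> \<le> c" using F assms(2) by (intro psum_leD) auto
  finally show "(\<Sum>(x, y)\<in>F. f x y) \<le> c" .
qed

lemma psum_le_prod_swap:
  assumes "psum_le (\<lambda>(x, y). f x y) (A \<times> B) c"
  shows "psum_le (\<lambda>(y, x). f x y) (B \<times> A) c"
  using psum_le_reindex[of "\<lambda>(y, x). (x, y)" "B \<times> A" "\<lambda>(x, y). f x y" "A \<times> B" c] assms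
  by (simp add: case_prod_unfold inj_on_def image_subset_iff prod_eq_iff)

lemma psum_le_prod_fst:
  assumes "psum_le (\<lambda>(x, y). f x y) (A \<times> B) c" "\<And>x y. x \<in> A \<Longrightarrow> y \<in> B \<Longrightarrow> 0 \<le> f x y" "x \<in> A"
  shows "psum_le (f x) B c"
  using psum_le_reindex[of "Pair x" B "\<lambda>(x, y). f x y" "A \<times> B" c] assms
  by (auto simp: inj_on_def)

lemma psum_le_iterate:
  assumes "psum_le (\<lambda>(x, y). f x y) (A \<times> B) c" "\<And>x y. x \<in> A \<Longrightarrow> y \<in> B \<Longrightarrow> 0 \<le> f x y"
  shows "psum_le (\<lambda>x. infsum (f x) B) A c"
  unfolding psum_le_def
proof (intro allI impI)
  fix F assume F: "finite F" "F \<subseteq> A"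
  have s: "f x summable_on B" if "x \<in> F" for x
    using psum_le_prod_fst[OF assms, of x] that F assms(2)
    by (intro psum_le_real(1)) auto
  have "(\<Sum>x\<in>F. infsum (f x) B) = infsum (\<lambda>y. \<Sum>x\<in>F. f x y) B"
    by (rule sym, rule infsumI, rule has_sum_finite_sum) (use s in auto)
  also have "\<dots> \<le> c"
  proof (rule psum_le_real(2))
    show "psum_le (\<lambda>y. \<Sum>x\<in>F. f x y) B c"
      unfolding psum_le_def
    proof (intro allI impI)
      fix G assume G: "finite G" "G \<subseteq> B"
      have "(\<Sum>y\<in>G. \<Sum>x\<in>F. f x y) = (\<Sum>(x, y)\<in>F \<times> G. f x y)"
        by (subst sum.swap) (simp add: sum.cartesian_product)
      also have "\<dots> \<le> c" using F G by (intro psum_leD[OF assms(1)]) auto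
      finally show "(\<Sum>y\<in>G. \<Sum>x\<in>F. f x y) \<le> c" .
    qed
  qed (use assms(2) F in \<open>auto intro!: sum_nonneg\<close>)
  finally show "(\<Sum>x\<in>F. infsum (f x) B) \<le> c" .
qed

lemma infsum_swap_psum_le:
  fixes f :: "'a \<Rightarrow> 'b \<Rightarrow> 'c::banach"
  assumes "psum_le (\<lambda>(x, y). norm (f x y)) (A \<times> B) c"
  shows "infsum (\<lambda>x. infsum (\<lambda>y. f x y) B) A = infsum (\<lambda>y. infsum (\<lambda>x. f x y) A) B"
  by (rule infsum_swap_banach, rule psum_le_summable[OF assms]) auto

text \<open>The integral test: in the applications \<open>G\<close> samples an antiderivative of a
  decreasing majorant, so only its increments over unit intervals have to be compared with
  \<open>f\<close>.\<close>

lemma psum_le_telescope: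
  fixes f G :: "int \<Rightarrow> real"
  assumes "\<And>m. a < m \<Longrightarrow> f m \<le> G m - G (m - 1)" "\<And>m. a < m \<Longrightarrow> 0 \<le> f m" "\<And>m. a \<le> m \<Longrightarrow> G m \<le> L"
  shows "psum_le f {a<..} (L - G a)"
  unfolding psum_le_def
proof (intro allI impI)
  fix F :: "int set" assume F: "finite F" "F \<subseteq> {a<..}"
  define M where "M = Max (insert a F)"
  have aM: "a \<le> M" using F by (auto simp: M_def)
  have FM: "F \<subseteq> {a+1..M}" using F by (auto simp: M_def)
  have "(\<Sum>m\<in>{a+1..M}. f m) \<le> G M - G a"
    using aM
  proof (induction M rule: int_ge_induct)
    case (step i)
    have "{a+1..i+1} = insert (i+1) {a+1..i}" using step by auto
    then show ?case using step assms(1)[of "i+1"] by simp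
  qed simp
  moreover have "sum f F \<le> (\<Sum>m\<in>{a+1..M}. f m)"
    using FM F assms(2) by (intro sum_mono2) auto
  ultimately show "sum f F \<le> L - G a" using assms(3)[OF aM] by linarith
qed

section \<open>Power sums over the integers\<close>

text \<open>The exponent is a rate of decay, so a negative \<open>p\<close> gives a growing weight,
  used to express moments. The added 1 avoids an exception at 0.\<close>

definition wt :: "real \<Rightarrow> int \<Rightarrow> real" where
  "wt p m = (1 + \<bar>real_of_int m\<bar>) powr (- p)"

lemma wt_pos: "0 < wt p m" and wt_nonneg [simp]: "0 \<le> wt p m"
  by (auto simp: wt_def)

lemma wt_minus [simp]: "wt p (- m) = wt p m"
  by (simp add: wt_def)

lemma wt_commute: "wt p (m - k) = wt p (k - m)"
  using wt_minus[of p "k - m"] by simp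

lemma wt_add: "wt (p + q) m = wt p m * wt q m"
  by (simp add: wt_def powr_add[symmetric])

lemma wt_0_left [simp]: "wt 0 m = 1" and wt_0_right [simp]: "wt p 0 = 1"
  by (auto simp: wt_def)

lemma wt_1: "wt 1 m = 1 / (1 + \<bar>real_of_int m\<bar>)"
  by (simp add: wt_def powr_minus divide_simps)

lemma wt_le_1: "0 \<le> p \<Longrightarrow> wt p m \<le> 1"
  using powr_mono2'[of "- p" 1 "1 + \<bar>real_of_int m\<bar>"] by (simp add: wt_def)

lemma wt_antimono_exp: "p \<le> q \<Longrightarrow> wt q m \<le> wt p m"
  unfolding wt_def by (intro powr_mono) auto

lemma wt_antimono: "0 \<le> p \<Longrightarrow> \<bar>k\<bar> \<le> \<bar>m\<bar> \<Longrightarrow> wt p m \<le> wt p k"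
  unfolding wt_def by (intro powr_mono2') auto

text \<open>Peetre's inequality, from the submultiplicativity of \<open>1 + \<bar>m\<bar>\<close>.
  It carries a weight through a convolution at the cost of a moment of the other factor.\<close>

lemma wt_shift:
  assumes "0 \<le> p"
  shows "wt p m \<le> wt (- p) s * wt p (m + s)"
proof -
  have "1 + \<bar>real_of_int (m + s)\<bar> \<le> (1 + \<bar>real_of_int m\<bar>) * (1 + \<bar>real_of_int s\<bar>)"
    by (simp add: algebra_simps) (smt (verit) abs_ge_zero mult_nonneg_nonneg)
  then have "((1 + \<bar>real_of_int m\<bar>) * (1 + \<bar>real_of_int s\<bar>)) powr (- p) \<le> wt p (m + s)"
    unfolding wt_def using assms by (intro powr_mono2') auto
  then have "wt p m * wt p s \<le> wt p (m + s)" by (simp add: wt_def powr_mult)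
  then have "wt p m * wt p s * wt (-p) s \<le> wt p (m + s) * wt (-p) s"
    by (intro mult_right_mono) auto
  moreover have "wt p s * wt (-p) s = 1" by (simp flip: wt_add)
  ultimately show ?thesis by (metis mult.assoc mult.commute mult_1_right)
qed

text \<open>Differentiability is asked for in the open interval because the primitives in use have
  infinite slope at 0, which may be the left endpoint.\<close>

lemma increment_ge:
  fixes G G' :: "real \<Rightarrow> real"
  assumes "a < b" "continuous_on {a..b} G"
    "\<And>x. a < x \<Longrightarrow> x < b \<Longrightarrow> (G has_real_derivative G' x) (at x)"
    "\<And>x. a < x \<Longrightarrow> x < b \<Longrightarrow> L \<le> G' x"
  shows "L * (b - a) \<le> G b - G a"
proof -
  obtain l z where z: "a < z" "z < b" "(G has_real_derivative l) (at z)" "G b - G a = (b - a) * l"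
    using MVT[OF assms(1,2)] assms(3) by (metis real_differentiable_def)
  then have "l = G' z" using assms(3)[of z] DERIV_unique by blast
  then show ?thesis using z assms(1,4) by (simp add: mult.commute mult_left_mono)
qed

lemma powr_increment_gt:
  fixes x p :: real
  assumes "0 < x" "1 < p"
  shows "(x + 1) powr (- p) \<le> (x powr (1 - p) - (x + 1) powr (1 - p)) / (p - 1)"
proof -
  have "(x + 1) powr (- p) * (x + 1 - x) \<le> (x + 1) powr (1 - p) / (1 - p) - x powr (1 - p) / (1 - p)"
  proof (rule increment_ge[where G' = "\<lambda>y. y powr (- p)"])
    show "continuous_on {x..x+1} (\<lambda>y. y powr (1 - p) / (1 - p))"
      using assms by (intro continuous_intros) auto
    show "((\<lambda>y. y powr (1 - p) / (1 - p)) has_real_derivative y powr (- p)) (at y)"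
      if "x < y" "y < x + 1" for y
      using assms that by (auto intro!: derivative_eq_intros)
    show "(x + 1) powr (- p) \<le> y powr (- p)" if "x < y" "y < x + 1" for y
      using assms that by (intro powr_mono2') auto
  qed auto
  also have "\<dots> = (x powr (1 - p) - (x + 1) powr (1 - p)) / (p - 1)"
    unfolding diff_divide_distrib[symmetric] by (subst minus_divide_divide[symmetric]) simp
  finally show ?thesis by simp
qed

lemma powr_increment_lt:
  fixes x p :: real
  assumes "0 \<le> x" "0 \<le> p" "p < 1"
  shows "(x + 1) powr (- p) \<le> ((x + 1) powr (1 - p) - x powr (1 - p)) / (1 - p)"
proof -
  have "(x + 1) powr (- p) * (x + 1 - x) \<le> (x + 1) powr (1 - p) / (1 - p) - x powr (1 - p) / (1 - p)"
  proof (rule increment_ge[where G' = "\<lambda>y. y powr (- p)"])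
    show "continuous_on {x..x+1} (\<lambda>y. y powr (1 - p) / (1 - p))"
      using assms by (intro continuous_intros continuous_on_powr') auto
    show "((\<lambda>y. y powr (1 - p) / (1 - p)) has_real_derivative y powr (- p)) (at y)"
      if "x < y" "y < x + 1" for y
      using assms that by (auto intro!: derivative_eq_intros)
    show "(x + 1) powr (- p) \<le> y powr (- p)" if "x < y" "y < x + 1" for y
      using assms that by (intro powr_mono2') auto
  qed auto
  then show ?thesis by (simp add: diff_divide_distrib)
qed

lemma psum_le_wt_tail:
  assumes "1 < p" "0 \<le> s"
  shows "psum_le (\<lambda>k. wt p (s + k)) {0..} (p / (p - 1) * wt (p - 1) s)"
proof -
  define G :: "int \<Rightarrow> real" where "G k = - ((1 + real_of_int (s + k)) powr (1 - p)) / (p - 1)" for k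
  have "psum_le (\<lambda>k. wt p (s + k)) {0<..} (0 - G 0)"
  proof (rule psum_le_telescope)
    fix m :: int assume m: "0 < m"
    show "wt p (s + m) \<le> G m - G (m - 1)"
      using powr_increment_gt[of "real_of_int (s + m)" p] assms m
      by (simp add: wt_def G_def diff_divide_distrib add_ac)
  qed (use assms in \<open>auto simp: G_def\<close>)
  then have "psum_le (\<lambda>k. wt p (s + k)) ({0} \<union> {0<..}) (wt p s + (0 - G 0))"
    using psum_le_finite[of "{0}" "\<lambda>k. wt p (s + k)"] by (intro psum_le_union) auto
  moreover have "{0} \<union> {0<..} = {0::int..}" by auto
  \<comment> \<open>The term \<open>k = 0\<close> costs 1 and the integral costs
    \<open>1 / (p - 1)\<close>, both in units of \<open>wt (p - 1) s\<close>.\<close>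
  moreover have "wt p s + (0 - G 0) \<le> p / (p - 1) * wt (p - 1) s"
  proof -
    have "0 - G 0 = wt (p - 1) s / (p - 1)" using assms by (simp add: G_def wt_def)
    moreover have "wt p s \<le> wt (p - 1) s" by (intro wt_antimono_exp) auto
    moreover have "p / (p - 1) = 1 + 1 / (p - 1)" using assms by (simp add: field_simps)
    ultimately show ?thesis by (simp add: algebra_simps)
  qed
  ultimately show ?thesis by (metis psum_le_mono order_refl)
qed

lemma psum_le_wt_UNIV:
  assumes "1 < p"
  shows "psum_le (wt p) UNIV (2 * (p / (p - 1)))"
proof -
  have a: "psum_le (wt p) {0..} (p / (p - 1))" using psum_le_wt_tail[OF assms, of 0] by simp
  have "psum_le (\<lambda>k. wt p (- k)) {..0} (p / (p - 1))"
    by (rule psum_le_reindex[OF _ a]) auto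
  then have "psum_le (wt p) ({0..} \<union> {..0}) (p / (p - 1) + p / (p - 1))"
    using a by (intro psum_le_union) auto
  moreover have "{0::int..} \<union> {..0} = UNIV" by auto
  ultimately show ?thesis by simp
qed

lemma sum_wt_le:
  assumes "0 \<le> p" "p < 1" "0 \<le> n"
  shows "(\<Sum>t\<in>{0..n}. wt p t) \<le> 1 / (1 - p) * wt (p - 1) n"
proof -
  have "(\<Sum>t\<in>{0..n}. wt p t) \<le> (1 + real_of_int n) powr (1 - p) / (1 - p)"
    using assms(3)
  proof (induction n rule: int_ge_induct)
    case base
    show ?case using assms by (auto simp: field_simps)
  next
    case (step i)
    have "{0..i+1} = insert (i+1) {0..i}" using step by auto
    then show ?case using step powr_increment_lt[of "1 + real_of_int i" p] assms
      by (simp add: wt_def diff_divide_distrib add_ac)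
  qed
  then show ?thesis using assms by (simp add: wt_def)
qed

text \<open>A discrete beta integral, split in the middle: on each half one of the two weights is
  comparable with its value at \<open>n\<close> and the other one is summed. The threshold
  \<open>n - 1\<close> matches the 1 inside \<open>wt\<close>, as it gives
  \<open>1 + t \<ge> (1 + n) / 2\<close>.\<close>

lemma sum_wt_beta:
  assumes "0 \<le> p" "p < 1" "0 \<le> q" "q < 1" "0 \<le> n"
  shows "(\<Sum>t\<in>{0..n}. wt p t * wt q (n - t)) \<le> (2 powr p / (1 - q) + 2 powr q / (1 - p)) * wt (p + q - 1) n"
proof -
  have half: "wt r t \<le> 2 powr r * wt r n" if "2 * t \<ge> n - 1" "0 \<le> r" "0 \<le> t" for r t
  proof -
    have "wt r t \<le> ((1 + real_of_int n) / 2) powr (- r)"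
      unfolding wt_def using that assms by (intro powr_mono2') auto
    also have "\<dots> = 2 powr r * wt r n"
      using assms by (simp add: powr_divide wt_def powr_minus field_simps)
    finally show ?thesis .
  qed
  have le: "wt p t * wt q (n - t) \<le> 2 powr p * wt p n * wt q (n - t) + 2 powr q * wt q n * wt p t"
    if "t \<in> {0..n}" for t
  proof (cases "2 * t \<ge> n - 1")
    case True
    have "wt p t * wt q (n - t) \<le> (2 powr p * wt p n) * wt q (n - t)"
      using half[OF True assms(1)] that by (intro mult_right_mono) auto
    then show ?thesis by (auto intro!: add_increasing2)
  next
    case False
    have "wt q (n - t) * wt p t \<le> (2 powr q * wt q n) * wt p t"
      using half[of "n - t" q] that assms False by (intro mult_right_mono) auto
    then show ?thesis by (subst mult.commute) (auto intro!: add_increasing)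
  qed
  have refl: "(\<Sum>t\<in>{0..n}. wt q (n - t)) = (\<Sum>t\<in>{0..n}. wt q t)"
    by (rule sum.reindex_bij_witness[of _ "\<lambda>t. n - t" "\<lambda>t. n - t"]) auto
  have "(\<Sum>t\<in>{0..n}. wt p t * wt q (n - t)) \<le>
      2 powr p * wt p n * (\<Sum>t\<in>{0..n}. wt q t) + 2 powr q * wt q n * (\<Sum>t\<in>{0..n}. wt p t)"
    unfolding refl[symmetric] sum_distrib_left sum.distrib[symmetric]
    by (intro sum_mono le)
  also have "\<dots> \<le> 2 powr p * wt p n * (1 / (1 - q) * wt (q - 1) n) + 2 powr q * wt q n * (1 / (1 - p) * wt (p - 1) n)"
    using assms by (intro add_mono mult_left_mono sum_wt_le) auto
  also have "\<dots> = 2 powr p / (1 - q) * (wt p n * wt (q - 1) n) + 2 powr q / (1 - p) * (wt q n * wt (p - 1) n)"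
    by simp
  also have "\<dots> = (2 powr p / (1 - q) + 2 powr q / (1 - p)) * wt (p + q - 1) n"
    by (simp add: algebra_simps flip: wt_add)
  finally show ?thesis .
qed

text \<open>The crossover is at \<open>j = n\<close>. Before it the second weight is frozen at
  \<open>wt q n\<close>; after it both weights are measured from \<open>j\<close>, and
  \<open>p + q > 1\<close> makes the rest summable.\<close>

lemma psum_le_wt_cross:
  assumes "0 \<le> p" "p < 1" "0 \<le> q" "1 < p + q" "0 \<le> n"
  shows "psum_le (\<lambda>j. wt p j * wt q (n + j)) {0..} ((1 / (1 - p) + (p + q) / (p + q - 1)) * wt (p + q - 1) n)"
proof -
  have "psum_le (\<lambda>j. wt p j * wt q (n + j)) {0..n} (1 / (1 - p) * wt (p + q - 1) n)"
  proof -
    have "(\<Sum>j\<in>{0..n}. wt p j * wt q (n + j)) \<le> (\<Sum>j\<in>{0..n}. wt p j) * wt q n"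
      unfolding sum_distrib_right using assms by (intro sum_mono mult_left_mono wt_antimono) auto
    also have "\<dots> \<le> 1 / (1 - p) * wt (p - 1) n * wt q n"
      using assms by (intro mult_right_mono sum_wt_le) auto
    also have "\<dots> = 1 / (1 - p) * wt (p + q - 1) n"
      by (simp flip: wt_add add: algebra_simps)
    finally show ?thesis
      using psum_le_finite[of "{0..n}" "\<lambda>j. wt p j * wt q (n + j)"] by (auto intro: psum_le_mono)
  qed
  moreover have "psum_le (\<lambda>j. wt p j * wt q (n + j)) {n..} ((p + q) / (p + q - 1) * wt (p + q - 1) n)"
  proof (rule psum_le_mono[where g = "\<lambda>j. wt (p + q) (n + (j - n))"])
    show "psum_le (\<lambda>j. wt (p + q) (n + (j - n))) {n..} ((p + q) / (p + q - 1) * wt (p + q - 1) n)"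
      using assms by (intro psum_le_reindex[OF _ psum_le_wt_tail]) (auto simp: inj_on_def)
    show "wt p j * wt q (n + j) \<le> wt (p + q) (n + (j - n))" if "j \<in> {n..}" for j
      using assms that unfolding wt_add by (intro mult_mono wt_antimono) auto
  qed auto
  ultimately have "psum_le (\<lambda>j. wt p j * wt q (n + j)) ({0..n} \<union> {n..})
     (1 / (1 - p) * wt (p + q - 1) n + (p + q) / (p + q - 1) * wt (p + q - 1) n)"
    by (intro psum_le_union) auto
  moreover have "{0..n} \<union> {n..} = {0..}" using assms by auto
  ultimately show ?thesis by (simp add: algebra_simps)
qed

text \<open>Hilbert's inequality for the weight \<open>m powr (-1/2)\<close>, with its sharp constant; the
  derivative of \<open>2 / sqrt M * arctan (sqrt (x / M))\<close> is \<open>1 / (sqrt x * (x + M))\<close>.\<close>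
lemma psum_le_hilbert:
  fixes M :: real
  assumes "0 < M"
  shows "psum_le (\<lambda>m. 1 / (sqrt (real_of_int m) * (real_of_int m + M))) {0<..} (pi / sqrt M)"
proof -
  define G :: "real \<Rightarrow> real" where "G x = 2 / sqrt M * arctan (sqrt x * (1 / sqrt M))" for x
  have "psum_le (\<lambda>m. 1 / (sqrt (real_of_int m) * (real_of_int m + M))) {0<..} (pi / sqrt M - G (real_of_int 0))"
  proof (rule psum_le_telescope)
    fix m :: int assume m: "0 < m"
    have "1 / (sqrt m * (m + M)) * (real_of_int m - (real_of_int m - 1)) \<le> G (real_of_int m) - G (real_of_int m - 1)"
    proof (rule increment_ge[where G' = "\<lambda>x. 1 / (sqrt x * (x + M))"])
      \<comment> \<open>For \<open>m = 1\<close> the interval begins at 0, where the derivative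
        blows up but \<open>G\<close> is still continuous.\<close>
      show "continuous_on {real_of_int m - 1..real_of_int m} G"
        unfolding G_def using assms m by (intro continuous_intros) auto
      show "(G has_real_derivative 1 / (sqrt x * (x + M))) (at x)"
        if "real_of_int m - 1 < x" "x < real_of_int m" for x
      proof -
        have x: "0 < x" using that m by linarith
        have "(G has_real_derivative 2 / sqrt M * (inverse (1 + (sqrt x * (1 / sqrt M))\<^sup>2) * (inverse (sqrt x) / 2 * (1 / sqrt M)))) (at x)"
        proof -
          have "((\<lambda>x. 2 * c * arctan (sqrt x * c)) has_real_derivative
              2 * c * (inverse (1 + (sqrt x * c)\<^sup>2) * (inverse (sqrt x) / 2 * c))) (at x)" for c
            using x by (auto intro!: derivative_eq_intros)
          from this[of "1 / sqrt M"] show ?thesis by (simp add: G_def[abs_def])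
        qed
        also have "2 / sqrt M * (inverse (1 + (sqrt x * (1 / sqrt M))\<^sup>2) * (inverse (sqrt x) / 2 * (1 / sqrt M))) = 1 / (sqrt x * (x + M))"
        proof -
          have "2 / c * (inverse (1 + (e * (1 / c))\<^sup>2) * (inverse e / 2 * (1 / c))) = 1 / (e * (e\<^sup>2 + c\<^sup>2))"
            if "0 < c" "0 < e" for c e :: real
          proof -
            have "1 + (e * (1 / c))\<^sup>2 = (e\<^sup>2 + c\<^sup>2) / c\<^sup>2" using that by (simp add: field_simps)
            then show ?thesis using that by (simp add: power2_eq_square inverse_eq_divide)
          qed
          from this[of "sqrt M" "sqrt x"] show ?thesis using x assms by simp
        qed
        finally show ?thesis .
      qed
      show "1 / (sqrt m * (m + M)) \<le> 1 / (sqrt x * (x + M))"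
        if "real_of_int m - 1 < x" "x < real_of_int m" for x
        using that m assms by (intro divide_left_mono mult_mono mult_pos_pos) auto
    qed auto
    then show "1 / (sqrt m * (m + M)) \<le> G (real_of_int m) - G (real_of_int (m - 1))" by simp
  next
    fix m :: int
    show "G (real_of_int m) \<le> pi / sqrt M"
      using arctan_ubound[of "sqrt m / sqrt M"] assms
      by (simp add: G_def divide_le_cancel mult.commute)
  qed (use assms in auto)
  then show ?thesis by (simp add: G_def)
qed

text \<open>One power of the weight is the Hilbert kernel with \<open>M = 1 + s\<close>; the surplus
  \<open>wt d\<close> is frozen at its value at \<open>s\<close>.\<close>

lemma psum_le_sqrt_wt:
  assumes "0 < d" "0 \<le> s"
  shows "psum_le (\<lambda>m. 1 / sqrt (real_of_int m) * wt (1 + d) (m + s)) {0<..} (pi * wt (1 / 2 + d) s)"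
proof (rule psum_le_mono[where g = "\<lambda>m. wt d s * (1 / (sqrt (real_of_int m) * (real_of_int m + (1 + real_of_int s))))"])
  show "psum_le (\<lambda>m. wt d s * (1 / (sqrt (real_of_int m) * (real_of_int m + (1 + real_of_int s))))) {0<..} (wt d s * (pi / sqrt (1 + real_of_int s)))"
    using assms by (intro psum_le_cmult psum_le_hilbert) auto
  show "1 / sqrt (real_of_int m) * wt (1 + d) (m + s) \<le> wt d s * (1 / (sqrt m * (m + (1 + real_of_int s))))"
    if "m \<in> {0<..}" for m
  proof -
    have "1 / sqrt (real_of_int m) * wt (1 + d) (m + s) = wt d (m + s) * (1 / (sqrt m * (m + (1 + real_of_int s))))"
      using that assms by (simp add: wt_add wt_1 add_ac)
    also have "\<dots> \<le> wt d s * (1 / (sqrt m * (m + (1 + real_of_int s))))"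
      using that assms by (intro mult_right_mono wt_antimono) auto
    finally show ?thesis .
  qed
  show "wt d s * (pi / sqrt (1 + real_of_int s)) \<le> pi * wt (1 / 2 + d) s"
    using assms by (simp add: wt_add) (simp add: wt_def powr_minus powr_half_sqrt field_simps)
qed

section \<open>Square matrices with the Frobenius norm\<close>

lemma norm_sq_mat:
  fixes A :: "'q::finite cmat"
  shows "(norm A)\<^sup>2 = (\<Sum>i\<in>UNIV. \<Sum>j\<in>UNIV. (cmod (A $ i $ j))\<^sup>2)"
  by (simp add: norm_vec_def L2_set_def sum_nonneg)

lemma norm_mat_mult_le:
  fixes A B :: "'q::finite cmat"
  shows "norm (A ** B) \<le> norm A * norm B"
proof (rule power2_le_imp_le)
  have "(cmod ((A ** B) $ i $ j))\<^sup>2 \<le> (\<Sum>k\<in>UNIV. (cmod (A $ i $ k))\<^sup>2) * (\<Sum>k\<in>UNIV. (cmod (B $ k $ j))\<^sup>2)" for i j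
  proof -
    have "cmod ((A ** B) $ i $ j) \<le> (\<Sum>k\<in>UNIV. \<bar>cmod (A $ i $ k)\<bar> * \<bar>cmod (B $ k $ j)\<bar>)"
      unfolding matrix_matrix_mult_def by (auto intro!: sum_norm_le simp: norm_mult)
    also have "\<dots> \<le> L2_set (\<lambda>k. cmod (A $ i $ k)) UNIV * L2_set (\<lambda>k. cmod (B $ k $ j)) UNIV"
      by (rule L2_set_mult_ineq)
    finally have "(cmod ((A ** B) $ i $ j))\<^sup>2 \<le> (L2_set (\<lambda>k. cmod (A $ i $ k)) UNIV * L2_set (\<lambda>k. cmod (B $ k $ j)) UNIV)\<^sup>2"
      by (intro power_mono) auto
    then show ?thesis by (simp add: power_mult_distrib L2_set_def sum_nonneg)
  qed
  then have "(norm (A ** B))\<^sup>2 \<le> (\<Sum>i\<in>UNIV. \<Sum>j\<in>UNIV. (\<Sum>k\<in>UNIV. (cmod (A $ i $ k))\<^sup>2) * (\<Sum>k\<in>UNIV. (cmod (B $ k $ j))\<^sup>2))"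
    unfolding norm_sq_mat by (intro sum_mono)
  also have "\<dots> = (\<Sum>i\<in>UNIV. \<Sum>k\<in>UNIV. (cmod (A $ i $ k))\<^sup>2) * (\<Sum>j\<in>UNIV. \<Sum>k\<in>UNIV. (cmod (B $ k $ j))\<^sup>2)"
    by (simp add: sum_product)
  also have "(\<Sum>j\<in>UNIV. \<Sum>k\<in>UNIV. (cmod (B $ k $ j))\<^sup>2) = (\<Sum>k\<in>UNIV. \<Sum>j\<in>UNIV. (cmod (B $ k $ j))\<^sup>2)"
    by (rule sum.swap)
  finally show "(norm (A ** B))\<^sup>2 \<le> (norm A * norm B)\<^sup>2"
    by (simp add: norm_sq_mat power_mult_distrib)
qed simp

lemma norm_mat_mult_le':
  fixes A B :: "'q::finite cmat"
  assumes "norm A \<le> x" "norm B \<le> y"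
  shows "norm (A ** B) \<le> x * y"
  using norm_mat_mult_le[of A B] mult_mono[OF assms] norm_ge_zero
  by (meson assms(1) order_trans)

lemma norm_mat_mult_le3:
  fixes A B C :: "'q::finite cmat"
  assumes "norm A \<le> x" "norm B \<le> y" "norm C \<le> z"
  shows "norm (A ** B ** C) \<le> x * y * z"
  by (intro norm_mat_mult_le' assms)

lemma bounded_bilinear_mat_mult: "bounded_bilinear ((**) :: 'q::finite cmat \<Rightarrow> 'q cmat \<Rightarrow> 'q cmat)"
proof
  fix a a' b b' :: "'q cmat" and r :: real
  show "(a + a') ** b = a ** b + a' ** b"
    by (simp add: matrix_matrix_mult_def vec_eq_iff sum.distrib distrib_right)
  show "a ** (b + b') = a ** b + a ** b'"
    by (simp add: matrix_matrix_mult_def vec_eq_iff sum.distrib distrib_left)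
  show "(r *\<^sub>R a) ** b = r *\<^sub>R (a ** b)"
    by (simp add: matrix_matrix_mult_def vec_eq_iff scaleR_sum_right)
  show "a ** (r *\<^sub>R b) = r *\<^sub>R (a ** b)"
    by (simp add: matrix_matrix_mult_def vec_eq_iff scaleR_sum_right)
  show "\<exists>K. \<forall>(a::'q cmat) (b::'q cmat). norm (a ** b) \<le> norm a * norm b * K"
    by (rule exI[of _ 1]) (simp add: norm_mat_mult_le)
qed

interpretation mat: bounded_bilinear "(**) :: 'q::finite cmat \<Rightarrow> 'q cmat \<Rightarrow> 'q cmat"
  by (rule bounded_bilinear_mat_mult)

lemmas mat_simps = mat.add_left mat.add_right mat.diff_left mat.diff_right
  mat.minus_left mat.minus_right mat.zero_left mat.zero_right

lemma herm_mult: "herm (A ** B) = herm B ** herm A"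
  by (simp add: herm_def matrix_matrix_mult_def vec_eq_iff mult.commute)

lemma herm_herm [simp]: "herm (herm A) = A"
  by (simp add: herm_def vec_eq_iff)

lemma herm_mat_1 [simp]: "herm (mat 1) = mat 1"
  by (simp add: herm_def mat_def vec_eq_iff)

lemma norm_herm [simp]: "norm (herm A) = norm A"
proof -
  have "(norm (herm A))\<^sup>2 = (norm A)\<^sup>2"
    unfolding norm_sq_mat herm_def by (subst sum.swap) simp
  then show ?thesis by simp
qed

lemma bounded_linear_herm: "bounded_linear (herm :: 'q::finite cmat \<Rightarrow> 'q cmat)"
  by (rule bounded_linear_intro[where K = 1]) (auto simp del: norm_herm simp: herm_def vec_eq_iff, metis herm_def norm_herm order_refl)

lemma herm_0 [simp]: "herm 0 = 0" and herm_add: "herm (A + B) = herm A + herm B"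
  and herm_diff: "herm (A - B) = herm A - herm B" and herm_minus: "herm (- A) = - herm A"
  and herm_scaleR: "herm (r *\<^sub>R A) = r *\<^sub>R herm A"
  by (auto simp: herm_def vec_eq_iff)

lemma
  fixes B :: "'q::finite cmat"
  shows infsum_mat_left: "f summable_on A \<Longrightarrow> infsum (\<lambda>x. f x ** B) A = infsum f A ** B"
  and infsum_mat_right:
  "f summable_on A \<Longrightarrow> infsum (\<lambda>x. B ** f x) A = B ** infsum f A"
  and summable_mat_left: "f summable_on A \<Longrightarrow> (\<lambda>x. f x ** B) summable_on A"
  and infsum_herm: "f summable_on A \<Longrightarrow> infsum (\<lambda>x. herm (f x)) A = herm (infsum f A)"
  by (auto intro!: infsumI has_sum_bounded_linear[OF mat.bounded_linear_left]
      has_sum_bounded_linear[OF mat.bounded_linear_right] has_sum_bounded_linear[OF bounded_linear_herm]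
      summable_on_bounded_linear[OF mat.bounded_linear_left])

text \<open>Turns unitary invariance, and later the positivity of a Gram sum, into matrix
  algebra.\<close>

lemma norm_sq_trace:
  fixes Y :: "'q::finite cmat"
  shows "complex_of_real ((norm Y)\<^sup>2) = (\<Sum>i\<in>UNIV. (herm Y ** Y) $ i $ i)"
proof -
  have "complex_of_real ((norm Y)\<^sup>2) = (\<Sum>i\<in>UNIV. \<Sum>j\<in>UNIV. cnj (Y $ j $ i) * Y $ j $ i)"
    unfolding norm_sq_mat by (subst sum.swap) (simp add: complex_norm_square[symmetric] mult.commute del: of_real_power)
  then show ?thesis by (simp add: matrix_matrix_mult_def herm_def)
qed

text \<open>The reason why the bounds on the phase coefficients are stated for products with an
  arbitrary matrix: a unitary matrix has Frobenius norm \<open>sqrt q\<close>, which would destroy a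
  contraction factor close to 1, but multiplication by it is isometric.\<close>

lemma norm_unitary_mult:
  fixes U X :: "'q::finite cmat"
  assumes "herm U ** U = mat 1"
  shows "norm (U ** X) = norm X"
proof -
  have "herm (U ** X) ** (U ** X) = herm X ** (herm U ** U) ** X"
    by (simp only: herm_mult matrix_mul_assoc)
  also have "\<dots> = herm X ** X" using assms by simp
  finally have "complex_of_real ((norm (U ** X))\<^sup>2) = complex_of_real ((norm X)\<^sup>2)"
    unfolding norm_sq_trace by simp
  then have "(norm (U ** X))\<^sup>2 = (norm X)\<^sup>2" by (simp only: of_real_eq_iff)
  then show ?thesis by simp
qed

lemma norm_mat_vec_le:
  fixes A :: "'q::finite cmat"
  shows "norm (A *v x) \<le> norm A * norm x"
proof (rule power2_le_imp_le)
  have "(cmod ((A *v x) $ i))\<^sup>2 \<le> (\<Sum>k\<in>UNIV. (cmod (A $ i $ k))\<^sup>2) * (norm x)\<^sup>2" for i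
  proof -
    have "cmod ((A *v x) $ i) \<le> (\<Sum>k\<in>UNIV. \<bar>cmod (A $ i $ k)\<bar> * \<bar>cmod (x $ k)\<bar>)"
      unfolding matrix_vector_mult_def by (auto intro!: sum_norm_le simp: norm_mult)
    also have "\<dots> \<le> L2_set (\<lambda>k. cmod (A $ i $ k)) UNIV * L2_set (\<lambda>k. cmod (x $ k)) UNIV"
      by (rule L2_set_mult_ineq)
    finally have "(cmod ((A *v x) $ i))\<^sup>2 \<le> (L2_set (\<lambda>k. cmod (A $ i $ k)) UNIV * L2_set (\<lambda>k. cmod (x $ k)) UNIV)\<^sup>2"
      by (intro power_mono) auto
    then show ?thesis by (simp add: power_mult_distrib L2_set_def sum_nonneg norm_vec_def)
  qed
  then have "(\<Sum>i\<in>UNIV. (cmod ((A *v x) $ i))\<^sup>2) \<le> (\<Sum>i\<in>UNIV. (\<Sum>k\<in>UNIV. (cmod (A $ i $ k))\<^sup>2) * (norm x)\<^sup>2)"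
    by (intro sum_mono)
  also have "\<dots> = (norm A * norm x)\<^sup>2"
    unfolding power_mult_distrib norm_sq_mat by (rule sum_distrib_right[symmetric])
  finally show "(norm (A *v x))\<^sup>2 \<le> (norm A * norm x)\<^sup>2"
    by (simp add: norm_vec_def L2_set_def sum_nonneg)
qed simp

lemma spectral_norm_le: "spectral_norm A \<le> norm A"
  unfolding spectral_norm_def by (rule onorm_le) (simp add: norm_mat_vec_le)

lemma bounded_linear_mat_vec:
  fixes A :: "'q::finite cmat"
  shows "bounded_linear (\<lambda>x. A *v x)"
proof (rule bounded_linear_intro[where K = "norm A"])
  show "A *v (r *\<^sub>R x) = r *\<^sub>R (A *v x)" for r x
    by (simp add: matrix_vector_mult_def vec_eq_iff scaleR_sum_right)
qed (auto simp: matrix_vector_right_distrib norm_mat_vec_le mult.commute[of _ "norm A"])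

lemma spectral_norm_nonneg [simp]: "0 \<le> spectral_norm A"
  unfolding spectral_norm_def by (intro onorm_pos_le bounded_linear_mat_vec)

text \<open>Each entry is a coordinate of the image of a unit vector; there are \<open>q * q\<close>
  entries.\<close>

lemma norm_le_spectral_norm:
  fixes A :: "'q::finite cmat"
  shows "norm A \<le> real CARD('q) * spectral_norm A"
proof -
  have e: "cmod (A $ i $ j) \<le> spectral_norm A" for i j
  proof -
    have "A *v axis j 1 = (\<chi> i. A $ i $ j)"
      by (simp add: matrix_vector_mult_def axis_def vec_eq_iff if_distrib cong: if_cong)
    then have "cmod (A $ i $ j) \<le> norm (A *v axis j 1)"
      using Finite_Cartesian_Product.norm_nth_le[of "A *v axis j 1" i] by simp
    also have "\<dots> \<le> spectral_norm A * norm (axis j 1 :: complex^'q)"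
      unfolding spectral_norm_def by (rule onorm[OF bounded_linear_mat_vec])
    also have "norm (axis j 1 :: complex^'q) = 1"
      by (simp add: norm_vec_def L2_set_def axis_def if_distrib[of norm] if_distrib[of "\<lambda>x. x\<^sup>2"] cong: if_cong)
    finally show ?thesis by simp
  qed
  have "(norm A)\<^sup>2 \<le> (\<Sum>i\<in>(UNIV::'q set). \<Sum>j\<in>(UNIV::'q set). (spectral_norm A)\<^sup>2)"
    unfolding norm_sq_mat by (intro sum_mono power_mono e) auto
  also have "\<dots> = (real CARD('q) * spectral_norm A)\<^sup>2" by (simp add: power2_eq_square)
  finally show ?thesis by (rule power2_le_imp_le) simp
qed

section \<open>Convolution identities for a matrix symbol with two factorizations\<close>

lemma psum_le_shift: "psum_le f UNIV C \<Longrightarrow> psum_le (\<lambda>k. f (k + j)) UNIV C"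
  and psum_le_shift_minus: "psum_le f UNIV C \<Longrightarrow> psum_le (\<lambda>k. f (k - j)) UNIV C"
  and psum_le_reflect: "psum_le f UNIV C \<Longrightarrow> psum_le (\<lambda>k. f (j - k)) UNIV C"
  for j :: int
  by (rule psum_le_reindex; auto simp: inj_on_def)+

lemma infsum_shift: "infsum (\<lambda>k. f (k + j)) UNIV = infsum f UNIV" for j :: int
  by (rule infsum_reindex_bij_witness[of _ "\<lambda>k. k - j" "\<lambda>k. k + j"]) auto

lemma infsum_reflect: "infsum (\<lambda>k. f (j - k)) UNIV = infsum f UNIV" for j :: int
  by (rule infsum_reindex_bij_witness[of _ "\<lambda>k. j - k" "\<lambda>k. j - k"]) auto

lemma summable_shift: "(\<lambda>k. f (k + j)) summable_on UNIV \<longleftrightarrow> f summable_on UNIV" for j :: int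
  by (rule summable_on_reindex_bij_witness[of _ "\<lambda>k. k - j" "\<lambda>k. k + j"]) auto

lemma infsum_delta:
  fixes f :: "'a \<Rightarrow> 'b::{comm_monoid_add, t2_space}"
  shows "infsum (\<lambda>k. if k = p then f k else 0) UNIV = f p"
proof -
  have "infsum (\<lambda>k. if k = p then f k else 0) UNIV = infsum f {p}"
    by (rule infsum_cong_neutral) auto
  then show ?thesis by simp
qed

lemma infsum_int_split:
  fixes f :: "int \<Rightarrow> 'b::banach"
  assumes "f summable_on UNIV" "0 \<le> N"
  shows "infsum f UNIV = infsum f {..0} + (\<Sum>t\<in>{1..N}. f t) + infsum f {N<..}"
proof -
  have s: "f summable_on A" for A
    using assms(1) by (rule summable_on_subset_banach) auto
  have "infsum f ({..0} \<union> {1..N} \<union> {N<..}) = infsum f ({..0} \<union> {1..N}) + infsum f {N<..}"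
    using assms(2) by (intro infsum_Un_disjoint s) auto
  also have "infsum f ({..0} \<union> {1..N}) = infsum f {..0} + infsum f {1..N}"
    by (intro infsum_Un_disjoint s) auto
  also have "{..0} \<union> {1..N} \<union> {N<..} = UNIV" using assms(2) by auto
  finally show ?thesis by simp
qed

text \<open>Associativity of a triple product with summable outer factors and a bounded middle one.
  The middle factor is in turn \<open>gam\<close>, \<open>cs\<close> and \<open>c\<close>, which are
  controlled only by non-summable powers, while the inverse factors on the outside are
  summable.\<close>

lemma mat_triple_swap:
  fixes P R :: "'a \<Rightarrow> 'q::finite cmat" and G :: "'a \<Rightarrow> 'a \<Rightarrow> 'q cmat"
  assumes P: "psum_le (\<lambda>m. norm (P m)) UNIV p" and R: "psum_le (\<lambda>m. norm (R m)) UNIV r"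
    and G: "\<And>m i. norm (G m i) \<le> g"
  shows "infsum (\<lambda>m. P m ** infsum (\<lambda>i. G m i ** R i) UNIV) UNIV
       = infsum (\<lambda>i. infsum (\<lambda>m. P m ** G m i) UNIV ** R i) UNIV"
proof -
  have g0: "0 \<le> g" using G norm_ge_zero order_trans by blast
  have sR: "(\<lambda>i. G m i ** R i) summable_on UNIV" for m
    by (rule psum_le_summable[OF psum_le_cmult[OF R g0]]) (intro norm_mat_mult_le' G order_refl)
  have sP: "(\<lambda>m. P m ** G m i) summable_on UNIV" for i
    by (rule psum_le_summable[OF psum_le_cmult[OF P g0]])
      (subst mult.commute, intro norm_mat_mult_le' G order_refl)
  have b: "psum_le (\<lambda>(m, i). norm (P m) * g * norm (R i)) (UNIV \<times> UNIV) (g * r * p)"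
  proof (rule psum_le_prodI)
    show "psum_le (\<lambda>i. norm (P m) * g * norm (R i)) UNIV (g * r * norm (P m))" for m
      using psum_le_cmult[OF R, of "norm (P m) * g"] g0 by (simp add: mult_ac)
    have "0 \<le> r" using psum_leD[OF R, of "{}"] by simp
    then show "psum_le (\<lambda>m. g * r * norm (P m)) UNIV (g * r * p)"
      using g0 by (intro psum_le_cmult P) auto
  qed (use g0 in auto)
  have "infsum (\<lambda>m. P m ** infsum (\<lambda>i. G m i ** R i) UNIV) UNIV
      = infsum (\<lambda>m. infsum (\<lambda>i. P m ** G m i ** R i) UNIV) UNIV"
    by (simp add: infsum_mat_right[OF sR, symmetric] matrix_mul_assoc)
  also have "\<dots> = infsum (\<lambda>i. infsum (\<lambda>m. P m ** G m i ** R i) UNIV) UNIV"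
    by (rule infsum_swap_psum_le, rule psum_le_mono[OF b])
      (auto intro!: norm_mat_mult_le3 G)
  also have "\<dots> = infsum (\<lambda>i. infsum (\<lambda>m. P m ** G m i) UNIV ** R i) UNIV"
    by (simp add: infsum_mat_left[OF sP])
  finally show ?thesis .
qed

lemma psum_le_mult_sq:
  assumes "psum_le (\<lambda>k. (f k)\<^sup>2) A C" "psum_le (\<lambda>k. (g k)\<^sup>2) A C"
  shows "psum_le (\<lambda>k. f k * g k) A C"
proof (rule psum_le_mono[where c = "1/2 * (C + C)"])
  show "psum_le (\<lambda>k. 1/2 * ((f k)\<^sup>2 + (g k)\<^sup>2)) A (1/2 * (C + C))"
    using assms by (intro psum_le_cmult psum_le_add) auto
  show "f x * g x \<le> 1/2 * ((f x)\<^sup>2 + (g x)\<^sup>2)" for x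
    using zero_le_power2[of "f x - g x"] by (simp add: power2_diff)
qed simp

text \<open>Here \<open>d < 1/2\<close> enters as \<open>2 - 2 d > 1\<close>: coefficients that may
  fail to be summable are still square summable.\<close>

lemma psum_le_sq_wt:
  fixes f :: "int \<Rightarrow> 'a::real_normed_vector"
  assumes d: "d < 1 / 2" and f: "\<And>k. norm (f k) \<le> K * wt (1 - d) k"
  shows "psum_le (\<lambda>k. (norm (f k))\<^sup>2) UNIV (K\<^sup>2 * (2 * ((2 - 2 * d) / (1 - 2 * d))))"
proof (rule psum_le_mono[where g = "\<lambda>k. K\<^sup>2 * wt (2 - 2 * d) k"])
  show "psum_le (\<lambda>k. K\<^sup>2 * wt (2 - 2 * d) k) UNIV (K\<^sup>2 * (2 * ((2 - 2 * d) / (1 - 2 * d))))"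
    using psum_le_wt_UNIV[of "2 - 2 * d"] d by (intro psum_le_cmult) auto
  show "(norm (f k))\<^sup>2 \<le> K\<^sup>2 * wt (2 - 2 * d) k" for k
  proof -
    have "(norm (f k))\<^sup>2 \<le> (K * wt (1 - d) k)\<^sup>2" by (intro power_mono f) auto
    then show ?thesis by (simp add: power2_eq_square mult_ac flip: wt_add)
  qed
qed simp

text \<open>The symbol equals \<open>h\<close> times its adjoint, so the inverse of the adjoint
  cancels the second factor. In coefficients \<open>gam\<close> is expanded first; the correlations
  of \<open>c\<close> are absolutely convergent uniformly in the shift, so the sum with
  \<open>al\<close> may be carried out inside.\<close>

lemma factor_of_symbol:
  fixes c al :: "int \<Rightarrow> 'q::finite cmat"
  assumes c2: "psum_le (\<lambda>k. (norm (c k))\<^sup>2) UNIV S"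
    and al1: "psum_le (\<lambda>k. norm (al k)) UNIV A"
    and inv: "\<And>k. infsum (\<lambda>m. al m ** c (k - m)) UNIV = (if k = 0 then mat 1 else 0)"
    and gam: "\<And>k. gam k = infsum (\<lambda>m. c (m + k) ** herm (c m)) UNIV"
  shows "infsum (\<lambda>m. gam (j + m) ** herm (al m)) UNIV = c j"
proof -
  have S0: "0 \<le> S" using psum_leD[OF c2, of "{}"] by simp
  have cc: "psum_le (\<lambda>p. norm (c (p + i)) * norm (c (p + k))) UNIV S" for i k
    by (rule psum_le_mult_sq) (rule psum_le_shift[OF c2])+
  have s1: "(\<lambda>p. c (p + j) ** herm (c (p - m))) summable_on UNIV" for m
    by (rule psum_le_summable[OF cc[of j "- m"]]) (auto intro!: norm_mat_mult_le')
  have s2: "(\<lambda>m. al m ** c (p - m)) summable_on UNIV" for p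
  proof (rule psum_le_summable)
    show "psum_le (\<lambda>m. (S + 1) * norm (al m)) UNIV ((S + 1) * A)"
      using S0 by (intro psum_le_cmult al1) auto
    have "(norm (c k))\<^sup>2 \<le> S" for k using psum_leD[OF c2, of "{k}"] by simp
    moreover have "S \<le> (S + 1)\<^sup>2" using S0 by (simp add: power2_eq_square algebra_simps)
    ultimately have "(norm (c k))\<^sup>2 \<le> (S + 1)\<^sup>2" for k using order_trans by blast
    then have "norm (c k) \<le> S + 1" for k
      by (rule power2_le_imp_le) (use S0 in simp)
    then show "norm (al m ** c (p - m)) \<le> (S + 1) * norm (al m)" for m
      by (subst mult.commute) (auto intro!: norm_mat_mult_le')
  qed
  have b: "psum_le (\<lambda>(m, p). norm (c (p + j)) * norm (c (p - m)) * norm (al m)) (UNIV \<times> UNIV) (S * A)"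
  proof (rule psum_le_prodI)
    show "psum_le (\<lambda>p. norm (c (p + j)) * norm (c (p - m)) * norm (al m)) UNIV (S * norm (al m))" for m
      using psum_le_cmult[OF cc[of j "- m"], of "norm (al m)"] by (simp add: mult_ac)
  qed (use S0 al1 in \<open>auto intro!: psum_le_cmult\<close>)
  have "infsum (\<lambda>m. gam (j + m) ** herm (al m)) UNIV
      = infsum (\<lambda>m. infsum (\<lambda>p. c (p + j) ** herm (c (p - m)) ** herm (al m)) UNIV) UNIV"
  proof (rule infsum_cong)
    fix m
    have "gam (j + m) = infsum (\<lambda>p. c (p + j) ** herm (c (p - m))) UNIV"
      unfolding gam using infsum_shift[of "\<lambda>p. c (p + j) ** herm (c (p - m))" m]
      by (simp add: add_ac)
    then show "gam (j + m) ** herm (al m) = infsum (\<lambda>p. c (p + j) ** herm (c (p - m)) ** herm (al m)) UNIV"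
      by (simp add: infsum_mat_left[OF s1])
  qed
  also have "\<dots> = infsum (\<lambda>p. infsum (\<lambda>m. c (p + j) ** herm (c (p - m)) ** herm (al m)) UNIV) UNIV"
    by (rule infsum_swap_psum_le, rule psum_le_mono[OF b]) (auto intro!: norm_mat_mult_le3)
  also have "\<dots> = infsum (\<lambda>p. if p = 0 then c (p + j) else 0) UNIV"
  proof (rule infsum_cong)
    fix p
    have "infsum (\<lambda>m. c (p + j) ** herm (c (p - m)) ** herm (al m)) UNIV
        = infsum (\<lambda>m. c (p + j) ** herm (al m ** c (p - m))) UNIV"
      by (simp add: herm_mult matrix_mul_assoc)
    also have "\<dots> = c (p + j) ** herm (infsum (\<lambda>m. al m ** c (p - m)) UNIV)"
      using summable_on_bounded_linear[OF bounded_linear_herm s2[of p]]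
      by (simp add: infsum_mat_right infsum_herm[OF s2])
    finally show "infsum (\<lambda>m. c (p + j) ** herm (c (p - m)) ** herm (al m)) UNIV = (if p = 0 then c (p + j) else 0)"
      by (simp add: inv)
  qed
  also have "\<dots> = c j" by (simp add: infsum_delta)
  finally show ?thesis .
qed

text \<open>Because \<open>i \<ge> j\<close>, the decay of order 1 in \<open>i - N\<close> can be
  handed over to \<open>j - N\<close>. There it raises the arbitrarily small exponent
  \<open>\<tau>\<close> above 1, and the sum over \<open>i\<close> is left to
  \<open>wt (1 + d)\<close>.\<close>

lemma psum_le_conv_wt:
  assumes "0 < d" "0 < \<tau>"
  shows "psum_le (\<lambda>(j, i). wt 1 (i - N) * (if i \<ge> j then wt (1 + d) (i - j) else 0) * wt \<tau> (j - N))
    ({N<..} \<times> {N<..}) (2 * ((1 + d) / d) * (2 * ((1 + \<tau>) / \<tau>)))"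
proof (rule psum_le_prodI)
  fix j assume j: "j \<in> {N<..}"
  show "psum_le (\<lambda>i. wt 1 (i - N) * (if i \<ge> j then wt (1 + d) (i - j) else 0) * wt \<tau> (j - N)) {N<..}
     (2 * ((1 + d) / d) * wt (1 + \<tau>) (j - N))"
  proof (rule psum_le_mono[where g = "\<lambda>i. wt (1 + \<tau>) (j - N) * wt (1 + d) (i - j)"])
    show "psum_le (\<lambda>i. wt (1 + \<tau>) (j - N) * wt (1 + d) (i - j)) {N<..} (wt (1 + \<tau>) (j - N) * (2 * ((1 + d) / d)))"
      using psum_le_shift_minus[OF psum_le_wt_UNIV[of "1 + d"], of j] assms(1)
      by (intro psum_le_cmult) (auto elim: psum_le_subset)
    show "wt 1 (i - N) * (if i \<ge> j then wt (1 + d) (i - j) else 0) * wt \<tau> (j - N) \<le> wt (1 + \<tau>) (j - N) * wt (1 + d) (i - j)"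
      if "i \<in> {N<..}" for i
    proof (cases "i \<ge> j")
      case True
      then have "wt 1 (i - N) \<le> wt 1 (j - N)" using j by (intro wt_antimono) auto
      then have "wt 1 (i - N) * (wt (1 + d) (i - j) * wt \<tau> (j - N)) \<le> wt 1 (j - N) * (wt (1 + d) (i - j) * wt \<tau> (j - N))"
        by (intro mult_right_mono) auto
      then show ?thesis using True by (simp add: wt_add[of 1 \<tau>] mult_ac)
    qed auto
  qed (simp add: mult_ac)
next
  show "psum_le (\<lambda>j. 2 * ((1 + d) / d) * wt (1 + \<tau>) (j - N)) {N<..} (2 * ((1 + d) / d) * (2 * ((1 + \<tau>) / \<tau>)))"
    using psum_le_shift_minus[OF psum_le_wt_UNIV[of "1 + \<tau>"], of N] assms
    by (intro psum_le_cmult) (auto elim: psum_le_subset)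
qed auto

text \<open>Neither \<open>P\<close> nor \<open>u\<close> need be summable, so
  \<open>mat_triple_swap\<close> does not apply. Absolute convergence is rescued by the causality of
  \<open>Q\<close> through \<open>psum_le_conv_wt\<close>.\<close>

lemma conv_tail_swap:
  fixes P Q u :: "int \<Rightarrow> 'q::finite cmat"
  assumes d: "0 < d" and \<tau>: "0 < \<tau>"
    and Q0: "\<And>m. m < 0 \<Longrightarrow> Q m = 0" and Q: "\<And>m. norm (Q m) \<le> K1 * wt (1 + d) m"
    and P: "\<And>i. N < i \<Longrightarrow> norm (P i) \<le> K2 * wt 1 (i - N)"
    and u: "\<And>j. N < j \<Longrightarrow> norm (u j) \<le> K3 * wt \<tau> (j - N)"
    and R: "\<And>j. N < j \<Longrightarrow> R j = infsum (\<lambda>i. P i ** Q (i - j)) UNIV"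
  shows "infsum (\<lambda>j. R j ** u j) {N<..} = infsum (\<lambda>i. P i ** infsum (\<lambda>j. Q (i - j) ** u j) {N<..}) {N<..}"
    and "(\<lambda>i. P i ** infsum (\<lambda>j. Q (i - j) ** u j) {N<..}) summable_on {N<..}"
proof -
  have K: "0 \<le> K1" "0 \<le> K2" "0 \<le> K3"
    using Q[of 0] P[of "N+1"] u[of "N+1"] wt_pos[of 1 1] wt_pos[of \<tau> 1]
    by (auto intro: order_trans[OF norm_ge_zero] simp: zero_le_mult_iff dest: order_trans[OF norm_ge_zero] leD)
  define D where "D = K2 * K1 * K3 * (2 * ((1 + d) / d) * (2 * ((1 + \<tau>) / \<tau>)))"
  have b: "psum_le (\<lambda>(j, i). norm (P i ** Q (i - j) ** u j)) ({N<..} \<times> {N<..}) D"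
    unfolding D_def
  proof (rule psum_le_mono[OF psum_le_cmult[OF psum_le_conv_wt[OF d \<tau>], of "K2 * K1 * K3" N]])
    fix x assume "x \<in> {N<..} \<times> {N<..}"
    then obtain j i where x: "x = (j, i)" "N < j" "N < i" by auto
    show "(case x of (j, i) \<Rightarrow> norm (P i ** Q (i - j) ** u j)) \<le> K2 * K1 * K3 *
       (case x of (j, i) \<Rightarrow> wt 1 (i - N) * (if i \<ge> j then wt (1 + d) (i - j) else 0) * wt \<tau> (j - N))"
    proof (cases "j \<le> i")
      case True
      have "norm (P i ** Q (i - j) ** u j) \<le> (K2 * wt 1 (i - N)) * (K1 * wt (1 + d) (i - j)) * (K3 * wt \<tau> (j - N))"
        by (intro norm_mat_mult_le3 P Q u x)
      with True show ?thesis by (simp add: x mult_ac)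
    qed (use K in \<open>auto simp: x Q0\<close>)
  qed (use K in auto)
  have b': "psum_le (\<lambda>(i, j). norm (P i ** Q (i - j) ** u j)) ({N<..} \<times> {N<..}) D"
    by (rule psum_le_prod_swap[OF b])
  have Qb: "norm (Q m) \<le> K1" for m
    using Q[of m] wt_le_1[of "1 + d" m] d K by (smt (verit) mult_left_le)
  have ub: "norm (u j) \<le> K3" if "N < j" for j
    using u[OF that] wt_le_1[of \<tau> "j - N"] \<tau> K by (smt (verit) mult_left_le)
  have Pb: "norm (P i) \<le> K2" if "N < i" for i
    using P[OF that] wt_le_1[of 1 "i - N"] K by (smt (verit) mult_left_le)
  have Qs: "psum_le (\<lambda>m. K1 * wt (1 + d) m) UNIV (K1 * (2 * ((1 + d) / d)))"
    using K psum_le_wt_UNIV[of "1 + d"] d by (intro psum_le_cmult) auto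
  have sPQ: "(\<lambda>i. P i ** Q (i - j)) summable_on {N<..}" for j
    by (rule psum_le_summable[OF psum_le_cmult[OF psum_le_subset[OF psum_le_shift_minus[OF Qs]] K(2)]])
      (use K in \<open>auto intro!: norm_mat_mult_le' Pb Q\<close>)
  have sQu: "(\<lambda>j. Q (i - j) ** u j) summable_on {N<..}" for i
    by (rule psum_le_summable[OF psum_le_cmult[OF psum_le_subset[OF psum_le_reflect[OF Qs]] K(3)]])
      (auto intro!: norm_mat_mult_le' ub Q simp: mult.commute[of K3])
  have "infsum (\<lambda>j. R j ** u j) {N<..} = infsum (\<lambda>j. infsum (\<lambda>i. P i ** Q (i - j) ** u j) {N<..}) {N<..}"
  proof (rule infsum_cong)
    fix j assume j: "j \<in> {N<..}"
    \<comment> \<open>Only indices \<open>i \<ge> j > N\<close> contribute, so the convolution over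
      all integers already lives on the tail.\<close>
    have "R j = infsum (\<lambda>i. P i ** Q (i - j)) {N<..}"
    proof -
      have "P i ** Q (i - j) = 0" if "i \<notin> {N<..}" for i
        using that j by (simp add: Q0 mat_simps)
      then show ?thesis using j by (subst R) (auto intro!: infsum_cong_neutral)
    qed
    then show "R j ** u j = infsum (\<lambda>i. P i ** Q (i - j) ** u j) {N<..}"
      by (simp add: infsum_mat_left[OF sPQ])
  qed
  also have "\<dots> = infsum (\<lambda>i. infsum (\<lambda>j. P i ** Q (i - j) ** u j) {N<..}) {N<..}"
    by (rule infsum_swap_psum_le[OF b])
  finally show "infsum (\<lambda>j. R j ** u j) {N<..} = infsum (\<lambda>i. P i ** infsum (\<lambda>j. Q (i - j) ** u j) {N<..}) {N<..}"
    by (simp add: infsum_mat_right[OF sQu, symmetric] matrix_mul_assoc)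
  have "(\<lambda>i. infsum (\<lambda>j. P i ** Q (i - j) ** u j) {N<..}) summable_on {N<..}"
    by (rule summable_on_Sigma_banach) (rule psum_le_summable[OF b'], auto)
  then show "(\<lambda>i. P i ** infsum (\<lambda>j. Q (i - j) ** u j) {N<..}) summable_on {N<..}"
    by (simp add: infsum_mat_right[OF sQu, symmetric] matrix_mul_assoc)
qed

text \<open>For \<open>w = h h\<^sup>* = h\<^sub>\<sharp>\<^sup>* h\<^sub>\<sharp>\<close> on the circle, \<open>c\<close>, \<open>cs\<close>, \<open>al\<close> and \<open>a\<close> are the Taylor
  coefficients of \<open>h\<close>, \<open>h\<^sub>\<sharp>\<close> and of their inverses, \<open>gam\<close> are the Fourier coefficients of \<open>w\<close>, and
  \<open>V\<close> those of the unitary phase function \<open>(h\<^sub>\<sharp>\<^sup>*)\<^sup>-\<^sup>1 h\<close>. The bound \<open>\<theta> < 1\<close> on \<open>pi * m * V (- m)\<close>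
  is what makes the Hankel blocks of \<open>V\<close> contractions.\<close>
locale symbol_factors =
  fixes d :: real and c cs al a gam V :: "int \<Rightarrow> 'q::finite cmat" and K \<theta> :: real and n0 :: int
  assumes d: "0 < d" "d < 1 / 2"
    and causal: "\<And>k. k < 0 \<Longrightarrow> c k = 0" "\<And>k. k < 0 \<Longrightarrow> cs k = 0"
      "\<And>k. k < 0 \<Longrightarrow> al k = 0" "\<And>k. k < 0 \<Longrightarrow> a k = 0"
    and c_le: "\<And>k. norm (c k) \<le> K * wt (1 - d) k"
    and cs_le: "\<And>k. norm (cs k) \<le> K * wt (1 - d) k"
    and al_le: "\<And>k. norm (al k) \<le> K * wt (1 + d) k"
    and a_le: "\<And>k. norm (a k) \<le> K * wt (1 + d) k"
    and al_c: "\<And>k. infsum (\<lambda>m. al m ** c (k - m)) UNIV = (if k = 0 then mat 1 else 0)"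
    and c_al: "\<And>k. infsum (\<lambda>m. c m ** al (k - m)) UNIV = (if k = 0 then mat 1 else 0)"
    and a_cs: "\<And>k. infsum (\<lambda>m. a m ** cs (k - m)) UNIV = (if k = 0 then mat 1 else 0)"
    and cs_a: "\<And>k. infsum (\<lambda>m. cs m ** a (k - m)) UNIV = (if k = 0 then mat 1 else 0)"
    and gam_c: "\<And>k. gam k = infsum (\<lambda>m. c (m + k) ** herm (c m)) UNIV"
    and gam_cs: "\<And>k. gam k = infsum (\<lambda>m. herm (cs m) ** cs (m + k)) UNIV"
    and V_def: "\<And>k. V k = infsum (\<lambda>m. herm (a m) ** c (k + m)) UNIV"
    and V_le: "\<And>k. norm (V k) \<le> K * wt 1 k"
    and theta: "0 \<le> \<theta>" "\<theta> < 1" and n0: "1 \<le> n0"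
    and V_sharp: "\<And>m (X :: 'q cmat). n0 \<le> m \<Longrightarrow> norm (V (- m) ** X) \<le> \<theta> / (pi * m) * norm X"
      "\<And>m (X :: 'q cmat). n0 \<le> m \<Longrightarrow> norm (herm (V (- m)) ** X) \<le> \<theta> / (pi * m) * norm X"
    and inv_symbol_le: "\<And>k. norm (infsum (\<lambda>m. a m ** herm (a (m + k))) UNIV) \<le> K * wt (1 + 2 * d) k"
begin

lemma K_nonneg: "0 \<le> K"
  using order_trans[OF norm_ge_zero c_le[of 0]] by simp

lemma le_wt_imp_le_K: "norm X \<le> K * wt p k \<Longrightarrow> 0 \<le> p \<Longrightarrow> norm X \<le> K"
  using mult_left_mono[OF wt_le_1[of p k] K_nonneg] by simp

lemma bounded_by_K: "norm (c k) \<le> K" "norm (cs k) \<le> K" "norm (al k) \<le> K" "norm (a k) \<le> K" "norm (V k) \<le> K"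
  using le_wt_imp_le_K[OF c_le] le_wt_imp_le_K[OF cs_le] le_wt_imp_le_K[OF al_le]
    le_wt_imp_le_K[OF a_le] le_wt_imp_le_K[OF V_le] d by auto

definition S1 :: real where "S1 = K * (2 * ((1 + d) / d))"

lemma psum_wt1: "psum_le (\<lambda>k. K * wt (1 + d) k) UNIV S1"
  unfolding S1_def using psum_le_wt_UNIV[of "1 + d"] d K_nonneg by (intro psum_le_cmult) auto

lemma al_psum: "psum_le (\<lambda>k. norm (al k)) UNIV S1" and a_psum: "psum_le (\<lambda>k. norm (a k)) UNIV S1"
  by (rule psum_le_mono[OF psum_wt1]; simp add: al_le a_le)+

lemma c_eq: "infsum (\<lambda>m. gam (j + m) ** herm (al m)) UNIV = c j"
  by (rule factor_of_symbol[OF psum_le_sq_wt[OF d(2) c_le] al_psum al_c gam_c])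

text \<open>Any exponent strictly between half of \<open>1 - 2 d\<close> and \<open>1 - 2 d\<close>
  would serve. Below \<open>1 - 2 d\<close> the weight that remains to be summed has an exponent
  above 1; above one half of it the a priori bound for \<open>\<eta>\<close> converges, because then
  \<open>1 / 2 + d + \<tau> > 1\<close>.\<close>

lemma gam_bounded: "\<exists>B. \<forall>k. norm (gam k) \<le> B * wt (3 / 4 * (1 - 2 * d)) k"
proof -
  define \<tau> where "\<tau> = 3 / 4 * (1 - 2 * d)"
  have \<tau>: "0 \<le> \<tau>" "1 < 2 - 2 * d - \<tau>" "\<tau> \<le> 1 - d"
    using d by (auto simp: \<tau>_def field_simps)
  define S where "S = 2 * ((2 - 2 * d - \<tau>) / (1 - 2 * d - \<tau>))"
  have S: "psum_le (wt (2 - 2 * d - \<tau>)) UNIV S"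
    using psum_le_wt_UNIV[of "2 - 2 * d - \<tau>"] \<tau> by (simp add: S_def algebra_simps)
  have "norm (gam k) \<le> K\<^sup>2 * S * wt \<tau> k" for k
    unfolding gam_c
  proof (rule psum_le_infsum_le)
    define h where "h = (\<lambda>m. K\<^sup>2 * wt \<tau> k * wt (2 - 2 * d - \<tau>) (if k \<ge> 0 then m else m + k))"
    have "psum_le (\<lambda>m. wt (2 - 2 * d - \<tau>) (if k \<ge> 0 then m else m + k)) UNIV S"
      using S psum_le_shift[OF S, of k] by (cases "k \<ge> 0") auto
    then show "psum_le h UNIV (K\<^sup>2 * S * wt \<tau> k)"
      unfolding h_def by (rule psum_le_mono[OF psum_le_cmult[of _ UNIV S "K\<^sup>2 * wt \<tau> k"]])
        (auto simp: mult_ac)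
    \<comment> \<open>Of the decay at the larger index \<open>p\<close>, the part
      \<open>\<tau>\<close> is converted into decay in the difference and the rest is moved to the
      smaller index \<open>q\<close>.\<close>
    have tr: "wt (1 - d) p * wt (1 - d) q \<le> wt \<tau> (p - q) * wt (2 - 2 * d - \<tau>) q"
      if "0 \<le> q" "q \<le> p" for p q
    proof -
      have "wt (1 - d - \<tau>) p * wt \<tau> p * wt (1 - d) q \<le> wt (1 - d - \<tau>) q * wt \<tau> (p - q) * wt (1 - d) q"
        using that \<tau> by (intro mult_mono wt_antimono) auto
      also have "wt (1 - d - \<tau>) p * wt \<tau> p = wt (1 - d) p" by (simp flip: wt_add)
      also have "wt (1 - d - \<tau>) q * wt \<tau> (p - q) * wt (1 - d) q = wt \<tau> (p - q) * wt (2 - 2 * d - \<tau>) q"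
        using wt_add[of "1 - d - \<tau>" "1 - d" q] by (simp add: algebra_simps)
      finally show ?thesis .
    qed
    show "norm (c (m + k) ** herm (c m)) \<le> h m" for m
    proof (cases "m < 0 \<or> m + k < 0")
      case True
      then show ?thesis by (auto simp: causal h_def)
    next
      case False
      have "norm (c (m + k) ** herm (c m)) \<le> (K * wt (1 - d) (m + k)) * (K * wt (1 - d) m)"
        by (intro norm_mat_mult_le') (simp_all add: c_le)
      also have "\<dots> = K\<^sup>2 * (wt (1 - d) (m + k) * wt (1 - d) m)" by (simp add: power2_eq_square)
      also have "\<dots> \<le> h m"
      proof -
        have "wt (1 - d) (m + k) * wt (1 - d) m \<le> wt \<tau> k * wt (2 - 2 * d - \<tau>) (if k \<ge> 0 then m else m + k)"
        using tr[of m "m + k"] tr[of "m + k" m] False by (cases "k \<ge> 0") (auto simp: mult.commute)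
        then show ?thesis unfolding h_def mult.assoc by (intro mult_left_mono) auto
      qed
      finally show ?thesis .
    qed
  qed
  then show ?thesis unfolding \<tau>_def by blast
qed

definition "Gb = (SOME B. \<forall>k. norm (gam k) \<le> B * wt (3 / 4 * (1 - 2 * d)) k)"

lemma gam_le: "norm (gam k) \<le> Gb * wt (3 / 4 * (1 - 2 * d)) k"
  using someI_ex[OF gam_bounded] unfolding Gb_def by blast

lemma Gb_nonneg: "0 \<le> Gb"
  using order_trans[OF norm_ge_zero gam_le[of 0]] by simp

lemma gam_le_Gb: "norm (gam k) \<le> Gb"
  using gam_le[of k] mult_left_mono[OF wt_le_1[of "3 / 4 * (1 - 2 * d)" k] Gb_nonneg] d by simp

lemma herm_gam: "herm (gam k) = gam (- k)"
proof -
  have s: "(\<lambda>m. c (m + k) ** herm (c m)) summable_on UNIV"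
    by (rule psum_le_summable[OF psum_le_mult_sq[OF psum_le_shift[OF psum_le_sq_wt[OF d(2) c_le]] psum_le_sq_wt[OF d(2) c_le]]])
      (rule norm_mat_mult_le', auto)
  show ?thesis
    unfolding gam_c using infsum_shift[of "\<lambda>m. c (m - k) ** herm (c m)" k]
    by (simp add: infsum_herm[OF s, symmetric] herm_mult)
qed

lemma summable_a_gam: "(\<lambda>m. herm (a m) ** gam (j + m)) summable_on UNIV"
  by (rule psum_le_summable[OF psum_le_cmult[OF a_psum Gb_nonneg]])
    (subst mult.commute, rule norm_mat_mult_le', auto simp: gam_le_Gb)

lemma summable_gam_al: "(\<lambda>m. gam (j + m) ** herm (al m)) summable_on UNIV"
  by (rule psum_le_summable[OF psum_le_cmult[OF al_psum Gb_nonneg]])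
    (rule norm_mat_mult_le', auto simp: gam_le_Gb)

text \<open>Taking adjoints of all coefficients reverses the products and turns the second
  factorization into the form covered by \<open>factor_of_symbol\<close>.\<close>

lemma cs_eq: "infsum (\<lambda>m. herm (a m) ** gam (j + m)) UNIV = cs j"
proof -
  have s1: "(\<lambda>m. cs m ** a (k - m)) summable_on UNIV" for k
    by (rule psum_le_summable[OF psum_le_cmult[OF psum_le_reflect[OF a_psum] K_nonneg]])
      (rule norm_mat_mult_le', auto simp: bounded_by_K)
  have s2: "(\<lambda>m. herm (cs m) ** cs (m + k)) summable_on UNIV" for k
    by (rule psum_le_summable[OF psum_le_mult_sq[OF psum_le_sq_wt[OF d(2) cs_le] psum_le_shift[OF psum_le_sq_wt[OF d(2) cs_le]]]])
      (rule norm_mat_mult_le', auto)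
  have "infsum (\<lambda>m. herm (gam (j + m)) ** herm (herm (a m))) UNIV = herm (cs j)"
  proof (rule factor_of_symbol)
    show "psum_le (\<lambda>k. (norm (herm (cs k)))\<^sup>2) UNIV (K\<^sup>2 * (2 * ((2 - 2 * d) / (1 - 2 * d))))"
      using psum_le_sq_wt[OF d(2) cs_le] by simp
    show "psum_le (\<lambda>k. norm (herm (a k))) UNIV S1" using a_psum by simp
    show "infsum (\<lambda>m. herm (a m) ** herm (cs (k - m))) UNIV = (if k = 0 then mat 1 else 0)" for k
    proof -
      have "infsum (\<lambda>m. herm (a m) ** herm (cs (k - m))) UNIV = infsum (\<lambda>m. herm (cs m ** a (k - m))) UNIV"
        using infsum_reflect[of "\<lambda>m. herm (cs m ** a (k - m))" k] by (simp add: herm_mult)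
      then show ?thesis by (simp add: infsum_herm[OF s1] cs_a)
    qed
    show "herm (gam k) = infsum (\<lambda>m. herm (cs (m + k)) ** herm (herm (cs m))) UNIV" for k
      by (simp add: gam_cs infsum_herm[OF s2, symmetric] herm_mult)
  qed
  then have "herm (infsum (\<lambda>m. herm (a m) ** gam (j + m)) UNIV) = herm (cs j)"
    by (simp add: infsum_herm[OF summable_a_gam, symmetric] herm_mult)
  from arg_cong[OF this, of herm] show ?thesis by simp
qed

text \<open>The two factorizations meet here. The symbol multiplied from the left by the inverse
  adjoint of \<open>h\<^sub>\<sharp>\<close> is \<open>h\<^sub>\<sharp>\<close>, multiplied from the
  right by the inverse adjoint of \<open>h\<close> it is \<open>h\<close>; with both inverses
  applied, the order of evaluation gives the two expressions for the phase.\<close>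

lemma V_eq: "V k = infsum (\<lambda>i. cs (k + i) ** herm (al i)) UNIV"
proof -
  have "V k = infsum (\<lambda>m. herm (a m) ** infsum (\<lambda>i. gam (k + m + i) ** herm (al i)) UNIV) UNIV"
    by (simp add: V_def c_eq)
  also have "\<dots> = infsum (\<lambda>i. infsum (\<lambda>m. herm (a m) ** gam (k + m + i)) UNIV ** herm (al i)) UNIV"
    using a_psum al_psum gam_le_Gb by (intro mat_triple_swap) auto
  also have "\<dots> = infsum (\<lambda>i. cs (k + i) ** herm (al i)) UNIV"
  proof (rule infsum_cong)
    fix i
    have "infsum (\<lambda>m. herm (a m) ** gam (k + m + i)) UNIV = cs (k + i)"
      using cs_eq[of "k + i"] by (simp add: add_ac)
    then show "infsum (\<lambda>m. herm (a m) ** gam (k + m + i)) UNIV ** herm (al i) = cs (k + i) ** herm (al i)"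
      by simp
  qed
  finally show ?thesis .
qed

text \<open>In the form \<open>V_eq\<close> the phase has \<open>h\<^sub>\<sharp>\<close> as its
  left factor, which \<open>a\<close> cancels. In the defining form it has \<open>h\<close> as its
  right factor, which \<open>al\<close> cancels in \<open>V_al\<close>. These identities trade an
  inverse factor for the phase times the other one.\<close>

lemma a_V: "infsum (\<lambda>k. a (s - k) ** V (k - i)) UNIV = herm (al (i - s))"
proof -
  have "infsum (\<lambda>k. a (s - k) ** V (k - i)) UNIV = infsum (\<lambda>p. a p ** infsum (\<lambda>m. cs (s - p - i + m) ** herm (al m)) UNIV) UNIV"
    using infsum_reflect[of "\<lambda>p. a p ** V (s - p - i)" s] by (simp add: V_eq)
  also have "\<dots> = infsum (\<lambda>m. infsum (\<lambda>p. a p ** cs (s - p - i + m)) UNIV ** herm (al m)) UNIV"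
    using a_psum al_psum bounded_by_K by (intro mat_triple_swap) auto
  also have "\<dots> = infsum (\<lambda>m. if m = i - s then herm (al m) else 0) UNIV"
  proof (rule infsum_cong)
    fix m
    have "infsum (\<lambda>p. a p ** cs (s - p - i + m)) UNIV = (if s - i + m = 0 then mat 1 else 0)"
      using a_cs[of "s - i + m"] by (simp add: algebra_simps)
    then show "infsum (\<lambda>p. a p ** cs (s - p - i + m)) UNIV ** herm (al m) = (if m = i - s then herm (al m) else 0)"
      by (auto simp: mat_simps)
  qed
  finally show ?thesis by (simp add: infsum_delta)
qed

lemma V_al: "infsum (\<lambda>i. V (k - i) ** al (i - j)) UNIV = herm (a (j - k))"
proof -
  have "infsum (\<lambda>i. V (k - i) ** al (i - j)) UNIV = infsum (\<lambda>i. infsum (\<lambda>m. herm (a m) ** c (k - i + m)) UNIV ** al (i - j)) UNIV"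
    by (simp add: V_def)
  also have "\<dots> = infsum (\<lambda>m. herm (a m) ** infsum (\<lambda>i. c (k - i + m) ** al (i - j)) UNIV) UNIV"
    using a_psum psum_le_shift_minus[OF al_psum] bounded_by_K by (intro mat_triple_swap[symmetric]) auto
  also have "\<dots> = infsum (\<lambda>m. if m = j - k then herm (a m) else 0) UNIV"
  proof (rule infsum_cong)
    fix m
    have "infsum (\<lambda>i. c (k - i + m) ** al (i - j)) UNIV = infsum (\<lambda>i. c i ** al ((k + m - j) - i)) UNIV"
      using infsum_reflect[of "\<lambda>i. c i ** al ((k + m - j) - i)" "k + m"] by (simp add: algebra_simps)
    then have "infsum (\<lambda>i. c (k - i + m) ** al (i - j)) UNIV = (if k + m - j = 0 then mat 1 else 0)"
      by (simp add: c_al)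
    then show "herm (a m) ** infsum (\<lambda>i. c (k - i + m) ** al (i - j)) UNIV = (if m = j - k then herm (a m) else 0)"
      by (auto simp: mat_simps)
  qed
  finally show ?thesis by (simp add: infsum_delta)
qed

end

section \<open>The infinite inverse and the decay of its entries\<close>

context symbol_factors
begin

text \<open>The infinite inverse as a lower times an upper triangular matrix. For
  \<open>t < s\<close> causality removes the terms with \<open>k > t\<close>, so the upper limit
  \<open>s\<close> gives the same value as the minimum of \<open>s\<close> and
  \<open>t\<close>.\<close>

definition T :: "int \<Rightarrow> int \<Rightarrow> 'q cmat" where
  "T s t = (\<Sum>k\<in>{1..s}. a (s - k) ** herm (a (t - k)))"

text \<open>Truncation respects products of lower triangular Toeplitz matrices, so the section of
  \<open>a\<close> inverts the section of \<open>cs\<close>.\<close>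

lemma x_eq:
  fixes x :: "int \<Rightarrow> 'q cmat"
  assumes "s \<in> {1..N}"
  shows "x s = (\<Sum>k\<in>{1..s}. a (s - k) ** (\<Sum>t\<in>{1..N}. cs (k - t) ** x t))"
proof -
  have "(\<Sum>k\<in>{1..s}. a (s - k) ** (\<Sum>t\<in>{1..N}. cs (k - t) ** x t)) = (\<Sum>t\<in>{1..N}. (\<Sum>k\<in>{1..s}. a (s - k) ** cs (k - t)) ** x t)"
    by (simp add: mat.sum_right mat.sum_left matrix_mul_assoc) (rule sum.swap)
  also have "\<dots> = (\<Sum>t\<in>{1..N}. if t = s then x t else 0)"
  proof (rule sum.cong)
    fix t assume t: "t \<in> {1..N}"
    have "(\<Sum>k\<in>{1..s}. a (s - k) ** cs (k - t)) = infsum (\<lambda>k. a (s - k) ** cs (k - t)) {1..s}" by simp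
    also have "\<dots> = infsum (\<lambda>k. a (s - k) ** cs (k - t)) UNIV"
    proof (rule infsum_cong_neutral)
      fix k assume "k \<in> UNIV - {1..s}"
      then show "a (s - k) ** cs (k - t) = 0" using t by (cases "k > s") (auto simp: causal mat_simps)
    qed auto
    also have "\<dots> = infsum (\<lambda>m. a m ** cs ((s - t) - m)) UNIV"
      using infsum_reflect[of "\<lambda>m. a m ** cs ((s - t) - m)" s] by (simp add: algebra_simps)
    also have "\<dots> = (if s - t = 0 then mat 1 else 0)" by (rule a_cs)
    finally show "(\<Sum>k\<in>{1..s}. a (s - k) ** cs (k - t)) ** x t = (if t = s then x t else 0)"
      by (auto simp: mat_simps)
  qed simp
  also have "\<dots> = x s" using assms by (simp add: sum.delta')
  finally show ?thesis by simp
qed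

lemma psum_wt1_tail: "0 \<le> s \<Longrightarrow> psum_le (\<lambda>k. wt (1 + d) (s - k)) {..0} ((1 + d) / d * wt d s)"
  by (rule psum_le_mono[OF psum_le_reindex[of uminus "{..0}" "\<lambda>k. wt (1 + d) (s + k)", OF _ psum_le_wt_tail]])
    (use d in auto)

text \<open>Extending the sum over \<open>k\<close> to all integers replaces the product of the two triangular
  factors by a coefficient of the inverse symbol; this is the only place where the cancellation
  in that coefficient is needed.\<close>
lemma norm_T_le:
  assumes "1 \<le> s" "s \<le> t"
  shows "norm (T s t) \<le> K * wt (1 + 2 * d) (t - s) + K\<^sup>2 * ((1 + d) / d) * (wt d s * wt (1 + d) t)"
proof -
  define f where "f = (\<lambda>k. a (s - k) ** herm (a (t - k)))"
  have fs: "f summable_on UNIV"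
    unfolding f_def
    by (rule psum_le_summable[OF psum_le_cmult[OF psum_le_reflect[OF a_psum] K_nonneg]])
      (subst mult.commute, rule norm_mat_mult_le', auto simp: bounded_by_K)
  have "infsum f UNIV = infsum f {..0} + (\<Sum>k\<in>{1..s}. f k) + infsum f {s<..}"
    using fs assms by (intro infsum_int_split) auto
  moreover have "infsum f {s<..} = 0"
    by (rule infsum_0) (auto simp: f_def causal mat_simps)
  moreover have "infsum f UNIV = infsum (\<lambda>m. a m ** herm (a (m + (t - s)))) UNIV"
    using infsum_reflect[of "\<lambda>m. a m ** herm (a (m + (t - s)))" s] by (simp add: f_def)
  ultimately have "T s t = infsum (\<lambda>m. a m ** herm (a (m + (t - s)))) UNIV - infsum f {..0}"
    by (simp add: T_def f_def eq_diff_eq add.commute)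
  moreover have "norm (infsum f {..0}) \<le> K\<^sup>2 * wt (1 + d) t * ((1 + d) / d * wt d s)"
  proof (rule psum_le_infsum_le)
    show "psum_le (\<lambda>k. K\<^sup>2 * wt (1 + d) t * wt (1 + d) (s - k)) {..0} (K\<^sup>2 * wt (1 + d) t * ((1 + d) / d * wt d s))"
      using assms by (intro psum_le_cmult psum_wt1_tail) auto
    show "norm (f k) \<le> K\<^sup>2 * wt (1 + d) t * wt (1 + d) (s - k)" if "k \<in> {..0}" for k
    proof -
      have "norm (f k) \<le> (K * wt (1 + d) (s - k)) * (K * wt (1 + d) (t - k))"
        unfolding f_def by (intro norm_mat_mult_le') (simp_all add: a_le)
      also have "\<dots> \<le> (K * wt (1 + d) (s - k)) * (K * wt (1 + d) t)"
        using that assms d K_nonneg by (intro mult_left_mono wt_antimono) auto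
      finally show ?thesis by (simp add: power2_eq_square mult_ac)
    qed
  qed
  ultimately show ?thesis
    using inv_symbol_le[of "t - s"] norm_triangle_ineq4[of "infsum (\<lambda>m. a m ** herm (a (m + (t - s)))) UNIV" "infsum f {..0}"]
    by (simp add: mult_ac)
qed

text \<open>This is the effect of the data beyond the section. For the first term of
  \<open>norm_T_le\<close>, the sum over \<open>s\<close> leaves \<open>wt (2 * d) (t - N)\<close>,
  and \<open>psum_le_wt_cross\<close> does the sum over \<open>t\<close>, where
  \<open>2 d + \<rho> > 1\<close> is needed. The second term separates into about
  \<open>N powr (1 - d)\<close> times \<open>N powr (- d - \<rho>)\<close>, which is the same
  rate.\<close>

lemma tail_contribution:
  assumes \<rho>: "1 - 2 * d < \<rho>" "\<rho> < 1"
  shows "\<exists>C. \<forall>N\<ge>0. psum_le (\<lambda>(s, t). norm (T s t) * wt \<rho> t) ({1..N} \<times> {N<..}) (C * wt (\<rho> + 2 * d - 1) N)"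
proof -
  define C1 where "C1 = (1 + 2 * d) / (2 * d)"
  define C2 where "C2 = 2 powr (2 * d) * (1 / (1 - 2 * d) + (2 * d + \<rho>) / (2 * d + \<rho> - 1))"
  define C3 where "C3 = (1 + d + \<rho>) / (d + \<rho>) * (1 / (1 - d))"
  have \<rho>0: "0 < \<rho>" using \<rho> d by linarith
  have "psum_le (\<lambda>(s, t). norm (T s t) * wt \<rho> t) ({1..N} \<times> {N<..})
      ((K * C1 * C2 + K\<^sup>2 * ((1 + d) / d) * C3) * wt (\<rho> + 2 * d - 1) N)" if N: "0 \<le> N" for N
  proof -
    have a: "psum_le (\<lambda>(t, s). wt (1 + 2 * d) (t - s) * wt \<rho> t) ({N<..} \<times> {1..N}) (C1 * C2 * wt (\<rho> + 2 * d - 1) N)"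
    proof (rule psum_le_prodI)
      fix t assume t: "t \<in> {N<..}"
      have "psum_le (\<lambda>s. wt (1 + 2 * d) ((t - N) + (N - s))) {1..N} (C1 * wt (2 * d) (t - N))"
        using t d psum_le_reindex[of "\<lambda>s. N - s" "{1..N}", OF _ psum_le_wt_tail[of "1 + 2 * d" "t - N"]]
        by (auto simp: inj_on_def C1_def)
      from psum_le_cmult[OF this, of "wt \<rho> t"]
      show "psum_le (\<lambda>s. wt (1 + 2 * d) (t - s) * wt \<rho> t) {1..N} (C1 * (wt (2 * d) (t - N) * wt \<rho> t))"
        by (simp add: mult_ac)
    next
      have C1: "0 \<le> C1" using d by (simp add: C1_def)
      have "psum_le (\<lambda>j. wt (2 * d) j * wt \<rho> (N + j)) {0..} ((1 / (1 - 2 * d) + (2 * d + \<rho>) / (2 * d + \<rho> - 1)) * wt (2 * d + \<rho> - 1) N)"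
        using d \<rho> \<rho>0 N by (intro psum_le_wt_cross) auto
      then have "psum_le (\<lambda>t. wt (2 * d) (t - N - 1) * wt \<rho> (N + (t - N - 1))) {N<..} ((1 / (1 - 2 * d) + (2 * d + \<rho>) / (2 * d + \<rho> - 1)) * wt (2 * d + \<rho> - 1) N)"
        by (rule psum_le_reindex[rotated]) (auto simp: inj_on_def)
      from psum_le_cmult[OF this, of "2 powr (2 * d)"]
      have "psum_le (\<lambda>t. 2 powr (2 * d) * (wt (2 * d) (t - N - 1) * wt \<rho> (t - 1))) {N<..} (C2 * wt (\<rho> + 2 * d - 1) N)"
        by (simp add: C2_def add_ac mult.assoc)
      then have "psum_le (\<lambda>t. wt (2 * d) (t - N) * wt \<rho> t) {N<..} (C2 * wt (\<rho> + 2 * d - 1) N)"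
      proof (rule psum_le_mono)
        fix t assume t: "t \<in> {N<..}"
        have "wt (2 * d) (t - N) * wt \<rho> t \<le> wt (2 * d) (t - N - 1) * wt \<rho> (t - 1)"
          using t N d \<rho>0 by (intro mult_mono wt_antimono) auto
        also have "\<dots> \<le> 2 powr (2 * d) * (wt (2 * d) (t - N - 1) * wt \<rho> (t - 1))"
          using d ge_one_powr_ge_zero[of 2 "2 * d"]
            mult_right_mono[of 1 "2 powr (2 * d)" "wt (2 * d) (t - N - 1) * wt \<rho> (t - 1)"] by simp
        finally show "wt (2 * d) (t - N) * wt \<rho> t \<le> 2 powr (2 * d) * (wt (2 * d) (t - N - 1) * wt \<rho> (t - 1))" .
      qed simp
      from psum_le_cmult[OF this C1]
      show "psum_le (\<lambda>t. C1 * (wt (2 * d) (t - N) * wt \<rho> t)) {N<..} (C1 * C2 * wt (\<rho> + 2 * d - 1) N)"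
        by (simp add: mult.assoc)
    qed auto
    have b: "psum_le (\<lambda>(t, s). wt d s * wt (1 + d) t * wt \<rho> t) ({N<..} \<times> {1..N}) (C3 * wt (\<rho> + 2 * d - 1) N)"
    proof (rule psum_le_prodI)
      fix t
      have "(\<Sum>s\<in>{1..N}. wt d s) \<le> (\<Sum>s\<in>{0..N}. wt d s)" by (intro sum_mono2) auto
      also have "\<dots> \<le> 1 / (1 - d) * wt (d - 1) N" using d N by (intro sum_wt_le) auto
      finally have "psum_le (wt d) {1..N} (1 / (1 - d) * wt (d - 1) N)"
        using psum_le_finite[of "{1..N}" "wt d"] by (auto intro: psum_le_mono)
      from psum_le_cmult[OF this, of "wt (1 + d + \<rho>) t"]
      show "psum_le (\<lambda>s. wt d s * wt (1 + d) t * wt \<rho> t) {1..N} (1 / (1 - d) * wt (d - 1) N * wt (1 + d + \<rho>) t)"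
        by (simp add: wt_add[of "1 + d" \<rho>] mult_ac)
    next
      have "psum_le (\<lambda>t. wt (1 + d + \<rho>) (N + (t - N))) {N<..} ((1 + d + \<rho>) / (1 + d + \<rho> - 1) * wt (1 + d + \<rho> - 1) N)"
        using d \<rho>0 N by (intro psum_le_reindex[OF _ psum_le_wt_tail]) (auto simp: inj_on_def)
      then have "psum_le (wt (1 + d + \<rho>)) {N<..} ((1 + d + \<rho>) / (d + \<rho>) * wt (d + \<rho>) N)"
        by (simp add: add_ac)
      from psum_le_cmult[OF this, of "1 / (1 - d) * wt (d - 1) N"]
      show "psum_le (\<lambda>t. 1 / (1 - d) * wt (d - 1) N * wt (1 + d + \<rho>) t) {N<..} (C3 * wt (\<rho> + 2 * d - 1) N)"
      proof (rule psum_le_mono)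
        have "wt (d - 1) N * wt (d + \<rho>) N = wt (\<rho> + 2 * d - 1) N"
          by (simp flip: wt_add add: algebra_simps)
        moreover have "1 / (1 - d) * wt (d - 1) N * ((1 + d + \<rho>) / (d + \<rho>) * wt (d + \<rho>) N) = C3 * (wt (d - 1) N * wt (d + \<rho>) N)"
          by (simp add: C3_def mult.commute)
        ultimately show "1 / (1 - d) * wt (d - 1) N * ((1 + d + \<rho>) / (d + \<rho>) * wt (d + \<rho>) N) \<le> C3 * wt (\<rho> + 2 * d - 1) N"
          by simp
      qed (use d in auto)
    qed auto
    show ?thesis
    proof (rule psum_le_mono)
      show "psum_le (\<lambda>(s, t). K * (wt (1 + 2 * d) (t - s) * wt \<rho> t) + K\<^sup>2 * ((1 + d) / d) * (wt d s * wt (1 + d) t * wt \<rho> t))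
          ({1..N} \<times> {N<..}) (K * (C1 * C2 * wt (\<rho> + 2 * d - 1) N) + K\<^sup>2 * ((1 + d) / d) * (C3 * wt (\<rho> + 2 * d - 1) N))"
        using psum_le_add[OF psum_le_cmult[OF psum_le_prod_swap[OF a] K_nonneg]
          psum_le_cmult[OF psum_le_prod_swap[OF b], of "K\<^sup>2 * ((1 + d) / d)"]] d
        by (simp add: case_prod_unfold)
      fix x assume "x \<in> {1..N} \<times> {N<..}"
      then obtain s t where x: "x = (s, t)" "1 \<le> s" "s \<le> N" "N < t" by auto
      have "norm (T s t) * wt \<rho> t \<le> (K * wt (1 + 2 * d) (t - s) + K\<^sup>2 * ((1 + d) / d) * (wt d s * wt (1 + d) t)) * wt \<rho> t"
        using x by (intro mult_right_mono norm_T_le) auto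
      then show "(case x of (s, t) \<Rightarrow> norm (T s t) * wt \<rho> t) \<le>
        (case x of (s, t) \<Rightarrow> K * (wt (1 + 2 * d) (t - s) * wt \<rho> t) + K\<^sup>2 * ((1 + d) / d) * (wt d s * wt (1 + d) t * wt \<rho> t))"
        by (simp add: x algebra_simps)
    qed (simp add: algebra_simps)
  qed
  then show ?thesis by blast
qed

end

text \<open>\<open>x\<close> is a solution of the section of size \<open>N\<close>, and \<open>u\<close> is the doubly infinite sequence
  obtained by applying the Laurent operator to \<open>x\<close>. The part of \<open>u\<close> to the right of \<open>N\<close> is encoded
  by \<open>\<eta>\<close>, the part to the left of \<open>1\<close> by \<open>\<xi>\<close>; they determine each other through the
  Hankel blocks of \<open>V\<close>.\<close>
locale finite_section = symbol_factors d c cs al a gam V K \<theta> n0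
  for d c cs al a gam and V :: "int \<Rightarrow> 'q::finite cmat" and K \<theta> n0 +
  fixes N :: int and x :: "int \<Rightarrow> 'q cmat"
  assumes N: "n0 \<le> N"
begin

definition u :: "int \<Rightarrow> 'q cmat" where "u k = (\<Sum>t\<in>{1..N}. gam (k - t) ** x t)"
definition \<eta> :: "int \<Rightarrow> 'q cmat" where "\<eta> i = infsum (\<lambda>j. al (i - j) ** u j) {N<..}"
definition \<xi> :: "int \<Rightarrow> 'q cmat" where "\<xi> k = infsum (\<lambda>j. herm (a (j - k)) ** u j) {..0}"

lemma N_pos: "1 \<le> N" using N n0 by simp

abbreviation "\<tau> \<equiv> 3 / 4 * (1 - 2 * d)"

lemma tau_pos: "0 < \<tau>" using d by simp

text \<open>Purely qualitative: \<open>U\<close> depends on the section and on \<open>x\<close>. It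
  justifies the interchanges below and the finiteness of \<open>E\<close>, and does not enter the
  final bound.\<close>

lemma u_le: "\<exists>U\<ge>0. \<forall>j. norm (u j) \<le> U * wt \<tau> (j - i)"
proof -
  define U where "U = (\<Sum>t\<in>{1..N}. Gb * wt (- \<tau>) (t - i) * norm (x t))"
  have "norm (u j) \<le> U * wt \<tau> (j - i)" for j
    unfolding u_def U_def sum_distrib_right
  proof (rule sum_norm_le)
    fix t
    have "norm (gam (j - t)) \<le> Gb * (wt (- \<tau>) (t - i) * wt \<tau> (j - i))"
      using gam_le[of "j - t"] mult_left_mono[OF wt_shift[of \<tau> "j - t" "t - i"] Gb_nonneg] tau_pos by simp
    then have "norm (gam (j - t) ** x t) \<le> Gb * (wt (- \<tau>) (t - i) * wt \<tau> (j - i)) * norm (x t)"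
      by (intro norm_mat_mult_le') auto
    then show "norm (gam (j - t) ** x t) \<le> Gb * wt (- \<tau>) (t - i) * norm (x t) * wt \<tau> (j - i)"
      by (simp add: mult_ac)
  qed
  moreover have "0 \<le> U" unfolding U_def by (intro sum_nonneg mult_nonneg_nonneg Gb_nonneg) auto
  ultimately show ?thesis by blast
qed

lemma u_bounded: "\<exists>U\<ge>0. \<forall>j. norm (u j) \<le> U"
proof -
  obtain U where U: "0 \<le> U" "\<And>j. norm (u j) \<le> U * wt \<tau> (j - 0)" using u_le[of 0] by blast
  moreover have "U * wt \<tau> (j - 0) \<le> U" for j
    using mult_left_mono[OF wt_le_1[of \<tau> "j - 0"] U(1)] tau_pos by simp
  ultimately show ?thesis by (meson order_trans)
qed

lemma summable_au: "(\<lambda>j. herm (a (j - k)) ** u j) summable_on A"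
proof -
  obtain U where U: "0 \<le> U" "\<And>j. norm (u j) \<le> U" using u_bounded by blast
  show ?thesis
    by (rule psum_le_summable[OF psum_le_subset[OF psum_le_cmult[OF psum_le_shift_minus[OF a_psum] U(1)]]])
      (auto intro!: norm_mat_mult_le' simp: U mult.commute[of U])
qed

lemma summable_alu: "(\<lambda>j. al (i - j) ** u j) summable_on A"
proof -
  obtain U where U: "0 \<le> U" "\<And>j. norm (u j) \<le> U" using u_bounded by blast
  show ?thesis
    by (rule psum_le_summable[OF psum_le_subset[OF psum_le_cmult[OF psum_le_reflect[OF al_psum] U(1)]]])
      (auto intro!: norm_mat_mult_le' simp: U mult.commute[of U])
qed

text \<open>The symbol loses its left factor and \<open>h\<^sub>\<sharp>\<close> applied to
  \<open>x\<close> is left, which vanishes for \<open>k \<le> 0\<close>. In the mirror image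
  \<open>al_u\<close> the adjoint of \<open>h\<close> applied to \<open>x\<close> is left, which
  vanishes beyond \<open>N\<close>. These two supports are the source of \<open>xi_eq\<close> and
  \<open>eta_eq\<close>.\<close>

lemma a_u: "infsum (\<lambda>j. herm (a (j - k)) ** u j) UNIV = (\<Sum>t\<in>{1..N}. cs (k - t) ** x t)"
proof (rule infsumI)
  have "((\<lambda>j. herm (a (j - k)) ** gam (j - t) ** x t) has_sum cs (k - t) ** x t) UNIV" for t
  proof (rule has_sum_bounded_linear[OF mat.bounded_linear_left])
    have "((\<lambda>m. herm (a m) ** gam (k - t + m)) has_sum cs (k - t)) UNIV"
      using summable_a_gam[of "k - t"] cs_eq[of "k - t"] by (simp add: has_sum_iff)
    then show "((\<lambda>j. herm (a (j - k)) ** gam (j - t)) has_sum cs (k - t)) UNIV"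
      by (subst has_sum_reindex_bij_witness[of _ "\<lambda>m. m + k" "\<lambda>j. j - k" UNIV "\<lambda>m. herm (a m) ** gam (k - t + m)"]) auto
  qed
  then have "((\<lambda>j. \<Sum>t\<in>{1..N}. herm (a (j - k)) ** gam (j - t) ** x t) has_sum (\<Sum>t\<in>{1..N}. cs (k - t) ** x t)) UNIV"
    by (intro has_sum_finite_sum)
  then show "((\<lambda>j. herm (a (j - k)) ** u j) has_sum (\<Sum>t\<in>{1..N}. cs (k - t) ** x t)) UNIV"
    by (simp add: u_def mat.sum_right matrix_mul_assoc)
qed

lemma al_u: "infsum (\<lambda>j. al (i - j) ** u j) UNIV = (\<Sum>t\<in>{1..N}. herm (c (t - i)) ** x t)"
proof (rule infsumI)
  have "((\<lambda>j. al (i - j) ** gam (j - t) ** x t) has_sum herm (c (t - i)) ** x t) UNIV" for t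
  proof (rule has_sum_bounded_linear[OF mat.bounded_linear_left])
    have "((\<lambda>m. gam (t - i + m) ** herm (al m)) has_sum c (t - i)) UNIV"
      using summable_gam_al[of "t - i"] c_eq[of "t - i"] by (simp add: has_sum_iff)
    from has_sum_bounded_linear[OF bounded_linear_herm this]
    have "((\<lambda>m. al m ** gam (- (t - i + m))) has_sum herm (c (t - i))) UNIV"
      by (simp only: herm_mult herm_herm herm_gam)
    then show "((\<lambda>j. al (i - j) ** gam (j - t)) has_sum herm (c (t - i))) UNIV"
      by (subst has_sum_reindex_bij_witness[of _ "\<lambda>m. i - m" "\<lambda>j. i - j" UNIV "\<lambda>m. al m ** gam (- (t - i + m))"]) auto
  qed
  then have "((\<lambda>j. \<Sum>t\<in>{1..N}. al (i - j) ** gam (j - t) ** x t) has_sum (\<Sum>t\<in>{1..N}. herm (c (t - i)) ** x t)) UNIV"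
    by (intro has_sum_finite_sum)
  then show "((\<lambda>j. al (i - j) ** u j) has_sum (\<Sum>t\<in>{1..N}. herm (c (t - i)) ** x t)) UNIV"
    by (simp add: u_def mat.sum_right matrix_mul_assoc)
qed

lemma eta_eq:
  assumes "N < i"
  shows "\<eta> i = - infsum (\<lambda>j. al (i - j) ** u j) {..0} - (\<Sum>t\<in>{1..N}. al (i - t) ** u t)"
proof -
  have "infsum (\<lambda>j. al (i - j) ** u j) UNIV = 0"
    unfolding al_u using assms by (intro sum.neutral) (auto simp: causal mat_simps)
  then have "\<eta> i + infsum (\<lambda>j. al (i - j) ** u j) {..0} + (\<Sum>t\<in>{1..N}. al (i - t) ** u t) = 0"
    using infsum_int_split[OF summable_alu[of i UNIV], of N] N_pos by (simp add: \<eta>_def algebra_simps)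
  then show ?thesis by (simp add: eq_neg_iff_add_eq_0 algebra_simps)
qed

text \<open>By \<open>V_al\<close> the adjoint of \<open>a\<close> is the phase convolved with
  \<open>al\<close>; grouping \<open>al\<close> with \<open>u\<close> first produces
  \<open>\<eta>\<close>. Since \<open>k \<le> N < i\<close>, the phase decays at least like
  \<open>wt 1 (i - N)\<close>, as \<open>conv_tail_swap\<close> requires.\<close>

lemma a_u_tail:
  assumes "k \<le> N"
  shows "infsum (\<lambda>j. herm (a (j - k)) ** u j) {N<..} = infsum (\<lambda>i. V (k - i) ** \<eta> i) {N<..}"
    and "(\<lambda>i. V (k - i) ** \<eta> i) summable_on {N<..}"
proof -
  obtain U where U: "0 \<le> U" "\<And>j. norm (u j) \<le> U * wt \<tau> (j - N)" using u_le[of N] by blast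
  have V: "norm (V (k - i)) \<le> K * wt 1 (i - N)" if "N < i" for i
  proof -
    have "wt 1 (k - i) \<le> wt 1 (i - N)" using that assms by (intro wt_antimono) auto
    then show ?thesis using V_le[of "k - i"] mult_left_mono[OF _ K_nonneg] order_trans by blast
  qed
  note * = conv_tail_swap[of d \<tau> al K N "\<lambda>i. V (k - i)" K u U "\<lambda>j. herm (a (j - k))"]
  show "infsum (\<lambda>j. herm (a (j - k)) ** u j) {N<..} = infsum (\<lambda>i. V (k - i) ** \<eta> i) {N<..}"
    unfolding \<eta>_def using d tau_pos U V by (intro *) (auto simp: causal al_le V_al)
  show "(\<lambda>i. V (k - i) ** \<eta> i) summable_on {N<..}"
    unfolding \<eta>_def using d tau_pos U V by (intro *) (auto simp: causal al_le V_al)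
qed

text \<open>The mirror image of \<open>a_u_tail\<close>, with \<open>a_V\<close> in place of
  \<open>V_al\<close>. Reflection turns the half line \<open>j \<le> 0\<close> into
  \<open>- 1 < j\<close>, so the tail lemma is used with \<open>- 1\<close> in the role of
  \<open>N\<close>.\<close>

lemma al_u_left:
  assumes "N < i"
  shows "infsum (\<lambda>j. al (i - j) ** u j) {..0} = infsum (\<lambda>k. herm (V (k - i)) ** \<xi> k) {..0}"
    and "(\<lambda>k. herm (V (k - i)) ** \<xi> k) summable_on {..0}"
proof -
  obtain U where U: "0 \<le> U" "\<And>j. norm (u j) \<le> U * wt \<tau> (j - 1)" using u_le[of 1] by blast
  have U': "norm (u (- j)) \<le> U * wt \<tau> (j - (- 1))" for j
    using U(2)[of "- j"] wt_minus[of \<tau> "j + 1"] by simp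
  have V: "norm (herm (V (- k - i))) \<le> K * wt 1 (k - (- 1))" if "- 1 < k" for k
  proof -
    have "wt 1 (- k - i) \<le> wt 1 (k - (- 1))" using that assms N_pos by (intro wt_antimono) auto
    then show ?thesis using V_le[of "- k - i"] mult_left_mono[OF _ K_nonneg] order_trans by simp blast
  qed
  have R: "al (i - (- j)) = infsum (\<lambda>k. herm (V (- k - i)) ** herm (a (k - j))) UNIV" for j
  proof -
    have s: "(\<lambda>k. a (- j - k) ** V (k - i)) summable_on UNIV"
      by (rule psum_le_summable[OF psum_le_cmult[OF psum_le_reflect[OF a_psum] K_nonneg]])
        (subst mult.commute, rule norm_mat_mult_le', auto simp: bounded_by_K)
    have "al (i + j) = infsum (\<lambda>k. herm (V (k - i)) ** herm (a (- j - k))) UNIV"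
      using arg_cong[OF a_V[of "- j" i], of herm] by (simp add: infsum_herm[OF s, symmetric] herm_mult)
    also have "\<dots> = infsum (\<lambda>k. herm (V (- k - i)) ** herm (a (k - j))) UNIV"
      using infsum_reflect[of "\<lambda>k. herm (V (k - i)) ** herm (a (- j - k))" 0] by (simp add: add.commute)
    finally show ?thesis by simp
  qed
  note * = conv_tail_swap[of d \<tau> "\<lambda>m. herm (a m)" K "- 1" "\<lambda>k. herm (V (- k - i))" K "\<lambda>j. u (- j)" U "\<lambda>j. al (i - (- j))"]
  have 1: "infsum (\<lambda>j. al (i - (- j)) ** u (- j)) {-1<..}
      = infsum (\<lambda>k. herm (V (- k - i)) ** infsum (\<lambda>j. herm (a (k - j)) ** u (- j)) {-1<..}) {-1<..}"
    by (rule *(1)) (use d tau_pos U' V in \<open>auto simp: causal a_le R simp del: minus_minus diff_minus_eq_add\<close>)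
  have 2: "(\<lambda>k. herm (V (- k - i)) ** infsum (\<lambda>j. herm (a (k - j)) ** u (- j)) {-1<..}) summable_on {-1<..}"
    by (rule *(2)) (use d tau_pos U' V in \<open>auto simp: causal a_le R simp del: minus_minus diff_minus_eq_add\<close>)
  have x: "infsum (\<lambda>j. herm (a (k - j)) ** u (- j)) {-1<..} = \<xi> (- k)" for k
    unfolding \<xi>_def by (rule infsum_reindex_bij_witness[of _ uminus uminus]) auto
  have 3: "infsum (\<lambda>j. al (i - (- j)) ** u (- j)) {-1<..} = infsum (\<lambda>j. al (i - j) ** u j) {..0}"
    by (rule infsum_reindex_bij_witness[of _ uminus uminus]) auto
  have 4: "infsum (\<lambda>k. herm (V (- k - i)) ** \<xi> (- k)) {-1<..} = infsum (\<lambda>k. herm (V (k - i)) ** \<xi> k) {..0}"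
    by (rule infsum_reindex_bij_witness[of _ uminus uminus]) auto
  have 5: "(\<lambda>k. herm (V (- k - i)) ** \<xi> (- k)) summable_on {-1<..} \<longleftrightarrow> (\<lambda>k. herm (V (k - i)) ** \<xi> k) summable_on {..0}"
    by (rule summable_on_reindex_bij_witness[of _ uminus uminus]) auto
  show "infsum (\<lambda>j. al (i - j) ** u j) {..0} = infsum (\<lambda>k. herm (V (k - i)) ** \<xi> k) {..0}"
    using 1 3 4 by (simp only: x)
  show "(\<lambda>k. herm (V (k - i)) ** \<xi> k) summable_on {..0}"
    using 2 5 by (simp only: x)
qed

lemma xi_eq:
  assumes "k \<le> 0"
  shows "\<xi> k = - infsum (\<lambda>i. V (k - i) ** \<eta> i) {N<..} - (\<Sum>t\<in>{1..N}. herm (a (t - k)) ** u t)"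
proof -
  have "infsum (\<lambda>j. herm (a (j - k)) ** u j) UNIV = 0"
    unfolding a_u using assms by (intro sum.neutral) (auto simp: causal mat_simps)
  then have "\<xi> k + (\<Sum>t\<in>{1..N}. herm (a (t - k)) ** u t) + infsum (\<lambda>i. V (k - i) ** \<eta> i) {N<..} = 0"
    using infsum_int_split[OF summable_au[of k UNIV], of N] N_pos a_u_tail(1)[of k] assms
    by (simp add: \<xi>_def)
  then show ?thesis by (simp add: eq_neg_iff_add_eq_0 algebra_simps)
qed

text \<open>Split the image in \<open>a_u\<close> into left, middle and right parts and apply
  \<open>x_eq\<close>. For \<open>k \<ge> 1\<close> the left part disappears by causality, the
  middle part gives \<open>T\<close> applied to \<open>u\<close>, and the right part is governed by
  \<open>\<eta>\<close>. Hence only a bound on \<open>\<eta>\<close> is required for the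
  error.\<close>

lemma error_eq:
  assumes "s \<in> {1..N}"
  shows "x s - (\<Sum>t\<in>{1..N}. T s t ** u t) = (\<Sum>k\<in>{1..s}. a (s - k) ** infsum (\<lambda>i. V (k - i) ** \<eta> i) {N<..})"
proof -
  have F: "(\<Sum>t\<in>{1..N}. cs (k - t) ** x t) = (\<Sum>t\<in>{1..N}. herm (a (t - k)) ** u t) + infsum (\<lambda>i. V (k - i) ** \<eta> i) {N<..}"
    if "k \<in> {1..s}" for k
  proof -
    have "infsum (\<lambda>j. herm (a (j - k)) ** u j) {..0} = 0"
      using that by (intro infsum_0) (auto simp: causal mat_simps)
    then show ?thesis
      using infsum_int_split[OF summable_au[of k UNIV], of N] N_pos a_u_tail(1)[of k] assms that
      by (simp add: a_u)
  qed
  have "x s = (\<Sum>k\<in>{1..s}. a (s - k) ** (\<Sum>t\<in>{1..N}. herm (a (t - k)) ** u t)) + (\<Sum>k\<in>{1..s}. a (s - k) ** infsum (\<lambda>i. V (k - i) ** \<eta> i) {N<..})"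
    unfolding x_eq[OF assms, of x] by (simp add: F mat_simps sum.distrib)
  also have "(\<Sum>k\<in>{1..s}. a (s - k) ** (\<Sum>t\<in>{1..N}. herm (a (t - k)) ** u t)) = (\<Sum>t\<in>{1..N}. T s t ** u t)"
    by (simp add: T_def mat.sum_right mat.sum_left matrix_mul_assoc) (rule sum.swap)
  finally show ?thesis by simp
qed

end

text \<open>Schur's test for weighted l1: it suffices to control the weighted sum of each column of
  the kernel.\<close>

lemma psum_le_weighted_infsum:
  fixes g :: "'a \<Rightarrow> 'b \<Rightarrow> 'c::banach"
  assumes "\<And>y. y \<in> B \<Longrightarrow> psum_le (\<lambda>x. w x * f x y) A (h y)" "psum_le h B c"
    "\<And>x. x \<in> A \<Longrightarrow> 0 \<le> w x" "\<And>x y. x \<in> A \<Longrightarrow> y \<in> B \<Longrightarrow> norm (g x y) \<le> f x y"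
  shows "psum_le (\<lambda>x. w x * norm (infsum (g x) B)) A c"
proof -
  have n: "0 \<le> w x * f x y" if "x \<in> A" "y \<in> B" for x y
    using assms(3,4) that by (meson mult_nonneg_nonneg norm_ge_zero order_trans)
  have p: "psum_le (\<lambda>(x, y). w x * f x y) (A \<times> B) c"
    by (rule psum_le_prod_swap, rule psum_le_prodI[OF assms(1,2)]) (use n in auto)
  show ?thesis
  proof (rule psum_le_mono[OF psum_le_iterate[OF p]])
    fix x assume x: "x \<in> A"
    have "(\<lambda>y. w x * f x y) summable_on B"
      by (rule psum_le_real(1)[OF psum_le_prod_fst[OF p]]) (use n x in auto)
    then have "norm (infsum (\<lambda>y. w x *\<^sub>R g x y) B) \<le> infsum (\<lambda>y. w x * f x y) B"
      by (intro psum_le_infsum_le[OF psum_le_infsum]) (use n x assms in \<open>auto intro!: mult_left_mono\<close>)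
    then show "w x * norm (infsum (g x) B) \<le> infsum (\<lambda>y. w x * f x y) B"
      using assms(3)[OF x] by (simp add: infsum_scaleR_right)
  qed (use n in auto)
qed

lemma norm_neg_diff_le:
  fixes a b :: "'a::real_normed_vector"
  shows "norm (- a - b) \<le> norm a + norm b"
  using norm_triangle_ineq4[of "- a" b] by simp

lemma psum_le_shift_gt: "psum_le f {0<..} C \<Longrightarrow> psum_le (\<lambda>i. f (i - N)) {N<..} C" for N :: int
  by (rule psum_le_reindex) (auto simp: inj_on_def)

lemma psum_le_reflect_le: "psum_le f {0<..} C \<Longrightarrow> 0 < N \<Longrightarrow> psum_le (\<lambda>k. f (N - k)) {..0} C" for N :: int
  by (rule psum_le_reindex) (auto simp: inj_on_def)

section \<open>The contraction between the two outer parts and the error kernel\<close>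

context finite_section
begin

lemma psum_le_hilbert_theta:
  assumes "(0::int) < M"
  shows "psum_le (\<lambda>m. 1 / sqrt (real_of_int m) * (\<theta> / (pi * (real_of_int m + M)))) {0<..} (\<theta> / sqrt M)"
proof -
  have "psum_le (\<lambda>m. \<theta> / pi * (1 / (sqrt (real_of_int m) * (real_of_int m + M)))) {0<..} (\<theta> / pi * (pi / sqrt M))"
    using assms theta by (intro psum_le_cmult psum_le_hilbert) auto
  then show ?thesis by (simp add: mult_ac)
qed

text \<open>The inequality \<open>E_le\<close> bounds \<open>E\<close> only once \<open>E\<close> is
  known to be finite. Estimating the defining sum directly would give
  \<open>wt \<tau> (i - N)\<close>, which may be too weak against the weight. Since
  \<open>al_u\<close> vanishes beyond \<open>N\<close>, the sum can be replaced by minus the sum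
  over \<open>j \<le> N\<close>, and this one gains the additional exponent
  \<open>d\<close>.\<close>

lemma psum_le_eta_apriori: "\<exists>B. psum_le (\<lambda>i. 1 / sqrt (real_of_int (i - N)) * norm (\<eta> i)) {N<..} B"
proof -
  obtain U where U: "0 \<le> U" "\<And>j. norm (u j) \<le> U * wt \<tau> (j - N)" using u_le[of N] by blast
  have U': "norm (u j) \<le> U * wt \<tau> (N - j)" for j using U(2)[of j] by (simp add: wt_commute)
  have e: "\<eta> i = - infsum (\<lambda>j. al (i - j) ** u j) {..N}" if "N < i" for i
  proof -
    have "infsum (\<lambda>j. al (i - j) ** u j) UNIV = 0"
      unfolding al_u using that by (intro sum.neutral) (auto simp: causal mat_simps)
    moreover have "infsum (\<lambda>j. al (i - j) ** u j) ({..N} \<union> {N<..}) = infsum (\<lambda>j. al (i - j) ** u j) {..N} + \<eta> i"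
      unfolding \<eta>_def by (intro infsum_Un_disjoint summable_alu) auto
    moreover have "{..N} \<union> {N<..} = UNIV" by auto
    ultimately show ?thesis by (simp add: eq_neg_iff_add_eq_0 add.commute)
  qed
  define c where "c = K * U * pi * (2 * ((1 / 2 + d + \<tau>) / (1 / 2 + d + \<tau> - 1)))"
  have "psum_le (\<lambda>i. 1 / sqrt (real_of_int (i - N)) * norm (infsum (\<lambda>j. al (i - j) ** u j) {..N})) {N<..} c"
  proof (rule psum_le_weighted_infsum[where f = "\<lambda>i j. K * wt (1 + d) (i - j) * (U * wt \<tau> (N - j))"])
    fix j assume j: "j \<in> {..N}"
    have "psum_le (\<lambda>i. 1 / sqrt (real_of_int (i - N)) * wt (1 + d) ((i - N) + (N - j))) {N<..} (pi * wt (1 / 2 + d) (N - j))"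
      using j d psum_le_shift_gt[OF psum_le_sqrt_wt[of d "N - j"], of N] by simp
    from psum_le_cmult[OF this mult_nonneg_nonneg[OF K_nonneg mult_nonneg_nonneg[OF U(1) wt_nonneg[of \<tau> "N - j"]]]]
    show "psum_le (\<lambda>i. 1 / sqrt (real_of_int (i - N)) * (K * wt (1 + d) (i - j) * (U * wt \<tau> (N - j)))) {N<..} (K * U * pi * wt (1 / 2 + d + \<tau>) (N - j))"
      unfolding wt_add[of "1 / 2 + d" \<tau>] by (simp add: mult_ac)
  next
    have "psum_le (\<lambda>j. wt (1 / 2 + d + \<tau>) (N - j)) UNIV (2 * ((1 / 2 + d + \<tau>) / (1 / 2 + d + \<tau> - 1)))"
      using d by (intro psum_le_reflect psum_le_wt_UNIV) (auto simp: field_simps)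
    then show "psum_le (\<lambda>j. K * U * pi * wt (1 / 2 + d + \<tau>) (N - j)) {..N} c"
      unfolding c_def using U K_nonneg by (intro psum_le_cmult) (auto elim: psum_le_subset)
    show "norm (al (i - j) ** u j) \<le> K * wt (1 + d) (i - j) * (U * wt \<tau> (N - j))" for i j
      by (intro norm_mat_mult_le' al_le U')
  qed auto
  then have "psum_le (\<lambda>i. 1 / sqrt (real_of_int (i - N)) * norm (\<eta> i)) {N<..} c"
    by (rule psum_le_mono) (auto simp: e)
  then show ?thesis ..
qed

definition E :: real where "E = infsum (\<lambda>i. 1 / sqrt (real_of_int (i - N)) * norm (\<eta> i)) {N<..}"

lemma psum_le_eta: "psum_le (\<lambda>i. 1 / sqrt (real_of_int (i - N)) * norm (\<eta> i)) {N<..} E"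
proof -
  obtain B where "psum_le (\<lambda>i. 1 / sqrt (real_of_int (i - N)) * norm (\<eta> i)) {N<..} B"
    using psum_le_eta_apriori by blast
  then have "(\<lambda>i. 1 / sqrt (real_of_int (i - N)) * norm (\<eta> i)) summable_on {N<..}"
    by (rule psum_le_real(1)) auto
  then show ?thesis unfolding E_def by (rule psum_le_infsum) auto
qed

lemma V_small:
  fixes X :: "'q cmat"
  assumes "k \<le> 0" "N < i"
  shows "norm (V (k - i) ** X) \<le> \<theta> / (pi * real_of_int (i - k)) * norm X"
    and "norm (herm (V (k - i)) ** X) \<le> \<theta> / (pi * real_of_int (i - k)) * norm X"
  using V_sharp[of "i - k" X] assms N by auto

text \<open>The source terms of the coupled system: \<open>A1\<close> is what the data inside the
  section send directly beyond \<open>N\<close>; \<open>A2\<close> is what they send to the left of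
  1, weighted by the cost of its reflection to the right.\<close>

definition "A1 = (\<Sum>t\<in>{1..N}. K * pi * wt (1 / 2 + d) (N - t) * norm (u t))"
definition "A2 = (\<Sum>t\<in>{1..N}. \<theta> / sqrt N * K * ((1 + d) / d) * wt d t * norm (u t))"

text \<open>The weight on the left half line is also measured from \<open>N\<close>, not from 0.
  Then \<open>i - k\<close> is \<open>(i - N) + (N - k)\<close>, and the same Hilbert kernel governs
  both directions. The factor \<open>\<theta>\<close> in the weight is the norm of the step that
  leads back to the right.\<close>

lemma psum_le_xi: "psum_le (\<lambda>k. \<theta> / sqrt (real_of_int (N - k)) * norm (\<xi> k)) {..0} (\<theta>\<^sup>2 * E + A2)"
proof -
  have p1: "psum_le (\<lambda>k. \<theta> / sqrt (real_of_int (N - k)) * norm (infsum (\<lambda>i. V (k - i) ** \<eta> i) {N<..})) {..0} (\<theta>\<^sup>2 * E)"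
  proof (rule psum_le_weighted_infsum)
    fix i assume i: "i \<in> {N<..}"
    have "psum_le (\<lambda>k. 1 / sqrt (real_of_int (N - k)) * (\<theta> / (pi * (real_of_int (N - k) + real_of_int (i - N))))) {..0} (\<theta> / sqrt (real_of_int (i - N)))"
      using i N_pos psum_le_reflect_le[OF psum_le_hilbert_theta[of "i - N"], of N] by simp
    from psum_le_cmult[OF this, of "\<theta> * norm (\<eta> i)"] theta
    show "psum_le (\<lambda>k. \<theta> / sqrt (real_of_int (N - k)) * (\<theta> / (pi * real_of_int (i - k)) * norm (\<eta> i))) {..0}
        (\<theta>\<^sup>2 * (1 / sqrt (real_of_int (i - N)) * norm (\<eta> i)))"
      by (simp add: mult_ac power2_eq_square)
    show "norm (V (k - i) ** \<eta> i) \<le> \<theta> / (pi * real_of_int (i - k)) * norm (\<eta> i)" if "k \<in> {..0}" for k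
      using that i by (intro V_small) auto
  next
    show "psum_le (\<lambda>i. \<theta>\<^sup>2 * (1 / sqrt (real_of_int (i - N)) * norm (\<eta> i))) {N<..} (\<theta>\<^sup>2 * E)"
      by (intro psum_le_cmult psum_le_eta) simp
  qed (use theta N_pos in auto)
  have p2: "psum_le (\<lambda>k. \<Sum>t\<in>{1..N}. \<theta> / sqrt (real_of_int (N - k)) * (norm (a (t - k)) * norm (u t))) {..0} A2"
    unfolding A2_def
  proof (rule psum_le_sum)
    fix t assume t: "t \<in> {1..N}"
    show "psum_le (\<lambda>k. \<theta> / sqrt (real_of_int (N - k)) * (norm (a (t - k)) * norm (u t))) {..0}
       (\<theta> / sqrt N * K * ((1 + d) / d) * wt d t * norm (u t))"
    proof (rule psum_le_mono)
      show "psum_le (\<lambda>k. \<theta> / sqrt N * K * norm (u t) * wt (1 + d) (t - k)) {..0} (\<theta> / sqrt N * K * norm (u t) * ((1 + d) / d * wt d t))"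
        using t theta N_pos K_nonneg by (intro psum_le_cmult psum_wt1_tail) auto
      fix k :: int assume k: "k \<in> {..0}"
      have "\<theta> / sqrt (real_of_int (N - k)) * (norm (a (t - k)) * norm (u t)) \<le> \<theta> / sqrt N * (K * wt (1 + d) (t - k) * norm (u t))"
        using theta k N_pos K_nonneg
        by (intro mult_mono mult_right_mono divide_left_mono a_le mult_nonneg_nonneg) auto
      then show "\<theta> / sqrt (real_of_int (N - k)) * (norm (a (t - k)) * norm (u t)) \<le> \<theta> / sqrt N * K * norm (u t) * wt (1 + d) (t - k)"
        by (simp add: mult_ac)
    qed (simp only: divide_inverse mult_ac order_refl)
  qed simp
  show ?thesis
  proof (rule psum_le_mono[OF psum_le_add[OF p1 p2]])
    fix k :: int assume k: "k \<in> {..0}"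
    have "norm (\<xi> k) \<le> norm (infsum (\<lambda>i. V (k - i) ** \<eta> i) {N<..}) + norm (\<Sum>t\<in>{1..N}. herm (a (t - k)) ** u t)"
      using k by (simp only: xi_eq[of k] norm_neg_diff_le atMost_iff)
    also have "norm (\<Sum>t\<in>{1..N}. herm (a (t - k)) ** u t) \<le> (\<Sum>t\<in>{1..N}. norm (a (t - k)) * norm (u t))"
      by (intro sum_norm_le norm_mat_mult_le') auto
    finally have "\<theta> / sqrt (real_of_int (N - k)) * norm (\<xi> k) \<le> \<theta> / sqrt (real_of_int (N - k)) *
        (norm (infsum (\<lambda>i. V (k - i) ** \<eta> i) {N<..}) + (\<Sum>t\<in>{1..N}. norm (a (t - k)) * norm (u t)))"
      using theta k N_pos by (intro mult_left_mono) auto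
    then show "\<theta> / sqrt (real_of_int (N - k)) * norm (\<xi> k) \<le> \<theta> / sqrt (real_of_int (N - k)) * norm (infsum (\<lambda>i. V (k - i) ** \<eta> i) {N<..})
       + (\<Sum>t\<in>{1..N}. \<theta> / sqrt (real_of_int (N - k)) * (norm (a (t - k)) * norm (u t)))"
      by (simp only: distrib_left sum_distrib_left)
  qed simp
qed

text \<open>One round trip from right to left and back costs \<open>\<theta>\<^sup>2\<close>;
  everything else depends only on the data in the section.\<close>

lemma E_le: "E \<le> A1 + (\<theta>\<^sup>2 * E + A2)"
proof -
  have p1: "psum_le (\<lambda>i. 1 / sqrt (real_of_int (i - N)) * norm (infsum (\<lambda>k. herm (V (k - i)) ** \<xi> k) {..0})) {N<..} (\<theta>\<^sup>2 * E + A2)"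
  proof (rule psum_le_weighted_infsum)
    fix k :: int assume k: "k \<in> {..0}"
    have "psum_le (\<lambda>i. 1 / sqrt (real_of_int (i - N)) * (\<theta> / (pi * (real_of_int (i - N) + real_of_int (N - k))))) {N<..} (\<theta> / sqrt (real_of_int (N - k)))"
      using k N_pos psum_le_shift_gt[OF psum_le_hilbert_theta[of "N - k"], of N] by simp
    from psum_le_cmult[OF this, of "norm (\<xi> k)"]
    show "psum_le (\<lambda>i. 1 / sqrt (real_of_int (i - N)) * (\<theta> / (pi * real_of_int (i - k)) * norm (\<xi> k))) {N<..}
        (\<theta> / sqrt (real_of_int (N - k)) * norm (\<xi> k))"
      by (simp add: mult_ac)
    show "norm (herm (V (k - i)) ** \<xi> k) \<le> \<theta> / (pi * real_of_int (i - k)) * norm (\<xi> k)" if "i \<in> {N<..}" for i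
      using that k by (intro V_small) auto
  qed (use psum_le_xi in auto)
  have p2: "psum_le (\<lambda>i. \<Sum>t\<in>{1..N}. 1 / sqrt (real_of_int (i - N)) * (norm (al (i - t)) * norm (u t))) {N<..} A1"
    unfolding A1_def
  proof (rule psum_le_sum)
    fix t assume t: "t \<in> {1..N}"
    have "psum_le (\<lambda>i. 1 / sqrt (real_of_int (i - N)) * wt (1 + d) ((i - N) + (N - t))) {N<..} (pi * wt (1 / 2 + d) (N - t))"
      using t d psum_le_shift_gt[OF psum_le_sqrt_wt[of d "N - t"], of N] by simp
    from psum_le_cmult[OF this, of "K * norm (u t)"] K_nonneg
    have "psum_le (\<lambda>i. 1 / sqrt (real_of_int (i - N)) * (K * wt (1 + d) (i - t) * norm (u t))) {N<..} (K * pi * wt (1 / 2 + d) (N - t) * norm (u t))"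
      by (simp add: mult_ac)
    then show "psum_le (\<lambda>i. 1 / sqrt (real_of_int (i - N)) * (norm (al (i - t)) * norm (u t))) {N<..} (K * pi * wt (1 / 2 + d) (N - t) * norm (u t))"
      by (rule psum_le_mono) (intro mult_left_mono mult_right_mono al_le norm_ge_zero, auto)
  qed simp
  have "psum_le (\<lambda>i. 1 / sqrt (real_of_int (i - N)) * norm (\<eta> i)) {N<..} (\<theta>\<^sup>2 * E + A2 + A1)"
  proof (rule psum_le_mono[OF psum_le_add[OF p1 p2]])
    fix i :: int assume i: "i \<in> {N<..}"
    have "\<eta> i = - infsum (\<lambda>k. herm (V (k - i)) ** \<xi> k) {..0} - (\<Sum>t\<in>{1..N}. al (i - t) ** u t)"
      using eta_eq[of i] al_u_left(1)[of i] i by simp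
    then have "norm (\<eta> i) \<le> norm (infsum (\<lambda>k. herm (V (k - i)) ** \<xi> k) {..0}) + norm (\<Sum>t\<in>{1..N}. al (i - t) ** u t)"
      by (simp only: norm_neg_diff_le)
    also have "norm (\<Sum>t\<in>{1..N}. al (i - t) ** u t) \<le> (\<Sum>t\<in>{1..N}. norm (al (i - t)) * norm (u t))"
      by (intro sum_norm_le norm_mat_mult_le') auto
    finally have "1 / sqrt (real_of_int (i - N)) * norm (\<eta> i) \<le> 1 / sqrt (real_of_int (i - N)) *
        (norm (infsum (\<lambda>k. herm (V (k - i)) ** \<xi> k) {..0}) + (\<Sum>t\<in>{1..N}. norm (al (i - t)) * norm (u t)))"
      using i by (intro mult_left_mono) auto
    then show "1 / sqrt (real_of_int (i - N)) * norm (\<eta> i) \<le> 1 / sqrt (real_of_int (i - N)) * norm (infsum (\<lambda>k. herm (V (k - i)) ** \<xi> k) {..0})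
       + (\<Sum>t\<in>{1..N}. 1 / sqrt (real_of_int (i - N)) * (norm (al (i - t)) * norm (u t)))"
      by (simp only: distrib_left sum_distrib_left)
  qed simp
  then show ?thesis unfolding E_def by (intro psum_le_real(2)[THEN order_trans]) auto
qed

lemma E_bound: "E \<le> (A1 + A2) / (1 - \<theta>\<^sup>2)"
proof -
  have "\<theta>\<^sup>2 < 1" using theta by (simp add: abs_square_less_1)
  with E_le show ?thesis by (simp add: field_simps)
qed

text \<open>As in \<open>norm_T_le\<close>, the sum over \<open>k\<close> is extended to all
  integers to exhibit a cancellation. By \<open>a_V\<close> the full sum is a single coefficient of
  order \<open>1 + d\<close>, and the added part \<open>k \<le> 0\<close> is at distance at least
  \<open>s\<close> and \<open>i\<close> from the two indices.\<close>

lemma error_kernel_le: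
  assumes "1 \<le> s" "s \<le> N" "N < i"
  shows "norm (\<Sum>k\<in>{1..s}. a (s - k) ** V (k - i)) \<le> K * wt (1 + d) (i - s) + K\<^sup>2 * ((1 + d) / d) * (wt d s * wt 1 i)"
proof -
  define f where "f = (\<lambda>k. a (s - k) ** V (k - i))"
  have fs: "f summable_on UNIV"
    unfolding f_def
    by (rule psum_le_summable[OF psum_le_cmult[OF psum_le_reflect[OF a_psum] K_nonneg]])
      (subst mult.commute, rule norm_mat_mult_le', auto simp: bounded_by_K)
  have "infsum f UNIV = infsum f {..0} + (\<Sum>k\<in>{1..s}. f k) + infsum f {s<..}"
    using fs assms by (intro infsum_int_split) auto
  moreover have "infsum f {s<..} = 0"
    by (rule infsum_0) (auto simp: f_def causal mat_simps)
  moreover have "infsum f UNIV = herm (al (i - s))" unfolding f_def by (rule a_V)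
  ultimately have "(\<Sum>k\<in>{1..s}. f k) = herm (al (i - s)) - infsum f {..0}"
    by (simp add: eq_diff_eq add.commute)
  moreover have "norm (infsum f {..0}) \<le> K\<^sup>2 * wt 1 i * ((1 + d) / d * wt d s)"
  proof (rule psum_le_infsum_le)
    show "psum_le (\<lambda>k. K\<^sup>2 * wt 1 i * wt (1 + d) (s - k)) {..0} (K\<^sup>2 * wt 1 i * ((1 + d) / d * wt d s))"
      using assms by (intro psum_le_cmult psum_wt1_tail) auto
    show "norm (f k) \<le> K\<^sup>2 * wt 1 i * wt (1 + d) (s - k)" if "k \<in> {..0}" for k
    proof -
      have "norm (f k) \<le> (K * wt (1 + d) (s - k)) * (K * wt 1 (k - i))"
        unfolding f_def by (intro norm_mat_mult_le' a_le V_le)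
      also have "\<dots> \<le> (K * wt (1 + d) (s - k)) * (K * wt 1 i)"
        using that assms K_nonneg by (intro mult_left_mono wt_antimono) auto
      finally show ?thesis by (simp add: power2_eq_square mult_ac)
    qed
  qed
  ultimately show ?thesis
    using al_le[of "i - s"] norm_triangle_ineq4[of "herm (al (i - s))" "infsum f {..0}"]
    by (simp add: f_def mult_ac)
qed

definition "C5 = K / (1 / 2 - d) + K\<^sup>2 * ((1 + d) / d) / (1 - d)"

lemma C5_nonneg: "0 \<le> C5"
  unfolding C5_def using K_nonneg d by (intro add_nonneg_nonneg divide_nonneg_nonneg mult_nonneg_nonneg) auto

text \<open>Of the decay \<open>1 + d\<close> one half is spent on the weight
  \<open>1 / sqrt (i - N)\<close> of \<open>\<eta>\<close>. The remaining exponent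
  \<open>1 / 2 + d\<close> is below 1, so the sum over \<open>s\<close> grows like
  \<open>N powr (1 / 2 - d)\<close>; the second part of the kernel grows at the same rate.\<close>

lemma sum_error_kernel_le:
  assumes i: "N < i"
  shows "(\<Sum>s\<in>{1..N}. K * wt (1 + d) (i - s) + K\<^sup>2 * ((1 + d) / d) * (wt d s * wt 1 i))
    \<le> C5 * wt (d - 1 / 2) N * (1 / sqrt (real_of_int (i - N)))"
proof -
  have w: "wt (1 / 2) (i - N) \<le> 1 / sqrt (real_of_int (i - N))"
  proof -
    have "wt (1 / 2) (i - N) = 1 / sqrt (1 + real_of_int (i - N))"
      using i by (simp add: wt_def powr_minus powr_half_sqrt divide_simps)
    also have "\<dots> \<le> 1 / sqrt (real_of_int (i - N))" using i by (intro divide_left_mono) auto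
    finally show ?thesis .
  qed
  have "(\<Sum>s\<in>{1..N}. wt (1 + d) (i - s)) \<le> (\<Sum>s\<in>{1..N}. wt (1 / 2) (i - N) * wt (1 / 2 + d) (N - s))"
  proof (rule sum_mono)
    fix s assume s: "s \<in> {1..N}"
    have "wt (1 / 2 + (1 / 2 + d)) (i - s) \<le> wt (1 / 2) (i - N) * wt (1 / 2 + d) (N - s)"
      unfolding wt_add[of "1 / 2" "1 / 2 + d"] using i s d by (intro mult_mono wt_antimono) auto
    then show "wt (1 + d) (i - s) \<le> wt (1 / 2) (i - N) * wt (1 / 2 + d) (N - s)" by simp
  qed
  also have "\<dots> = wt (1 / 2) (i - N) * (\<Sum>s\<in>{1..N}. wt (1 / 2 + d) (N - s))"
    by (simp add: sum_distrib_left)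
  also have "(\<Sum>s\<in>{1..N}. wt (1 / 2 + d) (N - s)) = (\<Sum>s\<in>{0..N - 1}. wt (1 / 2 + d) s)"
    by (rule sum.reindex_bij_witness[of _ "\<lambda>t. N - t" "\<lambda>t. N - t"]) auto
  also have "wt (1 / 2) (i - N) * (\<Sum>s\<in>{0..N - 1}. wt (1 / 2 + d) s) \<le> 1 / sqrt (real_of_int (i - N)) * (1 / (1 / 2 - d) * wt (d - 1 / 2) N)"
  proof (intro mult_mono w)
    have "(\<Sum>s\<in>{0..N - 1}. wt (1 / 2 + d) s) \<le> (\<Sum>s\<in>{0..N}. wt (1 / 2 + d) s)" by (intro sum_mono2) auto
    also have "\<dots> \<le> 1 / (1 - (1 / 2 + d)) * wt (1 / 2 + d - 1) N"
      using d N_pos by (intro sum_wt_le) auto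
    finally show "(\<Sum>s\<in>{0..N - 1}. wt (1 / 2 + d) s) \<le> 1 / (1 / 2 - d) * wt (d - 1 / 2) N"
      by (simp add: algebra_simps)
  qed (use i in \<open>auto intro!: sum_nonneg\<close>)
  finally have 1: "(\<Sum>s\<in>{1..N}. wt (1 + d) (i - s)) \<le> 1 / (1 / 2 - d) * (wt (d - 1 / 2) N * (1 / sqrt (real_of_int (i - N))))"
    by (simp add: mult_ac)
  have "(\<Sum>s\<in>{1..N}. wt d s) \<le> (\<Sum>s\<in>{0..N}. wt d s)" by (intro sum_mono2) auto
  also have "\<dots> \<le> 1 / (1 - d) * wt (d - 1) N" using d N_pos by (intro sum_wt_le) auto
  finally have 2: "(\<Sum>s\<in>{1..N}. wt d s) \<le> 1 / (1 - d) * wt (d - 1) N" .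
  have "wt 1 i \<le> wt (1 / 2) N * (1 / sqrt (real_of_int (i - N)))"
  proof -
    have "wt (1 / 2 + 1 / 2) i \<le> wt (1 / 2) N * wt (1 / 2) (i - N)"
      unfolding wt_add using i N_pos by (intro mult_mono wt_antimono) auto
    also have "\<dots> \<le> wt (1 / 2) N * (1 / sqrt (real_of_int (i - N)))" by (intro mult_left_mono w) auto
    finally show ?thesis by simp
  qed
  with 2 have "(\<Sum>s\<in>{1..N}. wt d s) * wt 1 i \<le> 1 / (1 - d) * wt (d - 1) N * (wt (1 / 2) N * (1 / sqrt (real_of_int (i - N))))"
    using d by (intro mult_mono) auto
  also have "\<dots> = 1 / (1 - d) * (wt (d - 1 / 2) N * (1 / sqrt (real_of_int (i - N))))"
    using wt_add[of "d - 1" "1 / 2" N] by (simp add: mult_ac)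
  finally have 3: "(\<Sum>s\<in>{1..N}. wt d s) * wt 1 i \<le> 1 / (1 - d) * (wt (d - 1 / 2) N * (1 / sqrt (real_of_int (i - N))))" .
  have "(\<Sum>s\<in>{1..N}. K * wt (1 + d) (i - s) + K\<^sup>2 * ((1 + d) / d) * (wt d s * wt 1 i))
      = K * (\<Sum>s\<in>{1..N}. wt (1 + d) (i - s)) + K\<^sup>2 * ((1 + d) / d) * ((\<Sum>s\<in>{1..N}. wt d s) * wt 1 i)"
    by (simp only: sum.distrib sum_distrib_left sum_distrib_right)
  also have "\<dots> \<le> K * (1 / (1 / 2 - d) * (wt (d - 1 / 2) N * (1 / sqrt (real_of_int (i - N))))) +
     K\<^sup>2 * ((1 + d) / d) * (1 / (1 - d) * (wt (d - 1 / 2) N * (1 / sqrt (real_of_int (i - N)))))"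
    using 1 3 K_nonneg d by (intro add_mono mult_left_mono) auto
  also have "\<dots> = C5 * wt (d - 1 / 2) N * (1 / sqrt (real_of_int (i - N)))"
    unfolding C5_def by (simp only: distrib_right) (simp add: mult_ac)
  finally show ?thesis .
qed

lemma sum_error_le:
  "(\<Sum>s\<in>{1..N}. norm (x s - (\<Sum>t\<in>{1..N}. T s t ** u t))) \<le> C5 * wt (d - 1 / 2) N * E"
proof -
  have e: "x s - (\<Sum>t\<in>{1..N}. T s t ** u t) = infsum (\<lambda>i. (\<Sum>k\<in>{1..s}. a (s - k) ** V (k - i)) ** \<eta> i) {N<..}"
    if "s \<in> {1..N}" for s
  proof -
    have "((\<lambda>i. \<Sum>k\<in>{1..s}. a (s - k) ** (V (k - i) ** \<eta> i)) has_sum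
        (\<Sum>k\<in>{1..s}. a (s - k) ** infsum (\<lambda>i. V (k - i) ** \<eta> i) {N<..})) {N<..}"
      using that a_u_tail(2)
      by (intro has_sum_finite_sum has_sum_bounded_linear[OF mat.bounded_linear_right] has_sum_infsum) auto
    then show ?thesis
      unfolding error_eq[OF that] by (simp add: has_sum_iff mat.sum_left matrix_mul_assoc)
  qed
  have "psum_le (\<lambda>s. 1 * norm (infsum (\<lambda>i. (\<Sum>k\<in>{1..s}. a (s - k) ** V (k - i)) ** \<eta> i) {N<..})) {1..N} (C5 * wt (d - 1 / 2) N * E)"
  proof (rule psum_le_weighted_infsum)
    fix i assume i: "i \<in> {N<..}"
    have "psum_le (\<lambda>s. K * wt (1 + d) (i - s) + K\<^sup>2 * ((1 + d) / d) * (wt d s * wt 1 i)) {1..N} (C5 * wt (d - 1 / 2) N * (1 / sqrt (real_of_int (i - N))))"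
      using K_nonneg d sum_error_kernel_le[of i] i by (intro psum_le_mono[OF psum_le_finite]) (auto intro!: add_nonneg_nonneg mult_nonneg_nonneg)
    from psum_le_cmult[OF this, of "norm (\<eta> i)"]
    show "psum_le (\<lambda>s. 1 * ((K * wt (1 + d) (i - s) + K\<^sup>2 * ((1 + d) / d) * (wt d s * wt 1 i)) * norm (\<eta> i))) {1..N}
      (C5 * wt (d - 1 / 2) N * (1 / sqrt (real_of_int (i - N)) * norm (\<eta> i)))"
      by (simp add: mult_ac)
  next
    show "psum_le (\<lambda>i. C5 * wt (d - 1 / 2) N * (1 / sqrt (real_of_int (i - N)) * norm (\<eta> i))) {N<..} (C5 * wt (d - 1 / 2) N * E)"
      using C5_nonneg by (intro psum_le_cmult psum_le_eta) auto
    show "norm ((\<Sum>k\<in>{1..s}. a (s - k) ** V (k - i)) ** \<eta> i) \<le>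
        (K * wt (1 + d) (i - s) + K\<^sup>2 * ((1 + d) / d) * (wt d s * wt 1 i)) * norm (\<eta> i)"
      if "s \<in> {1..N}" "i \<in> {N<..}" for s i
      using that by (intro norm_mat_mult_le' error_kernel_le) auto
  qed auto
  from psum_leD[OF this, of "{1..N}"] show ?thesis by (simp add: e)
qed

end

section \<open>The error of the finite section for data of power decay\<close>

context symbol_factors
begin

lemma summable_T:
  fixes y :: "int \<Rightarrow> 'q cmat"
  assumes "\<And>t. 1 \<le> t \<Longrightarrow> norm (y t) \<le> Y"
  shows "(\<lambda>t. T s t ** y t) summable_on {1..}"
proof -
  have "(\<lambda>t. a (s - k) ** herm (a (t - k)) ** y t) summable_on {1..}" for k
  proof (rule psum_le_summable)
    have "0 \<le> Y" using order_trans[OF norm_ge_zero assms[of 1]] by simp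
    then show "psum_le (\<lambda>t. norm (a (s - k)) * Y * norm (a (t - k))) {1..} (norm (a (s - k)) * Y * S1)"
      by (intro psum_le_cmult psum_le_subset[OF psum_le_shift_minus[OF a_psum]]) auto
    show "norm (a (s - k) ** herm (a (t - k)) ** y t) \<le> norm (a (s - k)) * Y * norm (a (t - k))" if "t \<in> {1..}" for t
      using norm_mat_mult_le3[OF order_refl order_refl assms[of t], of "a (s - k)" "herm (a (t - k))"] that
      by (simp add: mult_ac)
  qed
  then have "(\<lambda>t. \<Sum>k\<in>{1..s}. a (s - k) ** herm (a (t - k)) ** y t) summable_on {1..}"
    by (rule has_sum_imp_summable[OF has_sum_finite_sum[OF has_sum_infsum]])
  then show ?thesis by (simp add: T_def mat.sum_left)
qed

text \<open>The error is at most of order \<open>N powr (1 / 2 - d)\<close> times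
  \<open>A1 + A2\<close>, plus the tail. \<open>A1\<close> is a beta sum of order
  \<open>N powr (1 / 2 - d - \<rho>)\<close>, which leads to the first rate and is where
  \<open>\<rho> < 1\<close> is used. \<open>A2\<close> has order \<open>N powr (- 1 / 2)\<close>
  times the partial sum, which leads to the second rate.\<close>

theorem finite_section_error:
  fixes y :: "int \<Rightarrow> 'q cmat"
  assumes \<rho>: "1 - 2 * d < \<rho>" "\<rho> < 1" and y: "\<And>t. 1 \<le> t \<Longrightarrow> norm (y t) \<le> Y * wt \<rho> t"
  shows "\<exists>C. \<forall>N\<ge>n0. \<forall>x. (\<forall>s\<in>{1..N}. (\<Sum>t\<in>{1..N}. gam (s - t) ** x t) = y s) \<longrightarrow>
    (\<Sum>s\<in>{1..N}. norm (infsum (\<lambda>t. T s t ** y t) {1..} - x s)) \<le>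
      C * (wt (\<rho> + 2 * d - 1) N + wt d N * (\<Sum>t\<in>{0..N}. wt (\<rho> + d) t))"
proof -
  have \<rho>0: "0 < \<rho>" using \<rho> d by linarith
  have Y: "0 \<le> Y" using order_trans[OF norm_ge_zero y[of 1]] wt_pos[of \<rho> 1] by (simp add: zero_le_mult_iff)
  obtain CT where CT: "\<And>N. 0 \<le> N \<Longrightarrow> psum_le (\<lambda>(s, t). norm (T s t) * wt \<rho> t) ({1..N} \<times> {N<..}) (CT * wt (\<rho> + 2 * d - 1) N)"
    using tail_contribution[OF \<rho>] by blast
  define C5 where "C5 = K / (1 / 2 - d) + K\<^sup>2 * ((1 + d) / d) / (1 - d)"
  \<comment> \<open>The constant of \<open>sum_wt_beta\<close> for the exponents
    \<open>\<rho>\<close> and \<open>1 / 2 + d\<close>.\<close>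
  define Cb where "Cb = 2 powr \<rho> / (1 - (1 / 2 + d)) + 2 powr (1 / 2 + d) / (1 - \<rho>)"
  define D1 where "D1 = C5 / (1 - \<theta>\<^sup>2) * (K * pi * Y * Cb)"
  define D2 where "D2 = C5 / (1 - \<theta>\<^sup>2) * (2 * \<theta> * K * ((1 + d) / d) * Y)"
  have th: "0 < 1 - \<theta>\<^sup>2" using theta by (simp add: abs_square_less_1)
  have C5: "0 \<le> C5"
    unfolding C5_def using K_nonneg d by (intro add_nonneg_nonneg divide_nonneg_nonneg mult_nonneg_nonneg) auto
  have "(\<Sum>s\<in>{1..N}. norm (infsum (\<lambda>t. T s t ** y t) {1..} - x s)) \<le>
      (D1 + D2 + Y * \<bar>CT\<bar>) * (wt (\<rho> + 2 * d - 1) N + wt d N * (\<Sum>t\<in>{0..N}. wt (\<rho> + d) t))"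
    if N: "n0 \<le> N" and x: "\<forall>s\<in>{1..N}. (\<Sum>t\<in>{1..N}. gam (s - t) ** x t) = y s" for N x
  proof -
    interpret F: finite_section d c cs al a gam V K \<theta> n0 N x
      by unfold_locales (rule N)
    have uy: "F.u t = y t" if "t \<in> {1..N}" for t using x that by (simp add: F.u_def)
    define S where "S = (\<Sum>t\<in>{0..N}. wt (\<rho> + d) t)"
    have S0: "0 \<le> S" by (auto simp: S_def intro!: sum_nonneg)
    have A1: "F.A1 \<le> K * pi * Y * (Cb * wt (\<rho> + d - 1 / 2) N)"
    proof -
      have "F.A1 \<le> (\<Sum>t\<in>{1..N}. K * pi * Y * (wt \<rho> t * wt (1 / 2 + d) (N - t)))"
        unfolding F.A1_def
      proof (rule sum_mono)
        fix t assume t: "t \<in> {1..N}"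
        have "K * pi * wt (1 / 2 + d) (N - t) * norm (F.u t) \<le> K * pi * wt (1 / 2 + d) (N - t) * (Y * wt \<rho> t)"
          using t y[of t] K_nonneg by (intro mult_left_mono) (auto simp: uy)
        then show "K * pi * wt (1 / 2 + d) (N - t) * norm (F.u t) \<le> K * pi * Y * (wt \<rho> t * wt (1 / 2 + d) (N - t))"
          by (simp add: mult_ac)
      qed
      also have "\<dots> = K * pi * Y * (\<Sum>t\<in>{1..N}. wt \<rho> t * wt (1 / 2 + d) (N - t))" by (simp add: sum_distrib_left)
      also have "\<dots> \<le> K * pi * Y * (Cb * wt (\<rho> + d - 1 / 2) N)"
      proof (intro mult_left_mono)
        have "(\<Sum>t\<in>{1..N}. wt \<rho> t * wt (1 / 2 + d) (N - t)) \<le> (\<Sum>t\<in>{0..N}. wt \<rho> t * wt (1 / 2 + d) (N - t))"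
          by (intro sum_mono2) auto
        also have "\<dots> \<le> Cb * wt (\<rho> + (1 / 2 + d) - 1) N"
          unfolding Cb_def using d \<rho> \<rho>0 F.N_pos by (intro sum_wt_beta) auto
        finally show "(\<Sum>t\<in>{1..N}. wt \<rho> t * wt (1 / 2 + d) (N - t)) \<le> Cb * wt (\<rho> + d - 1 / 2) N"
          by (simp add: algebra_simps)
      qed (use K_nonneg Y in auto)
      finally show ?thesis .
    qed
    have A2: "F.A2 \<le> 2 * \<theta> * K * ((1 + d) / d) * Y * (wt (1 / 2) N * S)"
    proof -
      have sq: "1 / sqrt N \<le> 2 * wt (1 / 2) N"
      proof -
        have "sqrt (1 + real_of_int N) \<le> sqrt (4 * real_of_int N)" using F.N_pos by (intro real_sqrt_le_mono) auto
        then have "1 / (2 * sqrt N) \<le> 1 / sqrt (1 + real_of_int N)"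
          using F.N_pos by (intro divide_left_mono) (auto simp: real_sqrt_mult)
        also have "\<dots> = wt (1 / 2) N" using F.N_pos by (simp add: wt_def powr_minus powr_half_sqrt divide_simps)
        finally show ?thesis by simp
      qed
      have "F.A2 \<le> (\<Sum>t\<in>{1..N}. \<theta> * K * ((1 + d) / d) * Y * (1 / sqrt N) * wt (\<rho> + d) t)"
        unfolding F.A2_def
      proof (rule sum_mono)
        fix t assume t: "t \<in> {1..N}"
        have "\<theta> / sqrt N * K * ((1 + d) / d) * wt d t * norm (F.u t) \<le> \<theta> / sqrt N * K * ((1 + d) / d) * wt d t * (Y * wt \<rho> t)"
          using t y[of t] K_nonneg theta d F.N_pos by (intro mult_left_mono) (auto simp: uy)
        then show "\<theta> / sqrt N * K * ((1 + d) / d) * wt d t * norm (F.u t) \<le> \<theta> * K * ((1 + d) / d) * Y * (1 / sqrt N) * wt (\<rho> + d) t"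
          by (simp add: wt_add mult_ac)
      qed
      also have "\<dots> = \<theta> * K * ((1 + d) / d) * Y * (1 / sqrt N) * (\<Sum>t\<in>{1..N}. wt (\<rho> + d) t)"
        by (simp add: sum_distrib_left)
      also have "\<dots> \<le> \<theta> * K * ((1 + d) / d) * Y * (2 * wt (1 / 2) N) * S"
        unfolding S_def using theta K_nonneg d Y F.N_pos sq
        by (intro mult_mono mult_left_mono sum_mono2) (auto intro!: sum_nonneg mult_nonneg_nonneg)
      finally show ?thesis by (simp only: mult_ac)
    qed
    have "(\<Sum>s\<in>{1..N}. norm (x s - (\<Sum>t\<in>{1..N}. T s t ** y t))) = (\<Sum>s\<in>{1..N}. norm (x s - (\<Sum>t\<in>{1..N}. T s t ** F.u t)))"
      by (simp add: uy)
    also have "\<dots> \<le> C5 * wt (d - 1 / 2) N * F.E" using F.sum_error_le by (simp add: C5_def F.C5_def)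
    also have "\<dots> \<le> C5 * wt (d - 1 / 2) N * ((F.A1 + F.A2) / (1 - \<theta>\<^sup>2))"
      using C5 by (intro mult_left_mono F.E_bound) auto
    also have "\<dots> \<le> C5 * wt (d - 1 / 2) N * ((K * pi * Y * (Cb * wt (\<rho> + d - 1 / 2) N) + 2 * \<theta> * K * ((1 + d) / d) * Y * (wt (1 / 2) N * S)) / (1 - \<theta>\<^sup>2))"
      using C5 th by (intro mult_left_mono divide_right_mono add_mono A1 A2) auto
    also have "\<dots> = D1 * (wt (d - 1 / 2) N * wt (\<rho> + d - 1 / 2) N) + D2 * ((wt (d - 1 / 2) N * wt (1 / 2) N) * S)"
      unfolding D1_def D2_def by (simp add: add_divide_distrib distrib_left mult_ac)
    also have "wt (d - 1 / 2) N * wt (\<rho> + d - 1 / 2) N = wt (\<rho> + 2 * d - 1) N"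
      by (simp flip: wt_add add: algebra_simps)
    also have "wt (d - 1 / 2) N * wt (1 / 2) N = wt d N" by (simp flip: wt_add)
    finally have 1: "(\<Sum>s\<in>{1..N}. norm (x s - (\<Sum>t\<in>{1..N}. T s t ** y t))) \<le> D1 * wt (\<rho> + 2 * d - 1) N + D2 * (wt d N * S)" .
    have yb: "norm (y t) \<le> Y" if "1 \<le> t" for t
      using y[OF that] mult_left_mono[OF wt_le_1[of \<rho> t] Y] \<rho>0 by simp
    have z: "infsum (\<lambda>t. T s t ** y t) {1..} = (\<Sum>t\<in>{1..N}. T s t ** y t) + infsum (\<lambda>t. T s t ** y t) {N<..}" for s
    proof -
      have sm: "(\<lambda>t. T s t ** y t) summable_on A" if "A \<subseteq> {1..}" for A
        by (rule summable_on_subset_banach[OF summable_T[OF yb] that])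
      have "infsum (\<lambda>t. T s t ** y t) ({1..N} \<union> {N<..}) = infsum (\<lambda>t. T s t ** y t) {1..N} + infsum (\<lambda>t. T s t ** y t) {N<..}"
        using F.N_pos by (intro infsum_Un_disjoint sm) auto
      moreover have "{1..N} \<union> {N<..} = {1..}" using F.N_pos by auto
      ultimately show ?thesis by simp
    qed
    have 2: "(\<Sum>s\<in>{1..N}. norm (infsum (\<lambda>t. T s t ** y t) {N<..})) \<le> Y * (CT * wt (\<rho> + 2 * d - 1) N)"
    proof -
      have p: "psum_le (\<lambda>(s, t). Y * (norm (T s t) * wt \<rho> t)) ({1..N} \<times> {N<..}) (Y * (CT * wt (\<rho> + 2 * d - 1) N))"
        using psum_le_cmult[OF CT Y, of N] F.N_pos by (simp add: case_prod_unfold)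
      have "psum_le (\<lambda>s. infsum (\<lambda>t. Y * (norm (T s t) * wt \<rho> t)) {N<..}) {1..N} (Y * (CT * wt (\<rho> + 2 * d - 1) N))"
        by (rule psum_le_iterate[OF p]) (use Y in auto)
      from psum_leD[OF this, of "{1..N}"]
      have "(\<Sum>s\<in>{1..N}. infsum (\<lambda>t. Y * (norm (T s t) * wt \<rho> t)) {N<..}) \<le> Y * (CT * wt (\<rho> + 2 * d - 1) N)" by simp
      moreover have "norm (infsum (\<lambda>t. T s t ** y t) {N<..}) \<le> infsum (\<lambda>t. Y * (norm (T s t) * wt \<rho> t)) {N<..}" if "s \<in> {1..N}" for s
      proof (rule psum_le_infsum_le[OF psum_le_infsum])
        show "(\<lambda>t. Y * (norm (T s t) * wt \<rho> t)) summable_on {N<..}"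
          by (rule psum_le_real(1)[OF psum_le_prod_fst[OF p]]) (use Y that in auto)
        fix t assume t: "t \<in> {N<..}"
        then have "norm (T s t ** y t) \<le> norm (T s t) * (Y * wt \<rho> t)"
          using F.N_pos by (intro norm_mat_mult_le' y) auto
        then show "norm (T s t ** y t) \<le> Y * (norm (T s t) * wt \<rho> t)" by (simp add: mult_ac)
      qed (use Y in auto)
      ultimately show ?thesis using sum_mono[of "{1..N}"] by (meson order_trans)
    qed
    have "(\<Sum>s\<in>{1..N}. norm (infsum (\<lambda>t. T s t ** y t) {1..} - x s)) \<le>
        (\<Sum>s\<in>{1..N}. norm (x s - (\<Sum>t\<in>{1..N}. T s t ** y t)) + norm (infsum (\<lambda>t. T s t ** y t) {N<..}))"
    proof (rule sum_mono)
      fix s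
      have "infsum (\<lambda>t. T s t ** y t) {1..} - x s = infsum (\<lambda>t. T s t ** y t) {N<..} - (x s - (\<Sum>t\<in>{1..N}. T s t ** y t))"
        by (simp add: z)
      then show "norm (infsum (\<lambda>t. T s t ** y t) {1..} - x s) \<le> norm (x s - (\<Sum>t\<in>{1..N}. T s t ** y t)) + norm (infsum (\<lambda>t. T s t ** y t) {N<..})"
        using norm_triangle_ineq4 by (simp only: add.commute)
    qed
    also have "\<dots> \<le> D1 * wt (\<rho> + 2 * d - 1) N + D2 * (wt d N * S) + Y * (CT * wt (\<rho> + 2 * d - 1) N)"
      using 1 2 by (simp add: sum.distrib)
    also have "\<dots> \<le> (D1 + D2 + Y * \<bar>CT\<bar>) * (wt (\<rho> + 2 * d - 1) N + wt d N * S)"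
    proof -
      have "0 \<le> Cb" unfolding Cb_def using d \<rho> by (intro add_nonneg_nonneg divide_nonneg_nonneg) auto
      then have "0 \<le> D1" "0 \<le> D2"
        unfolding D1_def D2_def using C5 th K_nonneg Y theta d
        by (auto intro!: mult_nonneg_nonneg divide_nonneg_nonneg)
      moreover have "Y * (CT * wt (\<rho> + 2 * d - 1) N) \<le> Y * \<bar>CT\<bar> * wt (\<rho> + 2 * d - 1) N"
        using Y by (simp add: mult.assoc mult_left_mono mult_right_mono)
      moreover have "0 \<le> wt d N * S" "0 \<le> wt (\<rho> + 2 * d - 1) N" "0 \<le> Y * \<bar>CT\<bar>" using S0 Y by auto
      ultimately show ?thesis
        unfolding distrib_left distrib_right by (smt (verit) mult_nonneg_nonneg)
    qed
    finally show ?thesis unfolding S_def .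
  qed
  then show ?thesis by blast
qed

end

section \<open>Solvability of the finite sections\<close>

text \<open>Positive definiteness: with \<open>F\<close> the image of \<open>x\<close> under
  \<open>h\<^sub>\<sharp>\<close>, the quadratic form of the section is the sum of
  \<open>herm (F k) ** F k\<close>. If it is zero, its trace makes every \<open>F k\<close> vanish,
  and \<open>x_eq\<close> recovers \<open>x\<close>.\<close>

lemma (in symbol_factors) section_injective:
  fixes x :: "int \<Rightarrow> 'q cmat"
  assumes "\<And>s. s \<in> {1..N} \<Longrightarrow> (\<Sum>t\<in>{1..N}. gam (s - t) ** x t) = 0" and t: "t \<in> {1..N}"
  shows "x t = 0"
proof -
  define F where "F k = (\<Sum>t\<in>{1..N}. cs (k - t) ** x t)" for k
  have g: "((\<lambda>k. herm (cs (k - s)) ** cs (k - t)) has_sum gam (s - t)) UNIV" for s t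
  proof -
    have "(\<lambda>m. herm (cs m) ** cs (m + (s - t))) summable_on UNIV"
      by (rule psum_le_summable[OF psum_le_mult_sq[OF psum_le_sq_wt[OF d(2) cs_le] psum_le_shift[OF psum_le_sq_wt[OF d(2) cs_le]]]])
        (rule norm_mat_mult_le', auto)
    then have "((\<lambda>m. herm (cs m) ** cs (m + (s - t))) has_sum gam (s - t)) UNIV"
      by (simp add: has_sum_iff gam_cs)
    then show ?thesis
      by (subst has_sum_reindex_bij_witness[of _ "\<lambda>m. m + s" "\<lambda>k. k - s" UNIV "\<lambda>m. herm (cs m) ** cs (m + (s - t))"]) auto
  qed
  have "((\<lambda>k. herm (x s) ** (\<Sum>t\<in>{1..N}. herm (cs (k - s)) ** cs (k - t) ** x t)) has_sum
      herm (x s) ** (\<Sum>t\<in>{1..N}. gam (s - t) ** x t)) UNIV" for s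
    by (intro has_sum_bounded_linear[OF mat.bounded_linear_right] has_sum_finite_sum
        has_sum_bounded_linear[OF mat.bounded_linear_left] g)
  then have "((\<lambda>k. \<Sum>s\<in>{1..N}. herm (x s) ** (\<Sum>t\<in>{1..N}. herm (cs (k - s)) ** cs (k - t) ** x t)) has_sum
      (\<Sum>s\<in>{1..N}. herm (x s) ** (\<Sum>t\<in>{1..N}. gam (s - t) ** x t))) UNIV"
    by (intro has_sum_finite_sum)
  moreover have "(\<Sum>s\<in>{1..N}. herm (x s) ** (\<Sum>t\<in>{1..N}. gam (s - t) ** x t)) = 0"
    using assms(1) by (intro sum.neutral) (auto simp: mat_simps)
  moreover have "(\<Sum>s\<in>{1..N}. herm (x s) ** (\<Sum>t\<in>{1..N}. herm (cs (k - s)) ** cs (k - t) ** x t)) = herm (F k) ** F k" for k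
  proof -
    have hs: "herm (\<Sum>s\<in>S. f s) = (\<Sum>s\<in>S. herm (f s))" for f :: "int \<Rightarrow> 'q cmat" and S
      by (induction S rule: infinite_finite_induct) (auto simp: herm_add)
    show ?thesis
      unfolding F_def hs herm_mult mat.sum_left by (simp add: mat.sum_right matrix_mul_assoc)
  qed
  ultimately have "((\<lambda>k. herm (F k) ** F k) has_sum 0) UNIV" by simp
  from has_sum_bounded_linear[OF bounded_linear_vec_nth this]
  have "((\<lambda>k. (herm (F k) ** F k) $ i) has_sum 0) UNIV" for i by simp
  from has_sum_bounded_linear[OF bounded_linear_vec_nth this]
  have "((\<lambda>k. (herm (F k) ** F k) $ i $ i) has_sum 0) UNIV" for i by simp
  then have "((\<lambda>k. \<Sum>i\<in>UNIV. (herm (F k) ** F k) $ i $ i) has_sum (\<Sum>i\<in>(UNIV::'q set). 0)) UNIV"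
    by (intro has_sum_finite_sum)
  then have "((\<lambda>k. complex_of_real ((norm (F k))\<^sup>2)) has_sum 0) UNIV"
    unfolding norm_sq_trace by simp
  from has_sum_bounded_linear[OF bounded_linear_Re this]
  have n: "((\<lambda>k. (norm (F k))\<^sup>2) has_sum 0) UNIV" by simp
  have "F k = 0" for k
    using finite_sum_le_has_sum[OF n, of "{k}"] by simp
  then show ?thesis using x_eq[OF t, of x] by (simp add: F_def mat_simps)
qed

lemma invertible_mat_if_injective:
  fixes S :: "'q::finite cmat"
  assumes "\<And>X :: 'q cmat. S ** X = 0 \<Longrightarrow> X = 0"
  shows "\<exists>S'. S ** S' = mat 1"
proof -
  have "x = 0" if "S *v x = 0" for x
  proof -
    \<comment> \<open>The kernel vector is repeated in every column to obtain a matrix.\<close>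
    have "S ** (\<chi> i j. x $ i) = 0"
      using that by (simp add: matrix_matrix_mult_def matrix_vector_mult_def vec_eq_iff)
    then have "(\<chi> i j. x $ i) = (0 :: 'q cmat)" by (rule assms)
    then show ?thesis by (simp add: vec_eq_iff)
  qed
  then obtain B where "B ** S = mat 1" using matrix_left_invertible_ker[of S] by blast
  then show ?thesis using matrix_left_right_inverse[of B S] by auto
qed

text \<open>All leading sections are included because the elimination of the last unknown relies on
  solving the smaller system.\<close>

definition sections_injective :: "nat \<Rightarrow> (nat \<Rightarrow> nat \<Rightarrow> 'q::finite cmat) \<Rightarrow> bool" where
  "sections_injective n A \<longleftrightarrow> (\<forall>m\<le>n. \<forall>x :: nat \<Rightarrow> 'q cmat.
     (\<forall>s\<in>{1..m}. (\<Sum>t=1..m. A s t ** x t) = 0) \<longrightarrow> (\<forall>t\<in>{1..m}. x t = 0))"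

lemma sections_injectiveD:
  fixes x :: "nat \<Rightarrow> 'q::finite cmat"
  assumes "sections_injective n A" "m \<le> n" "\<And>s. s \<in> {1..m} \<Longrightarrow> (\<Sum>t=1..m. A s t ** x t) = 0" "t \<in> {1..m}"
  shows "x t = 0"
  using assms unfolding sections_injective_def by blast

text \<open>Block elimination: the last unknown is solved for through its Schur complement.\<close>
lemma block_system_solvable:
  fixes A :: "nat \<Rightarrow> nat \<Rightarrow> 'q::finite cmat" and y :: "nat \<Rightarrow> 'q cmat"
  assumes inj: "sections_injective n A"
  shows "\<exists>x. \<forall>s\<in>{1..n}. (\<Sum>t=1..n. A s t ** x t) = y s"
  using inj
proof (induction n arbitrary: y)
  case (Suc m)
  have "sections_injective m A"
    using Suc.prems unfolding sections_injective_def by (meson le_SucI)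
  then have IH: "\<exists>x. \<forall>s\<in>{1..m}. (\<Sum>t=1..m. A s t ** x t) = y s" for y :: "nat \<Rightarrow> 'q cmat"
    by (rule Suc.IH)
  obtain p where p: "\<And>s. s \<in> {1..m} \<Longrightarrow> (\<Sum>t=1..m. A s t ** p t) = A s (Suc m)"
    using IH[of "\<lambda>s. A s (Suc m)"] by blast
  define S where "S = A (Suc m) (Suc m) - (\<Sum>t=1..m. A (Suc m) t ** p t)"
  have sys: "(\<Sum>t=1..Suc m. A s t ** (if t = Suc m then v else x0 t - p t ** v))
      = (if s = Suc m then (\<Sum>t=1..m. A s t ** x0 t) + S ** v else (\<Sum>t=1..m. A s t ** x0 t))"
    if "s \<in> {1..Suc m}" for s and v :: "'q cmat" and x0
  proof -
    have "(\<Sum>t=1..m. A s t ** (if t = Suc m then v else x0 t - p t ** v)) = (\<Sum>t=1..m. A s t ** (x0 t - p t ** v))"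
      by (intro sum.cong) auto
    also have "\<dots> = (\<Sum>t=1..m. A s t ** x0 t) - (\<Sum>t=1..m. A s t ** p t) ** v"
      by (simp add: mat_simps sum_subtractf matrix_mul_assoc mat.sum_left)
    finally show ?thesis using that p[of s] by (auto simp: S_def mat_simps)
  qed
  have "\<exists>S'. S ** S' = mat 1"
  proof (rule invertible_mat_if_injective)
    fix X :: "'q cmat" assume X: "S ** X = 0"
    define x where "x t = (if t = Suc m then X else 0 - p t ** X)" for t
    have "(\<Sum>t=1..Suc m. A s t ** x t) = 0" if "s \<in> {1..Suc m}" for s
      using sys[OF that, of X "\<lambda>_. 0"] X by (simp add: x_def mat_simps split: if_splits)
    then have "x (Suc m) = 0" using sections_injectiveD[OF Suc.prems, of "Suc m" x "Suc m"] by simp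
    then show "X = 0" by (simp add: x_def)
  qed
  then obtain S' where S': "S ** S' = mat 1" ..
  obtain x0 where x0: "\<And>s. s \<in> {1..m} \<Longrightarrow> (\<Sum>t=1..m. A s t ** x0 t) = y s"
    using IH[of y] by blast
  define v where "v = S' ** (y (Suc m) - (\<Sum>t=1..m. A (Suc m) t ** x0 t))"
  have v: "S ** v = y (Suc m) - (\<Sum>t=1..m. A (Suc m) t ** x0 t)"
    by (simp add: v_def matrix_mul_assoc S')
  show ?case
  proof (intro exI ballI)
    fix s assume s: "s \<in> {1..Suc m}"
    show "(\<Sum>t=1..Suc m. A s t ** (if t = Suc m then v else x0 t - p t ** v)) = y s"
      unfolding sys[OF s] using v x0[of s] s by auto
  qed
qed simp

text \<open>The columns of a right inverse \<open>B\<close> come from solvability. It is also a left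
  inverse by injectivity, since \<open>A\<close> applied to \<open>B A\<close> is \<open>A\<close>
  again; this gives existence for the definite description, and injectivity once more gives
  uniqueness.\<close>

lemma block_inverse_eq:
  fixes A :: "nat \<Rightarrow> nat \<Rightarrow> 'q::finite cmat"
  assumes inj: "sections_injective n A"
    and "s \<in> {1..n}" "t \<in> {1..n}"
  shows "(\<Sum>u=1..n. A s u ** block_inverse n A u t) = (if s = t then mat 1 else 0)"
proof -
  let ?P = "\<lambda>B. (\<forall>s\<in>{1..n}. \<forall>t\<in>{1..n}.
        (\<Sum>u=1..n. A s u ** B u t) = (if s = t then mat 1 else 0) \<and>
        (\<Sum>u=1..n. B s u ** A u t) = (if s = t then mat 1 else 0)) \<and>
     (\<forall>s t. s \<notin> {1..n} \<or> t \<notin> {1..n} \<longrightarrow> B s t = 0)"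
  have inj': "x t = x' t" if "\<And>s. s \<in> {1..n} \<Longrightarrow> (\<Sum>t=1..n. A s t ** x t) = (\<Sum>t=1..n. A s t ** x' t)" "t \<in> {1..n}"
    for x x' :: "nat \<Rightarrow> 'q cmat" and t
    using sections_injectiveD[OF inj, of n "\<lambda>t. x t - x' t" t] that by (simp add: mat_simps sum_subtractf)
  have "\<exists>x. \<forall>s\<in>{1..n}. (\<Sum>u=1..n. A s u ** x u) = (if s = t then mat 1 else 0)" for t
    by (rule block_system_solvable[OF inj])
  then obtain B0 where B0: "\<And>s t. s \<in> {1..n} \<Longrightarrow> (\<Sum>u=1..n. A s u ** B0 t u) = (if s = t then mat 1 else 0)"
    by metis
  define B where "B s t = (if s \<in> {1..n} \<and> t \<in> {1..n} then B0 t s else 0)" for s t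
  have AB: "(\<Sum>u=1..n. A s u ** B u t) = (if s = t then mat 1 else 0)" if "s \<in> {1..n}" "t \<in> {1..n}" for s t
    using B0[OF that(1), of t] that by (simp add: B_def)
  have BA: "(\<Sum>v=1..n. B u v ** A v t) = (if u = t then mat 1 else 0)" if "u \<in> {1..n}" "t \<in> {1..n}" for u t
  proof (rule inj'[OF _ that(1)])
    fix s assume s: "s \<in> {1..n}"
    have "(\<Sum>u=1..n. A s u ** (\<Sum>v=1..n. B u v ** A v t)) = (\<Sum>v=1..n. (\<Sum>u=1..n. A s u ** B u v) ** A v t)"
      by (simp add: mat.sum_right mat.sum_left matrix_mul_assoc) (rule sum.swap)
    also have "\<dots> = (\<Sum>v=1..n. if v = s then A s t else 0)"
    proof (rule sum.cong)
      fix v assume "v \<in> {1..n}"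
      then show "(\<Sum>u=1..n. A s u ** B u v) ** A v t = (if v = s then A s t else 0)"
        unfolding AB[OF s \<open>v \<in> {1..n}\<close>] by (auto simp: mat_simps)
    qed simp
    also have "\<dots> = A s t" using s by simp
    also have "\<dots> = (\<Sum>u=1..n. if u = t then A s t else 0)" using that by simp
    also have "\<dots> = (\<Sum>u=1..n. A s u ** (if u = t then mat 1 else 0))"
      by (intro sum.cong) (auto simp: mat_simps)
    finally show "(\<Sum>u=1..n. A s u ** (\<Sum>v=1..n. B u v ** A v t)) = (\<Sum>u=1..n. A s u ** (if u = t then mat 1 else 0))" .
  qed
  have "?P B" using AB BA by (simp add: B_def)
  moreover have "B' = B" if "?P B'" for B'
  proof (intro ext)
    fix s t
    show "B' s t = B s t"
    proof (cases "s \<in> {1..n} \<and> t \<in> {1..n}")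
      case True
      show ?thesis
      proof (rule inj'[of "\<lambda>s. B' s t" "\<lambda>s. B s t"])
        fix r assume r: "r \<in> {1..n}"
        have "(\<Sum>u=1..n. A r u ** B' u t) = (if r = t then mat 1 else 0)"
          using that r True by blast
        then show "(\<Sum>u=1..n. A r u ** B' u t) = (\<Sum>u=1..n. A r u ** B u t)"
          using AB[of r t] r True by simp
      qed (use True in simp)
    next
      case False
      then have "B' s t = 0" using that by blast
      then show ?thesis using False by (auto simp: B_def)
    qed
  qed
  ultimately have "block_inverse n A = B" unfolding block_inverse_def by (rule the_equality)
  then show ?thesis using AB assms by simp
qed

lemma finite_solution_solves:
  assumes inj: "sections_injective n (toeplitz w)"
    and s: "s \<in> {1..n}"
  shows "(\<Sum>t=1..n. toeplitz w s t ** finite_solution w y n t) = y s"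
proof -
  have "(\<Sum>t=1..n. toeplitz w s t ** finite_solution w y n t)
      = (\<Sum>v=1..n. (\<Sum>t=1..n. toeplitz w s t ** block_inverse n (toeplitz w) t v) ** y v)"
    unfolding finite_solution_def
    by (simp add: mat.sum_right mat.sum_left matrix_mul_assoc) (rule sum.swap)
  also have "\<dots> = (\<Sum>v=1..n. if v = s then y v else 0)"
    using block_inverse_eq[OF inj s] by (intro sum.cong) (auto simp: mat_simps)
  also have "\<dots> = y s" using s by simp
  finally show ?thesis .
qed

section \<open>Binomial coefficients and their correlations\<close>

lemma has_sum_int_nat:
  fixes f :: "int \<Rightarrow> 'b::{comm_monoid_add, topological_space}"
  assumes "\<And>k. k < 0 \<Longrightarrow> f k = 0"
  shows "(f has_sum S) UNIV \<longleftrightarrow> ((\<lambda>n. f (int n)) has_sum S) UNIV"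
proof -
  have "((\<lambda>n. f (int n)) has_sum S) UNIV \<longleftrightarrow> (f has_sum S) {0..}"
    by (rule has_sum_reindex_bij_witness[of _ nat int]) auto
  also have "\<dots> \<longleftrightarrow> (f has_sum S) UNIV"
    by (rule has_sum_cong_neutral) (auto simp: assms)
  finally show ?thesis by simp
qed

text \<open>\<open>bc x k\<close> is the coefficient of \<open>z\<^sup>k\<close> in \<open>(1 - z) powr (- x)\<close>.\<close>
definition bc :: "real \<Rightarrow> int \<Rightarrow> real" where
  "bc x k = (if k < 0 then 0 else pochhammer x (nat k) / fact (nat k))"

lemma bc_neg [simp]: "k < 0 \<Longrightarrow> bc x k = 0"
  by (simp add: bc_def)

lemma bc_0 [simp]: "bc x 0 = 1"
  by (simp add: bc_def)

text \<open>Written without division it holds at every integer: at \<open>k = -1\<close> the left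
  factor 0 absorbs the jump from 0 to 1. So recurrences for two-sided sums need no boundary terms at
  the origin.\<close>

lemma bc_rec: "(real_of_int k + 1) * bc x (k + 1) = (real_of_int k + x) * bc x k"
proof (cases "k < 0")
  case True
  then show ?thesis by (cases "k = -1") auto
next
  case False
  then obtain n where k: "k = int n" by (metis not_less zero_le_imp_eq_int)
  have n: "nat (1 + int n) = Suc n" "1 + real n \<noteq> 0" by auto
  have "(1 + real n) * (pochhammer x n * (x + real n) / ((1 + real n) * fact n)) = (real n + x) * (pochhammer x n / fact n)"
    using n(2) by simp
  then show ?thesis by (simp add: k bc_def n(1) pochhammer_Suc add_ac)
qed

lemma bc_Suc: "bc x (int (Suc n)) = (real n + x) / (real n + 1) * bc x (int n)"
  using bc_rec[of "int n" x] by (simp add: field_simps)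

lemma powr_ratio_cancel:
  fixes a b c :: real
  shows "0 < a \<Longrightarrow> 0 < b \<Longrightarrow> (a / b) powr c * a powr (- c) = b powr (- c)"
  by (simp add: powr_divide powr_minus field_simps)

lemma half_powr_minus:
  fixes a c :: real
  shows "0 < a \<Longrightarrow> (a / 2) powr (- c) = 2 powr c * a powr (- c)"
  by (simp add: powr_divide powr_minus field_simps)

lemma bernoulli_powr_le:
  fixes t c :: real
  assumes "0 < t" "0 \<le> c" "c \<le> 1"
  shows "(1 + t) powr c \<le> 1 + c * t"
proof -
  have "0 * (1 + t - 1) \<le> (c * (1 + t) - (1 + t) powr c) - (c * 1 - 1 powr c)"
  proof (rule increment_ge[where G' = "\<lambda>x. c - c * x powr (c - 1)"])
    show "continuous_on {1..1 + t} (\<lambda>x. c * x - x powr c)"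
      by (intro continuous_intros) auto
    show "((\<lambda>x. c * x - x powr c) has_real_derivative c - c * x powr (c - 1)) (at x)" if "1 < x" for x
      using that by (auto intro!: derivative_eq_intros)
    show "0 \<le> c - c * x powr (c - 1)" if "1 < x" for x
      using powr_mono2'[of "c - 1" 1 x] that assms by (simp add: mult_left_le)
  qed (use assms in auto)
  then show ?thesis by (simp add: algebra_simps)
qed

text \<open>This and \<open>one_minus_le\<close> compare the ratio of consecutive coefficients with
  the ratio of consecutive powers, so that power bounds follow from the recurrence by induction
  without losing a constant at each step.\<close>

lemma inverse_one_plus_le:
  fixes m c :: real
  assumes "0 < m" "0 \<le> c" "c \<le> 1"
  shows "1 / (1 + c / m) \<le> (m / (m + 1)) powr c"
proof -
  have "(1 + 1 / m) powr c \<le> 1 + c / m" using bernoulli_powr_le[of "1 / m" c] assms by simp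
  moreover have p: "0 < 1 + 1 / m" using assms by (simp add: add_pos_pos)
  ultimately have "1 / (1 + c / m) \<le> 1 / (1 + 1 / m) powr c"
    using assms by (intro divide_left_mono mult_pos_pos add_pos_nonneg) auto
  also have "\<dots> = (1 / (1 + 1 / m)) powr c" using p by (simp add: powr_divide)
  also have "1 / (1 + 1 / m) = m / (m + 1)"
  proof -
    have "1 + 1 / m = (m + 1) / m" using assms by (simp add: field_simps)
    then show ?thesis by simp
  qed
  finally show ?thesis .
qed

lemma one_minus_le:
  fixes m c :: real
  assumes "0 < m" "0 \<le> c" "c \<le> 1"
  shows "1 - c / m \<le> (m / (m + 1)) powr c"
proof -
  have "(1 - c / m) * (1 + c / m) \<le> 1" by (simp add: algebra_simps)
  then have "1 - c / m \<le> 1 / (1 + c / m)"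
    using assms by (subst pos_le_divide_eq) (auto intro: add_pos_nonneg)
  with inverse_one_plus_le[OF assms] show ?thesis by linarith
qed

lemma bc_pos_le:
  assumes "0 < d" "d < 1"
  shows "\<bar>bc d k\<bar> \<le> wt (1 - d) k"
proof (cases "k < 0")
  case False
  have "0 \<le> bc d (int n) \<and> bc d (int n) \<le> (real n + 1) powr (- (1 - d))" for n
  proof (induction n)
    case (Suc n)
    have e: "(real n + d) / (real n + 1) = 1 - (1 - d) / (real n + 1)" by (simp add: field_simps)
    have "(real n + d) / (real n + 1) * bc d (int n) \<le> ((real n + 1) / (real n + 1 + 1)) powr (1 - d) * (real n + 1) powr (- (1 - d))"
      using Suc assms one_minus_le[of "real n + 1" "1 - d"] unfolding e by (intro mult_mono) auto
    also have "\<dots> = (real n + 1 + 1) powr (- (1 - d))"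
      by (rule powr_ratio_cancel) auto
    finally show ?case using Suc assms unfolding bc_Suc by (simp add: add_ac)
  qed simp
  from this[of "nat k"] False show ?thesis by (simp add: wt_def add_ac)
qed simp

text \<open>The factor in the recurrence is negative only in the step from 0 to 1. The induction
  therefore starts at \<open>k = 1\<close> and gives \<open>k powr (- (1 + d))\<close>; passing to
  \<open>1 + k\<close> costs \<open>2 powr (1 + d) \<le> 4\<close>.\<close>

lemma bc_neg_le:
  assumes "0 < d" "d < 1"
  shows "\<bar>bc (- d) k\<bar> \<le> 4 * wt (1 + d) k"
proof (cases "k \<le> 0")
  case True
  then show ?thesis by (cases "k = 0") auto
next
  case False
  have "\<bar>bc (- d) (int (Suc n))\<bar> \<le> (real n + 1) powr (- (1 + d))" for n
  proof (induction n)
    case 0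
    show ?case using assms bc_Suc[of "- d" 0] by simp
  next
    case (Suc n)
    define m where "m = real n + 1"
    have m: "0 < m" "d < m" using assms by (auto simp: m_def)
    have "1 - d / m = (m - d) / m" using m by (simp add: field_simps)
    then have e: "(m - d) / (m + 1) = (1 - d / m) * (m / (m + 1))" using m by simp
    have "\<bar>bc (- d) (int (Suc (Suc n)))\<bar> = (m - d) / (m + 1) * \<bar>bc (- d) (int (Suc n))\<bar>"
      using m unfolding bc_Suc[of "- d" "Suc n"] abs_mult by (simp add: m_def add_ac)
    also have "\<dots> \<le> ((m / (m + 1)) powr d * (m / (m + 1))) * m powr (- (1 + d))"
      using Suc m assms one_minus_le[of m d] unfolding e
      by (intro mult_mono) (auto simp: m_def)
    also have "(m / (m + 1)) powr d * (m / (m + 1)) = (m / (m + 1)) powr (1 + d)"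
      using m by (simp add: powr_add)
    also have "\<dots> * m powr (- (1 + d)) = (m + 1) powr (- (1 + d))"
      using m by (intro powr_ratio_cancel) auto
    finally show ?case by (simp add: m_def add_ac)
  qed
  from this[of "nat k - 1"] False have "\<bar>bc (- d) k\<bar> \<le> (real_of_int k) powr (- (1 + d))"
    by (simp add: of_nat_diff)
  also have "\<dots> \<le> ((1 + real_of_int k) / 2) powr (- (1 + d))"
    using False assms by (intro powr_mono2') auto
  also have "\<dots> = 2 powr (1 + d) * wt (1 + d) k"
    using False half_powr_minus[of "1 + real_of_int k" "1 + d"] by (simp add: wt_def)
  also have "2 powr (1 + d) \<le> (2::real) powr 2" using assms by (intro powr_mono) auto
  finally show ?thesis by (simp add: mult_right_mono)
qed

text \<open>The Fourier coefficient of index \<open>k\<close> of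
  \<open>cnj ((1 - z) powr (- x)) * (1 - z) powr (- y)\<close> on the circle.\<close>

definition corr :: "real \<Rightarrow> real \<Rightarrow> int \<Rightarrow> real" where
  "corr x y k = infsum (\<lambda>m. bc x m * bc y (m + k)) UNIV"

lemma summable_corr:
  assumes "0 < d" "d < 1" "\<And>k. \<bar>bc y k\<bar> \<le> B"
  shows "(\<lambda>m. bc (- d) m * bc y (m + k)) summable_on UNIV"
proof (rule psum_le_summable)
  have "0 \<le> B" using order_trans[OF abs_ge_zero assms(3)[of 0]] .
  then show "psum_le (\<lambda>m. 4 * B * wt (1 + d) m) UNIV (4 * B * (2 * ((1 + d) / d)))"
    using psum_le_wt_UNIV[of "1 + d"] assms by (intro psum_le_cmult) auto
  show "norm (bc (- d) m * bc y (m + k)) \<le> 4 * B * wt (1 + d) m" for m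
    using mult_mono[OF bc_neg_le[OF assms(1,2), of m] assms(3)[of "m + k"]] by (simp add: abs_mult mult_ac)
qed

text \<open>The recurrences of the two factors make the summand of the difference the increment of
  \<open>m * bc (-d) m * bc y (m + k)\<close>.\<close>
lemma corr_rec:
  assumes "0 < d" "d < 1" "\<And>k. \<bar>bc y k\<bar> \<le> B"
  shows "(real_of_int k + 1 + d) * corr (- d) y (k + 1) = (real_of_int k + y) * corr (- d) y k"
proof -
  define R where "R m = real_of_int m * (bc (- d) m * bc y (m + k))" for m
  note s = summable_corr[OF assms]
  have inc: "(real_of_int k + 1 + d) * (bc (- d) m * bc y (m + (k + 1))) - (real_of_int k + y) * (bc (- d) m * bc y (m + k))
      = R m - R (m + 1)" for m
  proof -
    define b b' e e' where "b = bc (- d) m" "b' = bc (- d) (m + 1)" "e = bc y (m + k)" "e' = bc y (m + k + 1)"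
    have 1: "(real_of_int m + 1) * b' = (real_of_int m - d) * b"
      using bc_rec[of m "- d"] by (simp add: b_b'_e_e'_def)
    have 2: "(real_of_int m + real_of_int k + 1) * e' = (real_of_int m + real_of_int k + y) * e"
      using bc_rec[of "m + k" y] by (simp add: b_b'_e_e'_def)
    have "(real_of_int k + 1 + d) * (b * e') - (real_of_int k + y) * (b * e)
        = b * ((real_of_int m + real_of_int k + 1) * e' - (real_of_int m + real_of_int k + y) * e) + real_of_int m * (b * e) - ((real_of_int m - d) * b) * e'"
      by (simp add: algebra_simps)
    also have "\<dots> = real_of_int m * (b * e) - ((real_of_int m + 1) * b') * e'" by (simp only: 1 2) simp
    finally show ?thesis by (simp add: R_def b_b'_e_e'_def add_ac)
  qed
  have "((\<lambda>m. R m - R (m + 1)) has_sum ((real_of_int k + 1 + d) * corr (- d) y (k + 1) - (real_of_int k + y) * corr (- d) y k)) UNIV"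
    unfolding inc[symmetric] corr_def
    unfolding diff_conv_add_uminus
    by (intro has_sum_add has_sum_uminusI has_sum_cmult_right has_sum_infsum s)
  moreover have "R m - R (m + 1) = 0" if "m < 0" for m
    using that by (cases "m = -1") (auto simp: R_def)
  ultimately have "((\<lambda>n. R (int n) - R (int n + 1)) has_sum ((real_of_int k + 1 + d) * corr (- d) y (k + 1) - (real_of_int k + y) * corr (- d) y k)) UNIV"
    by (subst (asm) has_sum_int_nat) auto
  then have "(\<lambda>n. R (int n) - R (int (Suc n))) sums ((real_of_int k + 1 + d) * corr (- d) y (k + 1) - (real_of_int k + y) * corr (- d) y k)"
    by (simp add: has_sum_imp_sums add_ac)
  moreover have "(\<lambda>n. R (int n) - R (int (Suc n))) sums (R (int 0) - 0)"
  proof (rule telescope_sums')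
    have B: "0 \<le> B" using order_trans[OF abs_ge_zero assms(3)[of 0]] .
    \<comment> \<open>The boundary term at infinity is \<open>n\<close> times
      \<open>n powr (- 1 - d)\<close> times a bounded factor.\<close>
    have ev: "\<forall>\<^sub>F n in sequentially. norm (R (int n)) \<le> 4 * B * (1 + real n) powr (- d)"
    proof (intro always_eventually allI)
      fix n
      have "\<bar>R (int n)\<bar> = real n * (\<bar>bc (- d) (int n)\<bar> * \<bar>bc y (int n + k)\<bar>)" by (simp add: R_def abs_mult)
      also have "\<dots> \<le> (1 + real n) * ((4 * wt (1 + d) (int n)) * B)"
        using B by (intro mult_mono bc_neg_le assms) auto
      also have "\<dots> = 4 * B * (1 + real n) powr (- d)"
        by (simp add: wt_add wt_1) (simp add: wt_def)
      finally show "norm (R (int n)) \<le> 4 * B * (1 + real n) powr (- d)" by simp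
    qed
    have "(\<lambda>n. 4 * B * (1 + real n) powr (- d)) \<longlonglongrightarrow> 4 * B * 0"
    proof (intro tendsto_mult tendsto_const tendsto_neg_powr)
      show "filterlim (\<lambda>n. 1 + real n) at_top sequentially"
        by (rule filterlim_tendsto_add_at_top[OF tendsto_const filterlim_real_sequentially])
    qed (use assms in auto)
    then show "(\<lambda>n. R (int n)) \<longlonglongrightarrow> 0"
      using Lim_null_comparison[OF ev] by (simp only: mult_zero_right)
  qed
  ultimately have "(real_of_int k + 1 + d) * corr (- d) y (k + 1) - (real_of_int k + y) * corr (- d) y k = R (int 0) - 0"
    by (rule sums_unique2)
  then show ?thesis by (simp add: R_def)
qed

text \<open>For \<open>y = d\<close> the recurrence \<open>corr_rec\<close> says that
  \<open>(k + d) * corr (- d) d k\<close> is constant in \<open>k\<close>. Its value at 0 is found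
  from Euler's product for the sine, because the partial sums of the series for \<open>k = 0\<close>
  are the partial products.\<close>

lemma corr_opposite:
  assumes "0 < d" "d < 1"
  shows "(real_of_int k + d) * corr (- d) d k = sin (pi * d) / pi"
proof -
  have b: "\<bar>bc d k\<bar> \<le> 1" for k using bc_pos_le[OF assms, of k] wt_le_1[of "1 - d" k] assms by linarith
  have "(real_of_int k + d) * corr (- d) d k = d * corr (- d) d 0"
  proof (induction k rule: int_induct[of _ 0])
    case (step1 i)
    then show ?case using corr_rec[OF assms b, of i] by (simp add: algebra_simps)
  next
    case (step2 i)
    then show ?case using corr_rec[OF assms b, of "i - 1"] by (simp add: algebra_simps)
  qed simp
  also have "corr (- d) d 0 = sin (pi * d) / (pi * d)"
  proof -
    have "((\<lambda>m. bc (- d) m * bc d (m + 0)) has_sum corr (- d) d 0) UNIV"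
      unfolding corr_def by (intro has_sum_infsum summable_corr[OF assms b])
    then have "(\<lambda>n. bc (- d) (int n) * bc d (int n)) sums corr (- d) d 0"
      by (intro has_sum_imp_sums) (subst (asm) has_sum_int_nat, auto)
    moreover have "(\<Sum>i<Suc M. bc (- d) (int i) * bc d (int i)) = (\<Prod>k=1..M. 1 - d\<^sup>2 / (real k)\<^sup>2)" for M
    proof (induction M)
      case (Suc M)
      \<comment> \<open>The new term is the increment of the partial product, by induction from the
        recurrence of both coefficients.\<close>
      have t: "bc (- d) (int (Suc M)) * bc d (int (Suc M)) = - (d\<^sup>2 / (real (Suc M))\<^sup>2) * (\<Prod>k=1..M. 1 - d\<^sup>2 / (real k)\<^sup>2)" for M
      proof (induction M)
        case 0
        show ?case by (simp add: bc_Suc[of _ 0, simplified] power2_eq_square)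
      next
        case (Suc M)
        define m where "m = real M + 1"
        have m: "m > 0" by (simp add: m_def)
        have "bc (- d) (int (Suc (Suc M))) * bc d (int (Suc (Suc M)))
            = ((m - d) / (m + 1) * ((m + d) / (m + 1))) * (bc (- d) (int (Suc M)) * bc d (int (Suc M)))"
          unfolding bc_Suc[of _ "Suc M"] by (simp add: m_def add_ac)
        also have "\<dots> = ((m - d) / (m + 1) * ((m + d) / (m + 1))) * (- (d\<^sup>2 / m\<^sup>2) * (\<Prod>k=1..M. 1 - d\<^sup>2 / (real k)\<^sup>2))"
          unfolding Suc.IH by (simp add: m_def add_ac)
        also have "((m - d) / (m + 1) * ((m + d) / (m + 1))) * (- (d\<^sup>2 / m\<^sup>2) * p) = - (d\<^sup>2 / (m + 1)\<^sup>2) * (p * (1 - d\<^sup>2 / m\<^sup>2))" for p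
          using m by (simp add: field_simps power2_eq_square)
        finally show ?case by (simp add: m_def add_ac)
      qed
      show ?case using Suc.IH t[of M] by (simp add: algebra_simps)
    qed simp
    ultimately have "(\<lambda>M. \<Prod>k=1..M. 1 - d\<^sup>2 / (real k)\<^sup>2) \<longlonglongrightarrow> corr (- d) d 0"
      using LIMSEQ_Suc[of "\<lambda>n. \<Sum>i<n. bc (- d) (int i) * bc d (int i)" "corr (- d) d 0"] unfolding sums_def by simp
    moreover have "(\<lambda>M. \<Prod>k=1..M. 1 - d\<^sup>2 / (real k)\<^sup>2) \<longlonglongrightarrow> sin (pi * d) / (pi * d)"
      using sin_product_formula_real'[of d] assms by simp
    ultimately show ?thesis by (rule LIMSEQ_unique)
  qed
  finally show ?thesis using assms by simp
qed

text \<open>Now the recurrence has the ratio \<open>(m - d) / (m + 1 + d)\<close>. It splits into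
  three factors, each comparable with a ratio of powers, and the mixed product
  \<open>(n + 1) powr (- (1 + d)) * (n + 2) powr (- d)\<close> reproduces itself exactly under these
  comparisons. Negative \<open>k\<close> follow by symmetry.\<close>

lemma corr_same_le:
  assumes "0 < d" "d < 1"
  shows "\<exists>C\<ge>0. \<forall>k. \<bar>corr (- d) (- d) k\<bar> \<le> C * wt (1 + 2 * d) k"
proof -
  define w where "w = corr (- d) (- d)"
  have b: "\<bar>bc (- d) k\<bar> \<le> 4" for k
    using bc_neg_le[OF assms, of k] wt_le_1[of "1 + d" k] assms by linarith
  have sym: "w (- k) = w k" for k
    using infsum_shift[of "\<lambda>m. bc (- d) m * bc (- d) (m - k)" k] by (simp add: w_def corr_def mult.commute)
  have st: "\<bar>w (int (Suc n))\<bar> \<le> 2 * \<bar>w 1\<bar> * ((real n + 1) powr (- (1 + d)) * (real n + 2) powr (- d))" for n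
  proof (induction n)
    case 0
    have "(2::real) powr d \<le> 2 powr 1" using assms by (intro powr_mono) auto
    then have "1 \<le> 2 * (2::real) powr (- d)" by (simp add: powr_minus field_simps)
    from mult_left_mono[OF this, of "\<bar>w 1\<bar>"] show ?case by (simp add: mult_ac)
  next
    case (Suc n)
    define m where "m = real n + 1"
    have m: "0 < m" "d < m" using assms by (auto simp: m_def)
    have "(m + 1 + d) * w (int (Suc n) + 1) = (m - d) * w (int (Suc n))"
      using corr_rec[OF assms b, of "int (Suc n)"] by (simp add: w_def m_def add_ac)
    then have "w (int (Suc n) + 1) = (m - d) / (m + 1 + d) * w (int (Suc n))"
      using m assms by (simp add: field_simps)
    then have "\<bar>w (int (Suc (Suc n)))\<bar> = (m - d) / (m + 1 + d) * \<bar>w (int (Suc n))\<bar>"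
      using m assms by (simp add: abs_mult add_ac)
    moreover have "(m - d) / (m + 1 + d) = (1 - d / m) * (m / (m + 1)) * (1 / (1 + d / (m + 1)))"
    proof -
      have "1 - d / m = (m - d) / m" "1 + d / (m + 1) = (m + 1 + d) / (m + 1)"
        using m assms by (auto simp: field_simps)
      then show ?thesis using m assms by simp
    qed
    ultimately have "\<bar>w (int (Suc (Suc n)))\<bar> = ((1 - d / m) * (m / (m + 1)) * (1 / (1 + d / (m + 1)))) * \<bar>w (int (Suc n))\<bar>"
      by simp
    also have "\<dots> \<le> ((m / (m + 1)) powr d * (m / (m + 1)) * ((m + 1) / (m + 1 + 1)) powr d) *
        (2 * \<bar>w 1\<bar> * (m powr (- (1 + d)) * (m + 1) powr (- d)))"
      using Suc m assms one_minus_le[of m d] inverse_one_plus_le[of "m + 1" d]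
      by (intro mult_mono) (auto simp: m_def add_ac)
    also have "\<dots> = 2 * \<bar>w 1\<bar> * ((m + 1) powr (- (1 + d)) * (m + 1 + 1) powr (- d))"
    proof -
      have e1: "(m / (m + 1)) powr d * (m / (m + 1)) * m powr (- (1 + d)) = (m + 1) powr (- (1 + d))"
        using powr_ratio_cancel[of m "m + 1" "1 + d"] m by (simp add: powr_add mult_ac)
      have e2: "((m + 1) / (m + 1 + 1)) powr d * (m + 1) powr (- d) = (m + 1 + 1) powr (- d)"
        using m by (intro powr_ratio_cancel) auto
      have "p * q * r * (2 * \<bar>w 1\<bar> * (s * t)) = 2 * \<bar>w 1\<bar> * ((p * q * s) * (r * t))" for p q r s t
        by (simp only: mult_ac)
      from this[of "(m / (m + 1)) powr d" "m / (m + 1)" "((m + 1) / (m + 1 + 1)) powr d" "m powr (- (1 + d))" "(m + 1) powr (- d)"]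
      show ?thesis unfolding e1 e2 .
    qed
    finally show ?case by (simp add: m_def add_ac)
  qed
  define C where "C = 8 * \<bar>w 1\<bar> + \<bar>w 0\<bar>"
  have pos: "\<bar>w k\<bar> \<le> C * wt (1 + 2 * d) k" if "0 \<le> k" for k
  proof (cases "k = 0")
    case True
    then show ?thesis by (simp add: C_def)
  next
    case False
    define n where "n = nat k - 1"
    have k: "k = int (Suc n)" using False that by (simp add: n_def)
    have "(real n + 1) powr (- (1 + d)) \<le> ((real n + 2) / 2) powr (- (1 + d))"
      using assms by (intro powr_mono2') auto
    also have "\<dots> = 2 powr (1 + d) * (real n + 2) powr (- (1 + d))"
      by (rule half_powr_minus) simp
    also have "\<dots> \<le> 2 powr 2 * (real n + 2) powr (- (1 + d))"
      using assms by (intro mult_right_mono powr_mono) auto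
    finally have "(real n + 1) powr (- (1 + d)) * (real n + 2) powr (- d) \<le> 4 * (real n + 2) powr (- (1 + d)) * (real n + 2) powr (- d)"
      by (intro mult_right_mono) auto
    also have "\<dots> = 4 * wt (1 + 2 * d) k"
      by (simp add: k wt_def mult.assoc add_ac flip: powr_add)
    finally have "2 * \<bar>w 1\<bar> * ((real n + 1) powr (- (1 + d)) * (real n + 2) powr (- d)) \<le> 2 * \<bar>w 1\<bar> * (4 * wt (1 + 2 * d) k)"
      by (intro mult_left_mono) auto
    also have "\<dots> \<le> C * wt (1 + 2 * d) k" by (simp add: C_def distrib_right)
    finally show ?thesis using st[of n] by (simp add: k)
  qed
  have "\<bar>w k\<bar> \<le> C * wt (1 + 2 * d) k" for k
    using pos[of k] pos[of "- k"] sym[of k] by (cases "0 \<le> k") auto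
  moreover have "0 \<le> C" by (simp add: C_def)
  ultimately show ?thesis unfolding w_def by blast
qed

section \<open>Symbols with a power singularity\<close>

text \<open>The coefficients of \<open>(1 - z) powr (- x)\<close> times the series with coefficients
  \<open>r\<close>.\<close>

definition bconv :: "real \<Rightarrow> (int \<Rightarrow> 'q::finite cmat) \<Rightarrow> int \<Rightarrow> 'q cmat" where
  "bconv x r k = infsum (\<lambda>l. bc x (k - l) *\<^sub>R r l) UNIV"

lemma norm_scaleR_le: "\<bar>f\<bar> \<le> k \<Longrightarrow> norm (f *\<^sub>R X) \<le> k * norm X"
  by (simp add: mult_right_mono)

text \<open>By \<open>wt_shift\<close>, decay of order \<open>q\<close> survives convolution with a
  sequence that has a moment of order \<open>q\<close>. Hence the rational factors change no
  exponent.\<close>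

lemma conv_wt_le:
  fixes r :: "int \<Rightarrow> 'q::finite cmat"
  assumes f: "\<And>j. \<bar>f j\<bar> \<le> A * wt q j" and q: "0 \<le> q"
    and r: "psum_le (\<lambda>l. wt (- q) l * norm (r l)) UNIV D"
  shows "norm (infsum (\<lambda>l. f (j - l) *\<^sub>R r l) UNIV) \<le> A * D * wt q j"
proof (rule psum_le_infsum_le)
  have A: "0 \<le> A" using order_trans[OF abs_ge_zero f[of 0]] by simp
  then have "psum_le (\<lambda>l. A * wt q j * (wt (- q) l * norm (r l))) UNIV (A * wt q j * D)"
    by (intro psum_le_cmult r) auto
  then show "psum_le (\<lambda>l. A * wt q j * (wt (- q) l * norm (r l))) UNIV (A * D * wt q j)"
    by (simp add: mult_ac)
  fix l
  have "norm (f (j - l) *\<^sub>R r l) \<le> (A * wt q (j - l)) * norm (r l)"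
    using f[of "j - l"] by (simp add: mult_right_mono)
  also have "\<dots> \<le> (A * (wt (- q) l * wt q j)) * norm (r l)"
    using wt_shift[OF q, of "j - l" l] A by (intro mult_right_mono mult_left_mono) auto
  finally show "norm (f (j - l) *\<^sub>R r l) \<le> A * wt q j * (wt (- q) l * norm (r l))"
    by (simp add: mult_ac)
qed

lemma conv_wt_le':
  fixes r X :: "int \<Rightarrow> 'q::finite cmat"
  assumes X: "\<And>j. norm (X j) \<le> A * wt q j" and q: "0 \<le> q"
    and r: "psum_le (\<lambda>l. wt (- q) l * norm (r l)) UNIV D"
  shows "norm (infsum (\<lambda>p. herm (r p) ** X (k + p)) UNIV) \<le> A * D * wt q k"
proof (rule psum_le_infsum_le)
  have A: "0 \<le> A" using order_trans[OF norm_ge_zero X[of 0]] by simp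
  then have "psum_le (\<lambda>l. A * wt q k * (wt (- q) l * norm (r l))) UNIV (A * wt q k * D)"
    by (intro psum_le_cmult r) auto
  then show "psum_le (\<lambda>l. A * wt q k * (wt (- q) l * norm (r l))) UNIV (A * D * wt q k)"
    by (simp add: mult_ac)
  fix p
  have "norm (herm (r p) ** X (k + p)) \<le> norm (r p) * (A * wt q (k + p))"
    by (intro norm_mat_mult_le' X) simp
  also have "\<dots> \<le> norm (r p) * (A * (wt (- q) p * wt q k))"
    using wt_shift[OF q, of "k + p" "- p"] A by (intro mult_left_mono) auto
  finally show "norm (herm (r p) ** X (k + p)) \<le> A * wt q k * (wt (- q) p * norm (r p))"
    by (simp add: mult_ac)
qed

lemma psum_bc_neg:
  assumes "0 < d" "d < 1"
  shows "psum_le (\<lambda>m. \<bar>bc (- d) m\<bar>) UNIV (4 * (2 * ((1 + d) / d)))"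
  by (rule psum_le_mono[OF psum_le_cmult[OF psum_le_wt_UNIV[of "1 + d"], of 4]])
    (use assms bc_neg_le in auto)

text \<open>The singular and the rational parts separate: the scalar correlation appears, convolved
  with the rational coefficients on both sides. The interchanges converge absolutely since
  \<open>bc (- d)\<close> is summable and \<open>bc y\<close> bounded. The case \<open>y = d\<close>
  serves the phase and \<open>y = - d\<close> the inverse symbol.\<close>

lemma corr_bconv:
  fixes r g :: "int \<Rightarrow> 'q::finite cmat"
  assumes d: "0 < d" "d < 1" and B: "\<And>k. \<bar>bc y k\<bar> \<le> B"
    and r: "psum_le (\<lambda>p. norm (r p)) UNIV D" and g: "psum_le (\<lambda>p. norm (g p)) UNIV D"
  shows "infsum (\<lambda>m. herm (bconv (- d) r m) ** bconv y g (k + m)) UNIV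
    = infsum (\<lambda>p. herm (r p) ** infsum (\<lambda>l. corr (- d) y (k + p - l) *\<^sub>R g l) UNIV) UNIV"
proof -
  define S where "S = 4 * (2 * ((1 + d) / d))"
  have S: "psum_le (\<lambda>m. \<bar>bc (- d) m\<bar>) UNIV S" unfolding S_def by (rule psum_bc_neg[OF d])
  have S0: "0 \<le> S" "0 \<le> B" "0 \<le> D"
    using d order_trans[OF abs_ge_zero B[of 0]] psum_leD[OF r, of "{}"] by (auto simp: S_def)
  have b4: "\<bar>bc (- d) k\<bar> \<le> 4" for k
    using bc_neg_le[OF d, of k] wt_le_1[of "1 + d" k] d by linarith
  have sr: "(\<lambda>p. bc (- d) (m - p) *\<^sub>R r p) summable_on UNIV" for m
    by (rule psum_le_summable[OF psum_le_cmult[OF r, of 4]]) (auto intro: mult_right_mono b4)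
  have C: "norm (bconv y g m) \<le> B * D" for m
    unfolding bconv_def by (rule psum_le_infsum_le[OF psum_le_cmult[OF g S0(2)]]) (auto intro: mult_right_mono B)
  have sC: "(\<lambda>m. bc (- d) (m - p) *\<^sub>R bconv y g (k + m)) summable_on UNIV" for p
  proof (rule psum_le_summable)
    show "psum_le (\<lambda>m. B * D * \<bar>bc (- d) (m - p)\<bar>) UNIV (B * D * S)"
      using S0 by (intro psum_le_cmult psum_le_shift_minus[OF S]) auto
    show "norm (bc (- d) (m - p) *\<^sub>R bconv y g (k + m)) \<le> B * D * \<bar>bc (- d) (m - p)\<bar>" for m
      using mult_left_mono[OF C[of "k + m"], of "\<bar>bc (- d) (m - p)\<bar>"] by (simp add: mult_ac)
  qed
  have b1: "psum_le (\<lambda>(p, m). norm (r p) * B * D * \<bar>bc (- d) (m - p)\<bar>) (UNIV \<times> UNIV) (B * D * S * D)"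
  proof (rule psum_le_prodI)
    show "psum_le (\<lambda>m. norm (r p) * B * D * \<bar>bc (- d) (m - p)\<bar>) UNIV (norm (r p) * B * D * S)" for p
      using S0 by (intro psum_le_cmult psum_le_shift_minus[OF S]) auto
    show "psum_le (\<lambda>p. norm (r p) * B * D * S) UNIV (B * D * S * D)"
      using psum_le_cmult[OF r, of "B * D * S"] S0 by (simp add: mult_ac)
  qed (use S0 in auto)
  have b2: "psum_le (\<lambda>(m, l). \<bar>bc (- d) (m - p)\<bar> * B * norm (g l)) (UNIV \<times> UNIV) (B * D * S)" for p
  proof (rule psum_le_prodI)
    show "psum_le (\<lambda>l. \<bar>bc (- d) (m - p)\<bar> * B * norm (g l)) UNIV (\<bar>bc (- d) (m - p)\<bar> * B * D)" for m
      using S0 by (intro psum_le_cmult g) auto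
    show "psum_le (\<lambda>m. \<bar>bc (- d) (m - p)\<bar> * B * D) UNIV (B * D * S)"
      using psum_le_cmult[OF psum_le_shift_minus[OF S], of "B * D" p] S0 by (simp add: mult_ac)
  qed (use S0 in auto)
  have "infsum (\<lambda>m. herm (bconv (- d) r m) ** bconv y g (k + m)) UNIV
      = infsum (\<lambda>m. infsum (\<lambda>p. bc (- d) (m - p) *\<^sub>R (herm (r p) ** bconv y g (k + m))) UNIV) UNIV"
  proof (rule infsum_cong)
    fix m
    have "herm (bconv (- d) r m) = infsum (\<lambda>p. bc (- d) (m - p) *\<^sub>R herm (r p)) UNIV"
      unfolding bconv_def by (simp add: infsum_herm[OF sr, symmetric] herm_scaleR)
    moreover have "(\<lambda>p. bc (- d) (m - p) *\<^sub>R herm (r p)) summable_on UNIV"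
      using summable_on_bounded_linear[OF bounded_linear_herm sr[of m]] by (simp add: herm_scaleR)
    ultimately show "herm (bconv (- d) r m) ** bconv y g (k + m) = infsum (\<lambda>p. bc (- d) (m - p) *\<^sub>R (herm (r p) ** bconv y g (k + m))) UNIV"
      by (simp add: infsum_mat_left[symmetric] mat.scaleR_left)
  qed
  also have "\<dots> = infsum (\<lambda>p. infsum (\<lambda>m. bc (- d) (m - p) *\<^sub>R (herm (r p) ** bconv y g (k + m))) UNIV) UNIV"
  proof (rule infsum_swap_psum_le, rule psum_le_mono[OF psum_le_prod_swap[OF b1]])
    fix x :: "int \<times> int"
    obtain m p where x: "x = (m, p)" by (cases x)
    have "norm (bc (- d) (m - p) *\<^sub>R (herm (r p) ** bconv y g (k + m))) \<le> \<bar>bc (- d) (m - p)\<bar> * (norm (r p) * (B * D))"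
      by (simp, intro mult_left_mono norm_mat_mult_le' C) auto
    then show "(case x of (m, p) \<Rightarrow> norm (bc (- d) (m - p) *\<^sub>R (herm (r p) ** bconv y g (k + m))))
      \<le> (case x of (m, p) \<Rightarrow> norm (r p) * B * D * \<bar>bc (- d) (m - p)\<bar>)" by (simp add: x mult_ac)
  qed (rule order_refl)
  also have "\<dots> = infsum (\<lambda>p. herm (r p) ** infsum (\<lambda>l. corr (- d) y (k + p - l) *\<^sub>R g l) UNIV) UNIV"
  proof (rule infsum_cong)
    fix p
    have "infsum (\<lambda>m. bc (- d) (m - p) *\<^sub>R (herm (r p) ** bconv y g (k + m))) UNIV
        = herm (r p) ** infsum (\<lambda>m. bc (- d) (m - p) *\<^sub>R bconv y g (k + m)) UNIV"
      by (simp add: infsum_mat_right[OF sC, symmetric] mat.scaleR_right)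
    also have "infsum (\<lambda>m. bc (- d) (m - p) *\<^sub>R bconv y g (k + m)) UNIV
        = infsum (\<lambda>m. infsum (\<lambda>l. (bc (- d) (m - p) * bc y (k + m - l)) *\<^sub>R g l) UNIV) UNIV"
      unfolding bconv_def by (simp add: infsum_scaleR_right[symmetric])
    also have "\<dots> = infsum (\<lambda>l. infsum (\<lambda>m. (bc (- d) (m - p) * bc y (k + m - l)) *\<^sub>R g l) UNIV) UNIV"
    proof (rule infsum_swap_psum_le, rule psum_le_mono[OF b2[of p]])
      fix x :: "int \<times> int"
      obtain m l where x: "x = (m, l)" by (cases x)
      show "(case x of (m, l) \<Rightarrow> norm ((bc (- d) (m - p) * bc y (k + m - l)) *\<^sub>R g l))
        \<le> (case x of (m, l) \<Rightarrow> \<bar>bc (- d) (m - p)\<bar> * B * norm (g l))"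
        using B[of "k + m - l"] by (auto simp: x abs_mult intro!: mult_mono)
    qed (rule order_refl)
    also have "\<dots> = infsum (\<lambda>l. corr (- d) y (k + p - l) *\<^sub>R g l) UNIV"
    proof (rule infsum_cong)
      fix l
      define f where "f = (\<lambda>m. bc (- d) m * bc y (m + (k + p - l)))"
      have "f summable_on UNIV" unfolding f_def by (rule summable_corr[OF d B])
      then have s: "(\<lambda>m. f (m + - p)) summable_on UNIV" by (subst summable_shift)
      have e: "(bc (- d) (m - p) * bc y (k + m - l)) *\<^sub>R g l = f (m + - p) *\<^sub>R g l" for m
        by (simp add: f_def algebra_simps)
      show "infsum (\<lambda>m. (bc (- d) (m - p) * bc y (k + m - l)) *\<^sub>R g l) UNIV = corr (- d) y (k + p - l) *\<^sub>R g l"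
        unfolding e infsum_scaleR_left[OF s] infsum_shift by (simp add: corr_def f_def)
    qed
    finally show "infsum (\<lambda>m. bc (- d) (m - p) *\<^sub>R (herm (r p) ** bconv y g (k + m))) UNIV
      = herm (r p) ** infsum (\<lambda>l. corr (- d) y (k + p - l) *\<^sub>R g l) UNIV" .
  qed
  finally show ?thesis .
qed

text \<open>As \<open>d\<close> lies strictly between 0 and 1, \<open>j + d\<close> never vanishes;
  the critical values are \<open>j = 0\<close> and \<open>j = -1\<close>.\<close>

lemma abs_int_plus_ge:
  assumes "0 < d" "d < 1 / 2"
  shows "d / 2 * (1 + \<bar>real_of_int j\<bar>) \<le> \<bar>real_of_int j + d\<bar>"
proof (cases "0 \<le> j")
  case True
  then have "d * real_of_int j \<le> real_of_int j" using assms by (intro mult_left_le_one_le) auto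
  then show ?thesis using True assms by (simp add: algebra_simps)
next
  case False
  then have j: "real_of_int j \<le> -1" by linarith
  have "d / 2 * (1 + \<bar>real_of_int j\<bar>) \<le> 1 / 4 * (1 + \<bar>real_of_int j\<bar>)"
    using assms by (intro mult_right_mono) auto
  moreover have "1 / 4 * (1 + \<bar>real_of_int j\<bar>) \<le> \<bar>real_of_int j + d\<bar>"
  proof -
    have "\<bar>real_of_int j\<bar> = - real_of_int j" "\<bar>real_of_int j + d\<bar> = - real_of_int j - d"
      using j assms by auto
    then show ?thesis using j assms by simp
  qed
  ultimately show ?thesis by (rule order_trans)
qed

lemma norm_bconv_le:
  assumes "0 < d" "d < 1 / 2" "psum_le (\<lambda>l. wt (- 2) l * norm (G l)) UNIV D"
  shows "norm (bconv d G k) \<le> D * wt (1 - d) k"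
proof -
  have "psum_le (\<lambda>l. wt (- (1 - d)) l * norm (G l)) UNIV D"
    by (rule psum_le_mono[OF assms(3)]) (use assms in \<open>auto intro!: mult_right_mono wt_antimono_exp\<close>)
  then show ?thesis
    unfolding bconv_def using conv_wt_le[of "bc d" 1 "1 - d" G D k] bc_pos_le[of d] assms by simp
qed

text \<open>\<open>G\<close>, \<open>Gs\<close>, \<open>R\<close> and \<open>Rs\<close> are the
  coefficients of \<open>g\<close>, \<open>g_sharp\<close> and of their inverses, with the
  singularity split off. Moments of order 2 dominate all exponents up to \<open>1 + 2 d\<close> and
  pay for the second order error in \<open>V_asymp\<close>. The last assumption concerns the value
  of the phase at 1.\<close>

locale factor_coeffs =
  fixes d D :: real and G Gs R Rs gam :: "int \<Rightarrow> 'q::finite cmat"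
  assumes d: "0 < d" "d < 1 / 2"
    and causal: "\<And>k. k < 0 \<Longrightarrow> G k = 0" "\<And>k. k < 0 \<Longrightarrow> Gs k = 0"
      "\<And>k. k < 0 \<Longrightarrow> R k = 0" "\<And>k. k < 0 \<Longrightarrow> Rs k = 0"
    and psum: "psum_le (\<lambda>l. wt (- 2) l * norm (G l)) UNIV D" "psum_le (\<lambda>l. wt (- 2) l * norm (Gs l)) UNIV D"
      "psum_le (\<lambda>l. wt (- 2) l * norm (R l)) UNIV D" "psum_le (\<lambda>l. wt (- 2) l * norm (Rs l)) UNIV D"
    and inv: "\<And>k. infsum (\<lambda>m. bconv (- d) R m ** bconv d G (k - m)) UNIV = (if k = 0 then mat 1 else 0)"
      "\<And>k. infsum (\<lambda>m. bconv d G m ** bconv (- d) R (k - m)) UNIV = (if k = 0 then mat 1 else 0)"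
      "\<And>k. infsum (\<lambda>m. bconv (- d) Rs m ** bconv d Gs (k - m)) UNIV = (if k = 0 then mat 1 else 0)"
      "\<And>k. infsum (\<lambda>m. bconv d Gs m ** bconv (- d) Rs (k - m)) UNIV = (if k = 0 then mat 1 else 0)"
    and gam: "\<And>k. gam k = infsum (\<lambda>m. bconv d G (m + k) ** herm (bconv d G m)) UNIV"
      "\<And>k. gam k = infsum (\<lambda>m. herm (bconv d Gs m) ** bconv d Gs (m + k)) UNIV"
    and unitary: "herm (herm (infsum Rs UNIV) ** infsum G UNIV) ** (herm (infsum Rs UNIV) ** infsum G UNIV) = mat 1"
begin

lemma d1: "d < 1" using d by simp

lemma D0: "0 \<le> D" using psum_leD[OF psum(1), of "{}"] by simp

lemma bconv_causal: "(\<And>k. k < 0 \<Longrightarrow> r k = 0) \<Longrightarrow> k < 0 \<Longrightarrow> bconv x r k = 0"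
  unfolding bconv_def by (intro infsum_0) (smt (verit) bc_neg scale_zero_left scale_zero_right)

lemma psum_weaken:
  assumes "psum_le (\<lambda>l. wt (- 2) l * norm (r l)) UNIV D" "q \<le> 2"
  shows "psum_le (\<lambda>l. wt (- q) l * norm (r l)) UNIV D"
  by (rule psum_le_mono[OF assms(1)]) (use assms(2) in \<open>auto intro!: mult_right_mono wt_antimono_exp\<close>)

lemma psum_norm:
  assumes "psum_le (\<lambda>l. wt (- 2) l * norm (r l)) UNIV D"
  shows "psum_le (\<lambda>l. norm (r l)) UNIV D"
  using psum_weaken[OF assms, of 0] by simp

lemma bconv_neg_le:
  assumes "psum_le (\<lambda>l. wt (- 2) l * norm (r l)) UNIV D"
  shows "norm (bconv (- d) r k) \<le> 4 * D * wt (1 + d) k"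
  unfolding bconv_def
  using bc_neg_le[OF d(1) d1] psum_weaken[OF assms, of "1 + d"] d by (intro conv_wt_le) auto

lemma bc_d_bounded: "\<bar>bc d k\<bar> \<le> 1"
  using bc_pos_le[OF d(1) d1, of k] wt_le_1[of "1 - d" k] d by linarith

lemma bc_neg_bounded: "\<bar>bc (- d) k\<bar> \<le> 4"
  using bc_neg_le[OF d(1) d1, of k] wt_le_1[of "1 + d" k] d by linarith

definition \<kappa> :: real where "\<kappa> = sin (pi * d) / pi"

lemma kappa: "0 < \<kappa>" "pi * \<kappa> < 1"
proof -
  have *: "0 < pi * d" "pi * d < pi / 2" using d by (auto simp: field_simps)
  then have "0 < sin (pi * d)" by (intro sin_gt_zero) auto
  moreover have "sin (pi * d) < sin (pi / 2)" using * pi_gt_zero by (intro sin_monotone_2pi) linarith+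
  ultimately show "0 < \<kappa>" "pi * \<kappa> < 1" by (auto simp: \<kappa>_def)
qed

lemma corr_eq: "corr (- d) d k = \<kappa> / (real_of_int k + d)"
proof -
  have "0 < d / 2 * (1 + \<bar>real_of_int k\<bar>)" using d by (intro mult_pos_pos) auto
  then have "0 < \<bar>real_of_int k + d\<bar>" using abs_int_plus_ge[OF d, of k] by (rule less_le_trans)
  then have "real_of_int k + d \<noteq> 0" by simp
  then show ?thesis using corr_opposite[OF d(1) d1, of k] by (simp add: \<kappa>_def eq_divide_eq mult_ac)
qed

lemma corr_le: "\<bar>corr (- d) d k\<bar> \<le> 2 * \<kappa> / d * wt 1 k"
proof -
  have "0 < d / 2 * (1 + \<bar>real_of_int k\<bar>)" using d by (intro mult_pos_pos) auto
  moreover from this have "0 < \<bar>real_of_int k + d\<bar>" using abs_int_plus_ge[OF d, of k] by (rule less_le_trans)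
  ultimately have "\<kappa> / \<bar>real_of_int k + d\<bar> \<le> \<kappa> / (d / 2 * (1 + \<bar>real_of_int k\<bar>))"
    using abs_int_plus_ge[OF d, of k] kappa d by (intro divide_left_mono mult_pos_pos) auto
  also have "\<dots> = 2 * \<kappa> / d * wt 1 k" by (simp add: wt_1)
  finally show ?thesis using kappa by (simp add: corr_eq)
qed

text \<open>The difference is exactly \<open>\<kappa> (s + d) / (m (s - m + d))\<close>. When
  \<open>s\<close> is near \<open>m\<close> the last factor is not large; the second power of
  \<open>1 / m\<close> then comes from
  \<open>m \<le> (1 + \<bar>s\<bar>) * (1 + \<bar>s - m\<bar>)\<close>, at the price of two moments
  in \<open>s\<close>.\<close>

lemma corr_shift_le:
  assumes m: "1 \<le> m"
  shows "\<bar>corr (- d) d (- m + s) + \<kappa> / real_of_int m\<bar> \<le> 2 * \<kappa> / d / (real_of_int m)\<^sup>2 * wt (- 2) s"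
proof -
  define j where "j = s - m"
  have j: "0 < d / 2 * (1 + \<bar>real_of_int j\<bar>)" "d / 2 * (1 + \<bar>real_of_int j\<bar>) \<le> \<bar>real_of_int j + d\<bar>"
    using abs_int_plus_ge[OF d, of j] d by (auto intro!: mult_pos_pos)
  have ms: "real_of_int m \<le> (1 + \<bar>real_of_int s\<bar>) * (1 + \<bar>real_of_int j\<bar>)"
    by (simp add: j_def algebra_simps) (smt (verit) mult_nonneg_nonneg)
  have nz: "real_of_int j + d \<noteq> 0" using j by auto
  have "corr (- d) d (- m + s) + \<kappa> / real_of_int m = \<kappa> * (real_of_int s + d) / (real_of_int m * (real_of_int j + d))"
    unfolding corr_eq using m nz by (simp add: j_def field_simps)
  then have "\<bar>corr (- d) d (- m + s) + \<kappa> / real_of_int m\<bar> = \<kappa> * \<bar>real_of_int s + d\<bar> / (real_of_int m * \<bar>real_of_int j + d\<bar>)"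
    using kappa m by (simp add: abs_mult)
  also have "\<dots> \<le> \<kappa> * (1 + \<bar>real_of_int s\<bar>) / (real_of_int m * (d / 2 * (1 + \<bar>real_of_int j\<bar>)))"
    using j m kappa d by (intro frac_le mult_left_mono mult_pos_pos mult_nonneg_nonneg) auto
  also have "\<dots> = 2 * \<kappa> / d / (real_of_int m)\<^sup>2 * ((1 + \<bar>real_of_int s\<bar>) * (real_of_int m / (1 + \<bar>real_of_int j\<bar>)))"
    using m by (simp add: power2_eq_square mult_ac)
  also have "\<dots> \<le> 2 * \<kappa> / d / (real_of_int m)\<^sup>2 * ((1 + \<bar>real_of_int s\<bar>) * (1 + \<bar>real_of_int s\<bar>))"
    using kappa d ms by (intro mult_left_mono) (auto simp: divide_le_eq)
  also have "(1 + \<bar>real_of_int s\<bar>) * (1 + \<bar>real_of_int s\<bar>) = wt (- 2) s"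
    by (simp add: wt_def power2_eq_square)
  finally show ?thesis .
qed

definition V :: "int \<Rightarrow> 'q cmat" where
  "V k = infsum (\<lambda>m. herm (bconv (- d) Rs m) ** bconv d G (k + m)) UNIV"

lemma V_corr: "V k = infsum (\<lambda>p. herm (Rs p) ** infsum (\<lambda>l. corr (- d) d (k + p - l) *\<^sub>R G l) UNIV) UNIV"
  unfolding V_def by (rule corr_bconv[OF d(1) d1 bc_d_bounded psum_norm[OF psum(4)] psum_norm[OF psum(1)]])

lemma V_le: "norm (V k) \<le> 2 * \<kappa> / d * D * D * wt 1 k"
  unfolding V_corr
proof (rule conv_wt_le'[where X = "\<lambda>j. infsum (\<lambda>l. corr (- d) d (j - l) *\<^sub>R G l) UNIV"])
  show "norm (infsum (\<lambda>l. corr (- d) d (j - l) *\<^sub>R G l) UNIV) \<le> 2 * \<kappa> / d * D * wt 1 j" for j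
    using psum_weaken[OF psum(1), of 1] by (intro conv_wt_le corr_le) auto
qed (use psum_weaken[OF psum(4), of 1] in auto)

text \<open>The value of the phase at the singular point 1, since a sum of Taylor coefficients is
  the value of the function there.\<close>

definition U :: "'q cmat" where "U = herm (infsum Rs UNIV) ** infsum G UNIV"

text \<open>The leading term of the correlation does not depend on the shifts, so the double sum
  factors into \<open>U\<close>; the remainder uses up the second moments of both rational
  factors.\<close>

lemma V_asymp:
  assumes m: "1 \<le> m"
  shows "norm (V (- m) + (\<kappa> / real_of_int m) *\<^sub>R U) \<le> 2 * \<kappa> / d / (real_of_int m)\<^sup>2 * D * D"
proof -
  define c where "c = \<kappa> / real_of_int m"
  define X where "X j = infsum (\<lambda>l. corr (- d) d (- m + j - l) *\<^sub>R G l) UNIV" for j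
  have c1: "\<bar>corr (- d) d k\<bar> \<le> 2 * \<kappa> / d" for k
  proof -
    have "0 \<le> 2 * \<kappa> / d" using kappa d by simp
    from mult_left_mono[OF wt_le_1[of 1 k] this] show ?thesis using corr_le[of k] by simp
  qed
  have sG: "G summable_on UNIV" and sR: "Rs summable_on UNIV"
    by (rule psum_le_summable[OF psum_norm[OF psum(1)]], simp)
      (rule psum_le_summable[OF psum_norm[OF psum(4)]], simp)
  have sX: "(\<lambda>l. corr (- d) d (j - l) *\<^sub>R G l) summable_on UNIV" for j
    by (rule psum_le_summable[OF psum_le_cmult[OF psum_norm[OF psum(1)], of "2 * \<kappa> / d"]])
      (use kappa d in simp, rule norm_scaleR_le, rule c1)
  have sc: "(\<lambda>l. c *\<^sub>R G l) summable_on UNIV"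
    by (rule summable_on_bounded_linear[OF bounded_linear_scaleR_right sG])
  have Xc: "X j + c *\<^sub>R infsum G UNIV = infsum (\<lambda>l. (corr (- d) d (- m + (j - l)) + c) *\<^sub>R G l) UNIV" for j
  proof -
    have "X j + c *\<^sub>R infsum G UNIV = infsum (\<lambda>l. corr (- d) d (- m + j - l) *\<^sub>R G l + c *\<^sub>R G l) UNIV"
      unfolding X_def infsum_scaleR_right[symmetric] by (rule infsum_add[symmetric]) (rule sX, rule sc)
    then show ?thesis by (simp add: scaleR_add_left add_diff_eq)
  qed
  define A where "A = 2 * \<kappa> / d / (real_of_int m)\<^sup>2"
  have Xcb: "norm (X j + c *\<^sub>R infsum G UNIV) \<le> A * D * wt (- 2) j" for j
    unfolding Xc
  proof (rule psum_le_infsum_le)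
    have A: "0 \<le> A" using kappa d by (simp add: A_def)
    then have "psum_le (\<lambda>l. A * wt (- 2) j * (wt (- 2) l * norm (G l))) UNIV (A * wt (- 2) j * D)"
      by (intro psum_le_cmult psum) auto
    then show "psum_le (\<lambda>l. A * wt (- 2) j * (wt (- 2) l * norm (G l))) UNIV (A * D * wt (- 2) j)"
      by (simp add: mult_ac)
    fix l
    have "wt (- 2) (j - l) \<le> wt (- 2) j * wt (- 2) l"
    proof -
      have "1 + \<bar>real_of_int (j - l)\<bar> \<le> (1 + \<bar>real_of_int j\<bar>) * (1 + \<bar>real_of_int l\<bar>)"
        by (simp add: algebra_simps) (smt (verit) mult_nonneg_nonneg abs_ge_zero)
      then have "(1 + \<bar>real_of_int (j - l)\<bar>) powr 2 \<le> ((1 + \<bar>real_of_int j\<bar>) * (1 + \<bar>real_of_int l\<bar>)) powr 2"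
        by (intro powr_mono2) auto
      then show ?thesis by (simp add: wt_def powr_mult)
    qed
    then have "\<bar>corr (- d) d (- m + (j - l)) + c\<bar> \<le> A * (wt (- 2) j * wt (- 2) l)"
      using corr_shift_le[OF m, of "j - l"] mult_left_mono[OF _ A] order_trans unfolding A_def c_def by blast
    from norm_scaleR_le[OF this, of "G l"]
    show "norm ((corr (- d) d (- m + (j - l)) + c) *\<^sub>R G l) \<le> A * wt (- 2) j * (wt (- 2) l * norm (G l))"
      by (simp only: mult_ac)
  qed
  have Xb: "norm (X j) \<le> 2 * \<kappa> / d * D" for j
    unfolding X_def
    by (rule psum_le_infsum_le[OF psum_le_cmult[OF psum_norm[OF psum(1)]]])
      (use kappa d in simp, rule norm_scaleR_le, rule c1)
  have sRX: "(\<lambda>p. herm (Rs p) ** X p) summable_on UNIV"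
    by (rule psum_le_summable[OF psum_le_cmult[OF psum_norm[OF psum(4)], of "2 * \<kappa> / d * D"]])
      (use kappa d D0 in \<open>auto intro!: norm_mat_mult_le' Xb simp: mult.commute[of _ "norm _"] simp del: times_divide_eq_left\<close>)
  have sRG: "(\<lambda>p. herm (Rs p) ** (c *\<^sub>R infsum G UNIV)) summable_on UNIV"
    by (intro summable_mat_left summable_on_bounded_linear[OF bounded_linear_herm] sR)
  have "V (- m) = infsum (\<lambda>p. herm (Rs p) ** X p) UNIV" unfolding V_corr X_def ..
  moreover have "c *\<^sub>R U = infsum (\<lambda>p. herm (Rs p) ** (c *\<^sub>R infsum G UNIV)) UNIV"
    unfolding U_def infsum_herm[OF sR, symmetric]
    by (simp add: infsum_mat_left[OF summable_on_bounded_linear[OF bounded_linear_herm sR]] mat.scaleR_right infsum_scaleR_right)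
  ultimately have "V (- m) + c *\<^sub>R U = infsum (\<lambda>p. herm (Rs p) ** (X p + c *\<^sub>R infsum G UNIV)) UNIV"
    by (simp add: infsum_add[OF sRX sRG] mat.add_right)
  also have "norm \<dots> \<le> A * D * D"
  proof (rule psum_le_infsum_le)
    show "psum_le (\<lambda>p. A * D * (wt (- 2) p * norm (Rs p))) UNIV (A * D * D)"
      using kappa d D0 by (intro psum_le_cmult psum) (auto simp: A_def)
    show "norm (herm (Rs p) ** (X p + c *\<^sub>R infsum G UNIV)) \<le> A * D * (wt (- 2) p * norm (Rs p))" for p
      using norm_mat_mult_le'[OF order_refl Xcb, of "herm (Rs p)" p] by (simp add: mult_ac)
  qed
  finally show ?thesis by (simp add: c_def A_def)
qed

lemma symbol_factors_ex:
  "\<exists>K \<theta> n0. symbol_factors d (bconv d G) (bconv d Gs) (bconv (- d) R) (bconv (- d) Rs) gam V K \<theta> n0"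
proof -
  obtain Cw where Cw: "0 \<le> Cw" "\<And>k. \<bar>corr (- d) (- d) k\<bar> \<le> Cw * wt (1 + 2 * d) k"
    using corr_same_le[OF d(1) d1] by blast
  define C where "C = 2 * \<kappa> / d * D * D"
  define K where "K = D + 4 * D + C + Cw * D * D"
  \<comment> \<open>The midpoint between \<open>pi * \<kappa>\<close> and 1. The choice of
    \<open>n0\<close> makes the second order error fit into the half gap:
    \<open>C / m \<le> (1 - pi * \<kappa>) / (2 * pi)\<close>.\<close>
  define \<theta> where "\<theta> = (1 + pi * \<kappa>) / 2"
  define n0 where "n0 = max 1 \<lceil>2 * pi * C / (1 - pi * \<kappa>)\<rceil>"
  have C: "0 \<le> C" "0 \<le> Cw * D * D" using kappa d D0 Cw by (auto simp: C_def)
  have KK: "X \<le> K * wt q k" if "X \<le> a * wt q k" "a \<le> K" for X a q k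
    using that mult_right_mono[of a K "wt q k"] by (meson order_trans wt_nonneg)
  have K: "D \<le> K" "4 * D \<le> K" "C \<le> K" "Cw * D * D \<le> K"
    using C D0 by (auto simp: K_def)
  have U: "norm (U ** X) = norm X" "norm (herm U ** X) = norm X" for X :: "'q cmat"
  proof -
    have "herm U ** U = mat 1" using unitary by (simp add: U_def)
    moreover from this have "herm (herm U) ** herm U = mat 1"
      using matrix_left_right_inverse[of "herm U" U] by simp
    ultimately show "norm (U ** X) = norm X" "norm (herm U ** X) = norm X"
      by (auto intro: norm_unitary_mult)
  qed
  have sharp: "norm (V (- m) ** X) \<le> \<theta> / (pi * real_of_int m) * norm X"
    "norm (herm (V (- m)) ** X) \<le> \<theta> / (pi * real_of_int m) * norm X" if m: "n0 \<le> m" for m and X :: "'q cmat"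
  proof -
    have m1: "1 \<le> m" "2 * pi * C / (1 - pi * \<kappa>) \<le> real_of_int m"
      using m by (auto simp: n0_def ceiling_le_iff)
    then have "2 * pi * C \<le> (1 - pi * \<kappa>) * real_of_int m"
      using kappa by (simp add: pos_divide_le_eq mult.commute)
    then have "C / real_of_int m \<le> (1 - pi * \<kappa>) / (2 * pi)"
      using m1(1) by (simp add: divide_le_eq le_divide_eq mult_ac)
    then have "\<kappa> + C / real_of_int m \<le> \<kappa> + (1 - pi * \<kappa>) / (2 * pi)" by simp
    also have "\<dots> = \<theta> / pi" by (simp add: \<theta>_def field_simps)
    finally have "(\<kappa> + C / real_of_int m) / real_of_int m \<le> \<theta> / pi / real_of_int m"
      using m1(1) by (intro divide_right_mono) auto
    then have b: "\<kappa> / real_of_int m + C / (real_of_int m)\<^sup>2 \<le> \<theta> / (pi * real_of_int m)"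
      by (simp add: add_divide_distrib power2_eq_square)
    define E where "E = V (- m) + (\<kappa> / real_of_int m) *\<^sub>R U"
    have E: "norm E \<le> C / (real_of_int m)\<^sup>2"
      using V_asymp[OF m1(1)] by (simp add: E_def C_def)
    have V: "V (- m) = E - (\<kappa> / real_of_int m) *\<^sub>R U" by (simp add: E_def)
    have fin: "norm (E' ** X - (\<kappa> / real_of_int m) *\<^sub>R Y) \<le> \<theta> / (pi * real_of_int m) * norm X"
      if "norm E' = norm E" "norm Y = norm X" for E' Y :: "'q cmat"
    proof -
      have "norm (E' ** X - (\<kappa> / real_of_int m) *\<^sub>R Y) \<le> norm (E' ** X) + norm ((\<kappa> / real_of_int m) *\<^sub>R Y)"
        by (rule norm_triangle_ineq4)
      also have "norm (E' ** X) \<le> C / (real_of_int m)\<^sup>2 * norm X"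
        using E that(1) by (intro norm_mat_mult_le') auto
      also have "norm ((\<kappa> / real_of_int m) *\<^sub>R Y) = \<kappa> / real_of_int m * norm X"
        using that(2) kappa m1(1) by simp
      also have "C / (real_of_int m)\<^sup>2 * norm X + \<kappa> / real_of_int m * norm X = (\<kappa> / real_of_int m + C / (real_of_int m)\<^sup>2) * norm X"
        by (simp add: algebra_simps)
      also have "\<dots> \<le> \<theta> / (pi * real_of_int m) * norm X" using b by (rule mult_right_mono) simp
      finally show ?thesis by simp
    qed
    show "norm (V (- m) ** X) \<le> \<theta> / (pi * real_of_int m) * norm X"
      using fin[of E "U ** X"] U by (simp add: V mat_simps mat.scaleR_left)
    show "norm (herm (V (- m)) ** X) \<le> \<theta> / (pi * real_of_int m) * norm X"
      using fin[of "herm E" "herm U ** X"] U by (simp add: V mat_simps herm_diff herm_scaleR mat.scaleR_left)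
  qed
  have W: "norm (infsum (\<lambda>m. bconv (- d) Rs m ** herm (bconv (- d) Rs (m + k))) UNIV) \<le> Cw * D * D * wt (1 + 2 * d) k" for k
  proof -
    have ph: "psum_le (\<lambda>l. wt (- 2) l * norm (herm (Rs l))) UNIV D" using psum(4) by simp
    \<comment> \<open>In \<open>corr_bconv\<close> the adjoint stands on the left, here on the
      right; replacing \<open>Rs\<close> by its adjoints makes up for this.\<close>
    have h: "bconv (- d) (\<lambda>l. herm (Rs l)) m = herm (bconv (- d) Rs m)" for m
    proof -
      have "(\<lambda>p. bc (- d) (m - p) *\<^sub>R Rs p) summable_on UNIV"
        by (rule psum_le_summable[OF psum_le_cmult[OF psum_norm[OF psum(4)], of 4]])
          (auto intro: mult_right_mono bc_neg_bounded)
      then show ?thesis unfolding bconv_def by (simp add: infsum_herm[symmetric] herm_scaleR)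
    qed
    have "infsum (\<lambda>m. bconv (- d) Rs m ** herm (bconv (- d) Rs (m + k))) UNIV
        = infsum (\<lambda>m. herm (bconv (- d) (\<lambda>l. herm (Rs l)) m) ** bconv (- d) (\<lambda>l. herm (Rs l)) (k + m)) UNIV"
      by (simp add: h add.commute)
    also have "\<dots> = infsum (\<lambda>p. herm (herm (Rs p)) ** infsum (\<lambda>l. corr (- d) (- d) (k + p - l) *\<^sub>R herm (Rs l)) UNIV) UNIV"
      by (rule corr_bconv[OF d(1) d1 bc_neg_bounded psum_norm[OF ph] psum_norm[OF ph]])
    also have "norm \<dots> \<le> Cw * D * D * wt (1 + 2 * d) k"
    proof (rule conv_wt_le'[where X = "\<lambda>j. infsum (\<lambda>l. corr (- d) (- d) (j - l) *\<^sub>R herm (Rs l)) UNIV"])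
      show "norm (infsum (\<lambda>l. corr (- d) (- d) (j - l) *\<^sub>R herm (Rs l)) UNIV) \<le> Cw * D * wt (1 + 2 * d) j" for j
        using psum_weaken[OF ph, of "1 + 2 * d"] d by (intro conv_wt_le Cw) auto
    qed (use psum_weaken[OF ph, of "1 + 2 * d"] d in auto)
    finally show ?thesis .
  qed
  have "symbol_factors d (bconv d G) (bconv d Gs) (bconv (- d) R) (bconv (- d) Rs) gam V K \<theta> n0"
  proof
    show "norm (bconv d G k) \<le> K * wt (1 - d) k" for k by (rule KK[OF norm_bconv_le[OF d psum(1)] K(1)])
    show "norm (bconv d Gs k) \<le> K * wt (1 - d) k" for k by (rule KK[OF norm_bconv_le[OF d psum(2)] K(1)])
    show "norm (bconv (- d) R k) \<le> K * wt (1 + d) k" for k by (rule KK[OF bconv_neg_le[OF psum(3)] K(2)])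
    show "norm (bconv (- d) Rs k) \<le> K * wt (1 + d) k" for k by (rule KK[OF bconv_neg_le[OF psum(4)] K(2)])
    show "norm (V k) \<le> K * wt 1 k" for k by (rule KK[OF _ K(3)]) (use V_le in \<open>simp add: C_def\<close>)
    show "norm (infsum (\<lambda>m. bconv (- d) Rs m ** herm (bconv (- d) Rs (m + k))) UNIV) \<le> K * wt (1 + 2 * d) k" for k
      by (rule KK[OF W K(4)])
    show "0 \<le> \<theta>" "\<theta> < 1" using kappa by (auto simp: \<theta>_def)
    show "1 \<le> n0" by (simp add: n0_def)
  qed (rule d inv gam V_def sharp bconv_causal causal | assumption)+
  then show ?thesis by blast
qed

end

section \<open>Power series of rational matrix functions\<close>

definition rational_cdisk :: "(complex \<Rightarrow> complex) \<Rightarrow> bool" where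
  "rational_cdisk f \<longleftrightarrow> (\<exists>p r :: complex poly. \<forall>z\<in>cball 0 1. poly r z \<noteq> 0 \<and> f z = poly p z / poly r z)"

lemma rational_cdiskI:
  "(\<And>z. z \<in> cball 0 1 \<Longrightarrow> poly r z \<noteq> 0 \<and> f z = poly p z / poly r z) \<Longrightarrow> rational_cdisk f"
  unfolding rational_cdisk_def by blast

lemma rational_cdisk_const: "rational_cdisk (\<lambda>_. c)"
  by (rule rational_cdiskI[of 1 _ "[:c:]"]) simp

lemma rational_cdisk_add:
  assumes "rational_cdisk f" "rational_cdisk g" shows "rational_cdisk (\<lambda>z. f z + g z)"
proof -
  obtain p r p' r' where "\<And>z. z \<in> cball 0 1 \<Longrightarrow> poly r z \<noteq> 0 \<and> f z = poly p z / poly r z"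
    "\<And>z. z \<in> cball 0 1 \<Longrightarrow> poly r' z \<noteq> 0 \<and> g z = poly p' z / poly r' z"
    using assms unfolding rational_cdisk_def by metis
  then show ?thesis by (intro rational_cdiskI[of "r * r'" _ "p * r' + p' * r"]) (simp add: add_frac_eq)
qed

lemma rational_cdisk_mult:
  assumes "rational_cdisk f" "rational_cdisk g" shows "rational_cdisk (\<lambda>z. f z * g z)"
proof -
  obtain p r p' r' where "\<And>z. z \<in> cball 0 1 \<Longrightarrow> poly r z \<noteq> 0 \<and> f z = poly p z / poly r z"
    "\<And>z. z \<in> cball 0 1 \<Longrightarrow> poly r' z \<noteq> 0 \<and> g z = poly p' z / poly r' z"
    using assms unfolding rational_cdisk_def by metis
  then show ?thesis by (intro rational_cdiskI[of "r * r'" _ "p * p'"]) simp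
qed

lemma rational_cdisk_divide:
  assumes "rational_cdisk f" "rational_cdisk g" "\<And>z. z \<in> cball 0 1 \<Longrightarrow> g z \<noteq> 0"
  shows "rational_cdisk (\<lambda>z. f z / g z)"
proof -
  obtain p r p' r' where *: "\<And>z. z \<in> cball 0 1 \<Longrightarrow> poly r z \<noteq> 0 \<and> f z = poly p z / poly r z"
    "\<And>z. z \<in> cball 0 1 \<Longrightarrow> poly r' z \<noteq> 0 \<and> g z = poly p' z / poly r' z"
    using assms(1,2) unfolding rational_cdisk_def by metis
  moreover have "poly p' z \<noteq> 0" if "z \<in> cball 0 1" for z
    using *(2)[OF that] assms(3)[OF that] by auto
  ultimately show ?thesis by (intro rational_cdiskI[of "r * p'" _ "p * r'"]) simp
qed

lemma rational_cdisk_sum: "(\<And>i. i \<in> A \<Longrightarrow> rational_cdisk (f i)) \<Longrightarrow> rational_cdisk (\<lambda>z. \<Sum>i\<in>A. f i z)"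
  by (induction A rule: infinite_finite_induct) (auto intro: rational_cdisk_const rational_cdisk_add)

lemma rational_cdisk_prod: "(\<And>i. i \<in> A \<Longrightarrow> rational_cdisk (f i)) \<Longrightarrow> rational_cdisk (\<lambda>z. \<Prod>i\<in>A. f i z)"
  by (induction A rule: infinite_finite_induct) (auto intro: rational_cdisk_const rational_cdisk_mult)

lemma rational_cdisk_det:
  fixes A :: "complex \<Rightarrow> 'q::finite cmat"
  assumes "\<And>i j. rational_cdisk (\<lambda>z. A z $ i $ j)"
  shows "rational_cdisk (\<lambda>z. det (A z))"
  unfolding det_def by (intro rational_cdisk_sum rational_cdisk_mult rational_cdisk_const rational_cdisk_prod assms)

lemma rational_nopole_iff: "rational_nopole_closed_disk g \<longleftrightarrow> (\<forall>i j. rational_cdisk (\<lambda>z. g z $ i $ j))"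
  by (simp add: rational_nopole_closed_disk_def rational_cdisk_def)

lemma matrix_inv_mult:
  fixes A :: "'a::field^'n^'n"
  assumes "det A \<noteq> 0"
  shows "A ** matrix_inv A = mat 1" "matrix_inv A ** A = mat 1"
proof -
  have "\<exists>A'. A ** A' = mat 1 \<and> A' ** A = mat 1"
    using assms unfolding invertible_det_nz[symmetric] invertible_def .
  from someI_ex[OF this] show "A ** matrix_inv A = mat 1" "matrix_inv A ** A = mat 1"
    unfolding matrix_inv_def by auto
qed

text \<open>By Cramer's rule each entry of the inverse is a quotient of determinants whose
  denominator has no zero in the closed disk.\<close>

lemma rational_nopole_inverse:
  assumes "rational_nopole_closed_disk g" "det_nonzero_closed_disk g"
  shows "rational_nopole_closed_disk (\<lambda>z. matrix_inv (g z))"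
  unfolding rational_nopole_iff
proof (intro allI)
  fix i j
  define M where "M z = (\<chi> a b. if b = i then mat 1 $ a $ j else g z $ a $ b)" for z
  have g: "rational_cdisk (\<lambda>z. g z $ a $ b)" for a b using assms(1) by (simp add: rational_nopole_iff)
  have "rational_cdisk (\<lambda>z. M z $ a $ b)" for a b
    by (cases "b = i") (simp_all add: M_def rational_cdisk_const g)
  then have "rational_cdisk (\<lambda>z. det (M z) / det (g z))"
    using assms(2) by (intro rational_cdisk_divide rational_cdisk_det g) (auto simp: det_nonzero_closed_disk_def)
  moreover have "matrix_inv (g z) $ i $ j = det (M z) / det (g z)" if "z \<in> cball 0 1" for z
  proof -
    have d: "det (g z) \<noteq> 0" using assms(2) that by (auto simp: det_nonzero_closed_disk_def)
    have "g z *v (\<chi> a. matrix_inv (g z) $ a $ j) = (\<chi> a. mat 1 $ a $ j)"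
      using matrix_inv_mult(1)[OF d]
      by (simp add: vec_eq_iff matrix_matrix_mult_def matrix_vector_mult_def)
    then have "(\<chi> a. matrix_inv (g z) $ a $ j) = (\<chi> k. det (\<chi> a b. if b = k then (\<chi> a. mat 1 $ a $ j) $ a else g z $ a $ b) / det (g z))"
      by (simp only: cramer[OF d])
    then have "(\<chi> a. matrix_inv (g z) $ a $ j) $ i = (\<chi> k. det (\<chi> a b. if b = k then (\<chi> a. mat 1 $ a $ j) $ a else g z $ a $ b) / det (g z)) $ i"
      by simp
    then show ?thesis by (simp add: M_def cong: if_cong)
  qed
  ultimately show "rational_cdisk (\<lambda>z. matrix_inv (g z) $ i $ j)"
    unfolding rational_cdisk_def by simp
qed

text \<open>With the fourth root of \<open>q\<close> this is the boundedness of
  \<open>(1 + n) * x ^ n\<close>. The power 4 leaves a summable weight \<open>wt 2\<close> after the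
  moment of order 2 has been taken.\<close>

lemma geometric_wt_le:
  fixes q :: real
  assumes "0 \<le> q" "q < 1"
  shows "\<exists>B\<ge>0. \<forall>n. (1 + real n) ^ 4 * q ^ n \<le> B"
proof -
  define x where "x = root 4 q"
  have x: "0 \<le> x" "x < 1" "x ^ 4 = q" using assms by (auto simp: x_def)
  have "(\<lambda>n. real n * x ^ n + x ^ n) \<longlonglongrightarrow> 0 + 0"
    using x powser_times_n_limit_0[of x] by (intro tendsto_add LIMSEQ_realpow_zero) auto
  then have "Bseq (\<lambda>n. real n * x ^ n + x ^ n)" by (rule convergentI[THEN convergent_imp_Bseq])
  then obtain C where C: "0 < C" "\<And>n. \<bar>real n * x ^ n + x ^ n\<bar> \<le> C" unfolding Bseq_def by auto
  have "(1 + real n) ^ 4 * q ^ n \<le> C ^ 4" for n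
  proof -
    have "(1 + real n) ^ 4 * q ^ n = ((1 + real n) * x ^ n) ^ 4"
      unfolding power_mult_distrib x(3)[symmetric] power_mult[symmetric] by (simp add: mult.commute)
    also have "(1 + real n) * x ^ n = real n * x ^ n + x ^ n" by (simp add: algebra_simps)
    also have "\<dots> ^ 4 \<le> C ^ 4" using C(2)[of n] x by (intro power_mono) auto
    finally show ?thesis .
  qed
  then show ?thesis using C(1) by (intro exI[of _ "C ^ 4"]) auto
qed

text \<open>The denominator has finitely many roots, all outside the closed disk, so the function is
  holomorphic in a disk of radius above 1 and its coefficients decay geometrically.\<close>

lemma rational_cdisk_power_series:
  assumes "rational_cdisk f"
  shows "\<exists>s B. (\<forall>n. (1 + real n) ^ 4 * cmod (s n) \<le> B) \<and> (\<forall>z\<in>cball 0 1. (\<lambda>n. s n * z ^ n) sums f z)"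
proof -
  obtain p r where pr: "\<And>z. z \<in> cball 0 1 \<Longrightarrow> poly r z \<noteq> 0 \<and> f z = poly p z / poly r z"
    using assms unfolding rational_cdisk_def by blast
  have "r \<noteq> 0" using pr[of 0] by auto
  then have fin: "finite {z. poly r z = 0}" by (rule poly_roots_finite)
  \<comment> \<open>The 2 covers the case of a denominator without roots.\<close>
  define R where "R = Min (insert 2 (norm ` {z. poly r z = 0}))"
  have gt: "1 < norm z" if "poly r z = 0" for z using pr[of z] that by force
  have R: "1 < R" unfolding R_def using fin gt by (subst Min_gr_iff) auto
  have nz: "poly r z \<noteq> 0" if "norm z < R" for z
  proof
    assume "poly r z = 0"
    then have "R \<le> norm z" unfolding R_def using fin by (intro Min_le) auto
    then show False using that by simp
  qed
  have hol: "(\<lambda>z. poly p z / poly r z) holomorphic_on ball 0 R"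
    by (intro holomorphic_intros) (use nz in auto)
  define s where "s n = (deriv ^^ n) (\<lambda>z. poly p z / poly r z) 0 / fact n" for n
  have sums: "(\<lambda>n. s n * z ^ n) sums (poly p z / poly r z)" if "norm z < R" for z
    using holomorphic_power_series[OF hol, of z] that by (simp add: s_def)
  define x where "x = (1 + R) / 2"
  have x: "1 < x" "x < R" using R by (auto simp: x_def)
  have "(\<lambda>n. s n * complex_of_real x ^ n) \<longlonglongrightarrow> 0"
    using sums_summable[OF sums[of "complex_of_real x"]] x by (intro summable_LIMSEQ_zero) auto
  then have "Bseq (\<lambda>n. s n * complex_of_real x ^ n)" by (rule convergentI[THEN convergent_imp_Bseq])
  then obtain C where C: "\<And>n. cmod (s n * complex_of_real x ^ n) \<le> C" unfolding Bseq_def by blast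
  have sC: "cmod (s n) \<le> C * (1 / x) ^ n" for n
    using C[of n] x by (simp add: norm_mult norm_power power_divide pos_le_divide_eq)
  obtain B where B: "\<And>n. (1 + real n) ^ 4 * (1 / x) ^ n \<le> B"
    using geometric_wt_le[of "1 / x"] x by auto
  have "0 \<le> C" using order_trans[OF norm_ge_zero C[of 0]] .
  have "(1 + real n) ^ 4 * cmod (s n) \<le> C * B" for n
  proof -
    have "(1 + real n) ^ 4 * cmod (s n) \<le> (1 + real n) ^ 4 * (C * (1 / x) ^ n)"
      by (intro mult_left_mono sC) auto
    also have "\<dots> = C * ((1 + real n) ^ 4 * (1 / x) ^ n)" by (simp only: mult_ac)
    also have "\<dots> \<le> C * B" using \<open>0 \<le> C\<close> by (intro mult_left_mono B)
    finally show ?thesis .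
  qed
  moreover have "(\<lambda>n. s n * z ^ n) sums f z" if "z \<in> cball 0 1" for z
    using sums[of z] pr[OF that] that R by auto
  ultimately show ?thesis by blast
qed

lemma norm_mat_le_sum:
  fixes A :: "'q::finite cmat"
  shows "norm A \<le> (\<Sum>i\<in>UNIV. \<Sum>j\<in>UNIV. cmod (A $ i $ j))"
proof -
  have "norm A \<le> (\<Sum>i\<in>UNIV. norm (A $ i))" unfolding norm_vec_def by (rule L2_set_le_sum) simp
  also have "\<dots> \<le> (\<Sum>i\<in>UNIV. \<Sum>j\<in>UNIV. cmod (A $ i $ j))"
    unfolding norm_vec_def by (intro sum_mono L2_set_le_sum) simp
  finally show ?thesis .
qed

text \<open>The coefficients are indexed by all integers, with zeros at the negative ones, so that
  convolutions, shifts and adjoints of series are sums over the same index set.\<close>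

definition series_of :: "(int \<Rightarrow> 'q::finite cmat) \<Rightarrow> (complex \<Rightarrow> 'q cmat) \<Rightarrow> complex set \<Rightarrow> bool" where
  "series_of A F S \<longleftrightarrow> (\<forall>k<0. A k = 0) \<and> (\<forall>z\<in>S. \<forall>i j. (\<lambda>n. A (int n) $ i $ j * z ^ n) sums (F z $ i $ j))"

lemma rational_series:
  fixes g :: "complex \<Rightarrow> 'q::finite cmat"
  assumes "rational_nopole_closed_disk g"
  shows "\<exists>G D. series_of G g (cball 0 1) \<and> psum_le (\<lambda>l. wt (- 2) l * norm (G l)) UNIV D"
proof -
  have "\<forall>i j. \<exists>s B. (\<forall>n. (1 + real n) ^ 4 * cmod (s n) \<le> B) \<and> (\<forall>z\<in>cball 0 1. (\<lambda>n. s n * z ^ n) sums (g z $ i $ j))"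
    using assms unfolding rational_nopole_iff by (intro allI rational_cdisk_power_series) auto
  then obtain s B where s: "\<And>i j n. (1 + real n) ^ 4 * cmod (s i j n) \<le> B i j"
    "\<And>i j z. z \<in> cball 0 1 \<Longrightarrow> (\<lambda>n. s i j n * z ^ n) sums (g z $ i $ j)"
    by metis
  define G :: "int \<Rightarrow> 'q cmat" where "G k = (if k < 0 then 0 else (\<chi> i j. s i j (nat k)))" for k
  define D where "D = (\<Sum>i\<in>UNIV. \<Sum>j\<in>UNIV. B i j)"
  have "0 \<le> B i j" for i j using order_trans[OF norm_ge_zero] s(1)[of 0 i j] by simp
  then have D0: "0 \<le> D" unfolding D_def by (intro sum_nonneg)
  have "series_of G g (cball 0 1)" using s(2) by (auto simp: series_of_def G_def)
  moreover have "psum_le (\<lambda>l. wt (- 2) l * norm (G l)) UNIV (D * (2 * (2 / (2 - 1))))"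
  proof (rule psum_le_mono[OF psum_le_cmult[OF psum_le_wt_UNIV[of 2] D0]])
    fix l
    show "wt (- 2) l * norm (G l) \<le> D * wt 2 l"
    proof (cases "l < 0")
      case True
      then show ?thesis using D0 by (simp add: G_def)
    next
      case False
      then obtain n where l: "l = int n" by (metis not_less zero_le_imp_eq_int)
      have "(1 + real n) ^ 4 * norm (G l) \<le> (1 + real n) ^ 4 * (\<Sum>i\<in>UNIV. \<Sum>j\<in>UNIV. cmod (G l $ i $ j))"
        by (intro mult_left_mono norm_mat_le_sum) auto
      also have "\<dots> = (\<Sum>i\<in>UNIV. \<Sum>j\<in>UNIV. (1 + real n) ^ 4 * cmod (s i j n))"
        by (simp add: sum_distrib_left G_def l)
      also have "\<dots> \<le> D"
        unfolding D_def by (intro sum_mono s)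
      finally have "(1 + real n) ^ 4 * norm (G l) \<le> D" .
      then have "wt (- 4) l * norm (G l) \<le> D" by (simp add: wt_def l)
      then have "wt (- 4) l * norm (G l) * wt 2 l \<le> D * wt 2 l" by (intro mult_right_mono) auto
      also have "wt (- 4) l * norm (G l) * wt 2 l = wt (- 4 + 2) l * norm (G l)"
        unfolding wt_add by (simp only: mult_ac)
      finally show ?thesis by simp
    qed
  qed auto
  ultimately show ?thesis by blast
qed

section \<open>Power series of the singular factors and of their inverses\<close>

lemma bconv_finite:
  assumes "\<And>k. k < 0 \<Longrightarrow> r k = 0"
  shows "bconv x r (int n) = (\<Sum>l\<le>n. bc x (int l) *\<^sub>R r (int (n - l)))"
proof -
  have "bconv x r (int n) = infsum (\<lambda>l. bc x (int n - l) *\<^sub>R r l) {0..int n}"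
    unfolding bconv_def by (rule infsum_cong_neutral) (auto simp: assms not_le)
  also have "\<dots> = (\<Sum>l\<in>{0..int n}. bc x (int n - l) *\<^sub>R r l)" by simp
  also have "\<dots> = (\<Sum>l\<le>n. bc x (int l) *\<^sub>R r (int (n - l)))"
    by (rule sum.reindex_bij_witness[of _ "\<lambda>l. int n - int l" "\<lambda>l. n - nat l"]) auto
  finally show ?thesis .
qed

lemma power_series_abs_summable:
  fixes z :: complex
  assumes "\<And>z. norm z < 1 \<Longrightarrow> summable (\<lambda>n. f n * z ^ n)" "norm z < 1"
  shows "summable (\<lambda>n. norm (f n * z ^ n))"
proof -
  define x where "x = complex_of_real ((1 + norm z) / 2)"
  have "norm x = (1 + norm z) / 2" unfolding x_def norm_of_real by simp
  then have "norm x < 1" "norm z < norm x" using assms(2) by auto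
  then show ?thesis by (intro powser_insidea[OF assms(1)])
qed

lemma power_series_mult:
  fixes z :: complex
  assumes "\<And>z. norm z < 1 \<Longrightarrow> (\<lambda>n. f n * z ^ n) sums F z" "\<And>z. norm z < 1 \<Longrightarrow> (\<lambda>n. g n * z ^ n) sums H z" "norm z < 1"
  shows "(\<lambda>n. (\<Sum>i\<le>n. f i * g (n - i)) * z ^ n) sums (F z * H z)"
proof -
  have "(\<lambda>n. \<Sum>i\<le>n. (f i * z ^ i) * (g (n - i) * z ^ (n - i))) sums ((\<Sum>n. f n * z ^ n) * (\<Sum>n. g n * z ^ n))"
    using assms by (intro Cauchy_product_sums power_series_abs_summable) (auto dest: sums_summable)
  moreover have "(\<Sum>i\<le>n. (f i * z ^ i) * (g (n - i) * z ^ (n - i))) = (\<Sum>i\<le>n. f i * g (n - i)) * z ^ n" for n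
    unfolding sum_distrib_right
  proof (rule sum.cong)
    fix i assume "i \<in> {..n}"
    then have "z ^ n = z ^ i * z ^ (n - i)" by (simp add: power_add[symmetric])
    then show "(f i * z ^ i) * (g (n - i) * z ^ (n - i)) = f i * g (n - i) * z ^ n" by simp
  qed simp
  ultimately show ?thesis
    using sums_unique[OF assms(1)[OF assms(3)]] sums_unique[OF assms(2)[OF assms(3)]] by simp
qed

lemma bc_sums:
  fixes z :: complex
  assumes "norm z < 1"
  shows "(\<lambda>n. of_real (bc x (int n)) * z ^ n) sums ((1 - z) powr (- of_real x))"
proof -
  have "(\<lambda>n. (- complex_of_real x gchoose n) * (- z) ^ n) sums (1 + - z) powr (- of_real x)"
    using assms by (intro gen_binomial_complex) simp
  moreover have "(- complex_of_real x gchoose n) * (- z) ^ n = of_real (bc x (int n)) * z ^ n" for n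
  proof -
    have "(- complex_of_real x gchoose n) = (- 1) ^ n * of_real (bc x (int n))"
      by (simp add: gbinomial_pochhammer bc_def pochhammer_of_real[symmetric])
    moreover have "(- z) ^ n = (- 1) ^ n * z ^ n" by (rule power_minus)
    moreover have "(- 1) ^ n * b * ((- 1) ^ n * z ^ n) = ((- 1) * (- 1)) ^ n * (b * z ^ n)" for b :: complex
      by (simp only: power_mult_distrib mult_ac)
    ultimately show ?thesis by simp
  qed
  ultimately show ?thesis by simp
qed

lemma bconv_series:
  assumes "series_of r F (cball 0 1)"
  shows "series_of (bconv x r) (\<lambda>z. cscale ((1 - z) powr (- of_real x)) (F z)) (ball 0 1)"
  unfolding series_of_def
proof (intro conjI allI impI ballI)
  have r0: "\<And>k. k < 0 \<Longrightarrow> r k = 0" using assms by (simp add: series_of_def)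
  show "bconv x r k = 0" if "k < 0" for k
    unfolding bconv_def
  proof (rule infsum_0)
    fix l show "bc x (k - l) *\<^sub>R r l = 0" using that r0[of l] by (cases "l < 0") auto
  qed
  fix z :: complex and i j assume z: "z \<in> ball 0 1"
  have "(\<lambda>n. (\<Sum>l\<le>n. of_real (bc x (int l)) * r (int (n - l)) $ i $ j) * z ^ n) sums ((1 - z) powr (- of_real x) * F z $ i $ j)"
    using z assms bc_sums by (intro power_series_mult) (auto simp: series_of_def)
  moreover have "bconv x r (int n) $ i $ j = (\<Sum>l\<le>n. of_real (bc x (int l)) * r (int (n - l)) $ i $ j)" for n
    by (simp add: bconv_finite[OF r0]) (simp add: scaleR_conv_of_real)
  ultimately show "(\<lambda>n. bconv x r (int n) $ i $ j * z ^ n) sums (cscale ((1 - z) powr (- of_real x)) (F z) $ i $ j)"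
    by (simp add: cscale_def)
qed

lemma power_series_unique:
  fixes f g :: "nat \<Rightarrow> complex"
  assumes "\<And>z. norm z < 1 \<Longrightarrow> (\<lambda>n. f n * z ^ n) sums F z" "\<And>z. norm z < 1 \<Longrightarrow> (\<lambda>n. g n * z ^ n) sums F z"
  shows "f = g"
proof -
  have r: "0 < fps_conv_radius (Abs_fps h)" if "\<And>z. norm z < 1 \<Longrightarrow> (\<lambda>n. h n * z ^ n) sums F z" for h :: "nat \<Rightarrow> complex"
  proof -
    have "norm (1 / 2 :: complex) \<le> conv_radius h"
      using that[of "1 / 2"] by (intro conv_radius_geI) (auto dest: sums_summable)
    then show ?thesis unfolding fps_conv_radius_def by (simp add: less_le_trans[of 0 "ereal (1 / 2)"])
  qed
  have "Abs_fps f = Abs_fps g"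
  proof (rule eval_fps_eqD)
    have "eventually (\<lambda>z. z \<in> ball (0::complex) 1) (nhds 0)"
      by (intro eventually_nhds_in_open) auto
    then show "eventually (\<lambda>z. eval_fps (Abs_fps f) z = eval_fps (Abs_fps g) z) (nhds 0)"
    proof eventually_elim
      case (elim z)
      then show ?case
        using sums_unique[OF assms(1)[of z]] sums_unique[OF assms(2)[of z]] by (simp add: eval_fps_def)
    qed
  qed (use r assms in auto)
  then have "fps_nth (Abs_fps f) = fps_nth (Abs_fps g)" by (rule arg_cong)
  then show ?thesis by (simp add: Abs_fps_inverse)
qed

text \<open>By causality the convolution is a finite Cauchy product, and uniqueness of power series
  turns the identity in the disk into one for the coefficients.\<close>

lemma series_mult_inverse:
  assumes A: "series_of A F (ball 0 1)" and B: "series_of B H (ball 0 1)"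
    and FH: "\<And>z. z \<in> ball 0 1 \<Longrightarrow> F z ** H z = mat 1"
  shows "infsum (\<lambda>m. A m ** B (k - m)) UNIV = (if k = 0 then mat 1 else 0)"
proof -
  have z0: "A k = 0" "B k = 0" if "k < 0" for k using A B that by (auto simp: series_of_def)
  show ?thesis
  proof (cases "k < 0")
    case True
    then have "A m ** B (k - m) = 0" for m by (cases "m < 0") (auto simp: z0 mat_simps)
    then show ?thesis using True by simp
  next
    case False
    then obtain n where k: "k = int n" by (metis not_less zero_le_imp_eq_int)
    have "infsum (\<lambda>m. A m ** B (k - m)) UNIV = infsum (\<lambda>m. A m ** B (k - m)) {0..k}"
      by (rule infsum_cong_neutral) (auto simp: z0 mat_simps not_le)
    also have "\<dots> = (\<Sum>m\<in>{0..k}. A m ** B (k - m))" by simp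
    also have "\<dots> = (\<Sum>m\<le>n. A (int m) ** B (int (n - m)))"
      by (rule sum.reindex_bij_witness[of _ int nat]) (auto simp: k of_nat_diff)
    also have "\<dots> = (if k = 0 then mat 1 else 0)"
    proof (rule vec_eq_iff[THEN iffD2, rule_format], rule vec_eq_iff[THEN iffD2, rule_format])
      fix i j
      have "(\<lambda>n. \<Sum>l\<in>UNIV. \<Sum>m\<le>n. A (int m) $ i $ l * B (int (n - m)) $ l $ j) = (\<lambda>n. if n = 0 then mat 1 $ i $ j else 0)"
      proof (rule power_series_unique)
        fix z :: complex assume z: "norm z < 1"
        have "(\<lambda>n. \<Sum>l\<in>UNIV. (\<Sum>m\<le>n. A (int m) $ i $ l * B (int (n - m)) $ l $ j) * z ^ n) sums (\<Sum>l\<in>UNIV. F z $ i $ l * H z $ l $ j)"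
          using A B z by (intro sums_sum power_series_mult) (auto simp: series_of_def)
        moreover have "(\<Sum>l\<in>UNIV. F z $ i $ l * H z $ l $ j) = mat 1 $ i $ j"
          using FH[of z] z by (simp add: vec_eq_iff matrix_matrix_mult_def)
        ultimately show "(\<lambda>n. (\<Sum>l\<in>UNIV. \<Sum>m\<le>n. A (int m) $ i $ l * B (int (n - m)) $ l $ j) * z ^ n) sums (mat 1 $ i $ j)"
          by (simp only: sum_distrib_right)
        show "(\<lambda>n. (if n = 0 then mat 1 $ i $ j else 0) * z ^ n) sums (mat 1 $ i $ j)"
          using sums_single[of 0 "\<lambda>n. mat 1 $ i $ j * z ^ n"] by (simp add: if_distrib[of "\<lambda>x. x * _"] cong: if_cong)
      qed
      from fun_cong[OF this, of n]
      have "(\<Sum>m\<le>n. \<Sum>l\<in>UNIV. A (int m) $ i $ l * B (int (n - m)) $ l $ j) = (if n = 0 then mat 1 $ i $ j else 0)"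
        by (subst sum.swap) simp
      then show "(\<Sum>m\<le>n. A (int m) ** B (int (n - m))) $ i $ j = (if k = 0 then mat 1 else 0) $ i $ j"
        by (simp add: matrix_matrix_mult_def k)
    qed
    finally show ?thesis .
  qed
qed

text \<open>Connects the sums in \<open>factor_coeffs\<close> with the values at 1. The series
  converges on the closed disk, so the boundary point may be inserted directly.\<close>

lemma series_at_1:
  assumes "series_of G g (cball 0 1)" "psum_le (\<lambda>l. wt (- 2) l * norm (G l)) UNIV D"
  shows "infsum G UNIV = g 1"
proof -
  have "psum_le (\<lambda>l. norm (G l)) UNIV D"
  proof (rule psum_le_mono[OF assms(2)])
    fix l
    have "wt 0 l * norm (G l) \<le> wt (- 2) l * norm (G l)" by (intro mult_right_mono wt_antimono_exp) auto
    then show "norm (G l) \<le> wt (- 2) l * norm (G l)" by simp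
  qed simp
  then have "G summable_on UNIV" by (rule psum_le_summable) simp
  then have h: "(G has_sum infsum G UNIV) UNIV" by (rule has_sum_infsum)
  show ?thesis
  proof (rule vec_eq_iff[THEN iffD2, rule_format], rule vec_eq_iff[THEN iffD2, rule_format])
    fix i j
    from has_sum_bounded_linear[OF bounded_linear_vec_nth has_sum_bounded_linear[OF bounded_linear_vec_nth h]]
    have "((\<lambda>l. G l $ i $ j) has_sum infsum G UNIV $ i $ j) UNIV" by simp
    then have "((\<lambda>n. G (int n) $ i $ j) has_sum infsum G UNIV $ i $ j) UNIV"
      using assms(1) by (subst (asm) has_sum_int_nat) (auto simp: series_of_def)
    then have "(\<lambda>n. G (int n) $ i $ j) sums (infsum G UNIV $ i $ j)" by (rule has_sum_imp_sums)
    moreover have "(\<lambda>n. G (int n) $ i $ j) sums (g 1 $ i $ j)"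
      using assms(1) unfolding series_of_def by (force dest!: bspec[of _ _ 1])
    ultimately show "infsum G UNIV $ i $ j = g 1 $ i $ j" by (rule sums_unique2)
  qed
qed

section \<open>Fourier coefficients of the symbol\<close>

text \<open>The point \<open>\<theta> = 0\<close>, at which the symbol is unconstrained, is removed from the circle.\<close>
abbreviation circle :: "real measure" where
  "circle \<equiv> restrict_space lborel ({-pi..pi} - {0})"

lemma sets_circle [simp]: "({-pi..pi} - {0}) \<inter> space lborel \<in> sets lborel" "{-pi..pi} - {0} \<in> sets borel"
  by auto

lemma set_integral_circle:
  fixes f :: "real \<Rightarrow> complex"
  assumes "f \<in> borel_measurable circle"
  shows "(LBINT \<theta>:{-pi..pi}. f \<theta>) = integral\<^sup>L circle f"
proof -
  have m: "(\<lambda>x. indicator ({-pi..pi} - {0}) x *\<^sub>R f x) \<in> borel_measurable lborel"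
    using assms by (subst (asm) borel_measurable_restrict_space_iff) auto
  have e: "indicator {-pi..pi} x *\<^sub>R f x = indicator ({-pi..pi} - {0}) x *\<^sub>R f x + indicator {0} x *\<^sub>R f 0" for x :: real
    by (auto simp: indicator_def)
  have m': "(\<lambda>x. indicator {-pi..pi} x *\<^sub>R f x) \<in> borel_measurable lborel"
    unfolding e using m by (intro borel_measurable_add) auto
  have "AE x in lborel. x \<noteq> (0::real)" by (rule AE_lborel_singleton)
  then have "AE x in lborel. indicator {-pi..pi} x *\<^sub>R f x = indicator ({-pi..pi} - {0}) x *\<^sub>R f x"
    by eventually_elim (auto simp: indicator_def)
  then have "(LBINT \<theta>:{-pi..pi}. f \<theta>) = integral\<^sup>L lborel (\<lambda>x. indicator ({-pi..pi} - {0}) x *\<^sub>R f x)"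
    unfolding set_lebesgue_integral_def by (rule integral_cong_AE[OF m' m])
  also have "\<dots> = integral\<^sup>L circle f" by (subst integral_restrict_space) auto
  finally show ?thesis .
qed

lemma measurable_circle:
  "continuous_on ({-pi..pi} - {0}) f \<Longrightarrow> f \<in> borel_measurable circle"
  using borel_measurable_continuous_on_restrict[of "{-pi..pi} - {0}" f]
  by (simp add: measurable_def space_restrict_space sets_restrict_space)

lemma integrable_const_circle: "integrable circle (\<lambda>_. c :: real)"
proof -
  have "emeasure circle (space circle) = emeasure lborel ({-pi..pi} - {0})"
    by (simp add: space_restrict_space emeasure_restrict_space)
  also have "\<dots> \<le> emeasure lborel {-pi..pi}" by (rule emeasure_mono) auto
  also have "\<dots> < \<infinity>" using pi_gt_zero by simp
  finally have "emeasure circle (space circle) < \<infinity>" .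
  then interpret finite_measure circle by (intro finite_measureI) auto
  show ?thesis by simp
qed

lemma integral_exp_circle:
  "integral\<^sup>L circle (\<lambda>\<theta>. exp (\<i> * of_int k * of_real \<theta>)) = (if k = 0 then 2 * of_real pi else 0)"
proof -
  have "integral\<^sup>L circle (\<lambda>\<theta>. exp (\<i> * of_int k * of_real \<theta>)) = (LBINT \<theta>:{-pi..pi}. exp (\<i> * of_int k * of_real \<theta>))"
    by (rule set_integral_circle[symmetric], rule measurable_circle) (intro continuous_intros)
  also have "\<dots> = (if k = 0 then 2 * of_real pi else 0)"
  proof (cases "k = 0")
    case True
    have "(\<integral>x. indicator {-pi..pi} x *\<^sub>R (1::complex) \<partial>lborel) = of_real pi - of_real (- pi)"
      by (rule integral_FTC_Icc) (auto intro!: continuous_intros derivative_eq_intros)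
    then show ?thesis by (simp add: True set_lebesgue_integral_def)
  next
    case False
    define c where "c = \<i> * complex_of_int k"
    have c: "c \<noteq> 0" using False by (simp add: c_def)
    have "(\<integral>x. indicator {-pi..pi} x *\<^sub>R exp (c * of_real x) \<partial>lborel) = exp (c * of_real pi) / c - exp (c * of_real (- pi)) / c"
    proof (rule integral_FTC_Icc)
      show "((\<lambda>x. exp (c * of_real x) / c) has_vector_derivative exp (c * of_real x)) (at x within {-pi..pi})" for x
        using c by (auto intro!: derivative_eq_intros has_vector_derivative_real_field)
    qed (auto intro!: continuous_intros)
    also have "exp (c * of_real (- pi)) = exp (c * of_real pi)"
    proof -
      have "exp (c * of_real pi) = exp (c * of_real (- pi)) * exp (2 * of_int k * of_real pi * \<i>)"
        unfolding exp_add[symmetric] by (rule arg_cong[where f = exp]) (simp add: c_def algebra_simps)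
      moreover have "exp (2 * of_int k * of_real pi * \<i>) = 1"
        using exp_integer_2pi[of "of_int k"] by simp
      ultimately show ?thesis by simp
    qed
    finally show ?thesis using False by (simp add: set_lebesgue_integral_def c_def)
  qed
  finally show ?thesis .
qed

lemma sin_ge_half:
  fixes x :: real
  assumes "0 \<le> x" "x \<le> pi / 2"
  shows "x / 2 \<le> sin x"
proof (cases "x \<le> pi / 3")
  case True
  show ?thesis
  proof (cases "x = 0")
    case False
    have "0 * (x - 0) \<le> (sin x - x / 2) - (sin 0 - 0 / 2)"
    proof (rule increment_ge[where G' = "\<lambda>x. cos x - 1 / 2"])
      show "((\<lambda>x. sin x - x / 2) has_real_derivative cos y - 1 / 2) (at y)" for y
        by (auto intro!: derivative_eq_intros)
      show "0 \<le> cos y - 1 / 2" if "0 < y" "y < x" for y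
        using cos_monotone_0_pi_le[of y "pi / 3"] that True pi_gt_zero by (simp add: cos_60)
    qed (use assms False in \<open>auto intro!: continuous_intros\<close>)
    then show ?thesis by simp
  qed simp
next
  case False
  \<comment> \<open>Beyond \<open>pi / 3\<close> the function \<open>sin x - x / 2\<close>
    decreases, but numbers suffice: \<open>sin x \<ge> sqrt 3 / 2 \<ge> 0.85\<close>, while
    \<open>x / 2 \<le> pi / 4 < 0.8\<close>.\<close>
  have "sin (pi / 3) \<le> sin x" using False assms pi_gt_zero by (intro sin_monotone_2pi_le) auto
  moreover have "17 / 10 \<le> sqrt 3" by (rule real_le_rsqrt) (simp add: power2_eq_square)
  moreover have "pi < 3.2" using pi_approx by simp
  ultimately show ?thesis using assms(2) by (simp add: sin_60)
qed

lemma norm_one_minus_cis_ge: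
  assumes "\<bar>\<theta>\<bar> \<le> pi"
  shows "\<bar>\<theta>\<bar> / 2 \<le> cmod (1 - cis \<theta>)"
proof -
  have "(cmod (1 - cis \<theta>))\<^sup>2 = (2 * sin (\<bar>\<theta>\<bar> / 2))\<^sup>2"
  proof -
    have "(cmod (1 - cis \<theta>))\<^sup>2 = (1 - cos \<theta>)\<^sup>2 + (sin \<theta>)\<^sup>2" by (simp add: cmod_power2)
    also have "\<dots> = 2 - 2 * cos \<theta>" by (simp add: power2_diff algebra_simps)
    also have "cos \<theta> = cos (2 * (\<bar>\<theta>\<bar> / 2))" by simp
    also have "\<dots> = 1 - 2 * (sin (\<bar>\<theta>\<bar> / 2))\<^sup>2" by (rule cos_double_sin)
    finally show ?thesis by (simp add: power_mult_distrib)
  qed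
  moreover have g: "\<bar>\<theta>\<bar> / 2 / 2 \<le> sin (\<bar>\<theta>\<bar> / 2)" using assms by (intro sin_ge_half) auto
  moreover from g have "0 \<le> 2 * sin (\<bar>\<theta>\<bar> / 2)" using abs_ge_zero[of \<theta>] by linarith
  ultimately have "cmod (1 - cis \<theta>) = 2 * sin (\<bar>\<theta>\<bar> / 2)" by (metis norm_ge_zero power2_eq_imp_eq)
  with g show ?thesis by linarith
qed

lemma integrable_power_circle:
  assumes "0 < d" "d < 1 / 2"
  shows "integrable circle (\<lambda>\<theta>. \<bar>\<theta>\<bar> powr (- 2 * d))"
proof -
  have "(\<lambda>x. x powr (- 2 * d)) integrable_on {0..pi}"
    using assms by (intro integrable_on_powr_from_0) auto
  then have p: "(\<lambda>x. \<bar>x\<bar> powr (- 2 * d)) integrable_on {0..pi}"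
    by (rule integrable_eq) auto
  then have "(\<lambda>x. \<bar>x\<bar> powr (- 2 * d)) integrable_on {- pi..0}"
    using Henstock_Kurzweil_Integration.integrable_reflect_real[of "\<lambda>x. \<bar>x\<bar> powr (- 2 * d)" pi 0] by simp
  from Henstock_Kurzweil_Integration.integrable_combine[where a = "- pi" and b = pi and c = 0, OF _ _ this p]
  have "(\<lambda>x. \<bar>x\<bar> powr (- 2 * d)) integrable_on {- pi..pi}" by simp
  then have "(\<lambda>x. \<bar>x\<bar> powr (- 2 * d)) absolutely_integrable_on {- pi..pi}"
    by (subst absolutely_integrable_on_iff_nonneg) auto
  then have "integrable lborel (\<lambda>x. indicator {- pi..pi} x *\<^sub>R \<bar>x\<bar> powr (- 2 * d))"
    unfolding set_integrable_def by (subst (asm) integrable_completion) auto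
  moreover have "(\<lambda>x. indicator {- pi..pi} x *\<^sub>R \<bar>x\<bar> powr (- 2 * d)) = (\<lambda>x::real. indicator ({- pi..pi} - {0}) x *\<^sub>R \<bar>x\<bar> powr (- 2 * d))"
    using assms by (auto simp: indicator_def fun_eq_iff)
  ultimately show ?thesis by (subst integrable_restrict_space) (auto simp only: sets_circle)
qed

lemma norm_one_minus_cis_pos: "\<theta> \<in> {-pi..pi} - {0} \<Longrightarrow> 0 < cmod (1 - cis \<theta>)"
proof -
  assume th: "\<theta> \<in> {-pi..pi} - {0}"
  then have "\<bar>\<theta>\<bar> \<le> pi" "0 < \<bar>\<theta>\<bar>" by auto
  then show ?thesis using norm_one_minus_cis_ge[of \<theta>] by linarith
qed

locale singular_pair =
  fixes d K B :: real and s t :: "int \<Rightarrow> complex" and F H :: "complex \<Rightarrow> complex"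
  assumes d: "0 < d" "d < 1 / 2"
    and s: "\<And>k. k < 0 \<Longrightarrow> s k = 0" "\<And>k. cmod (s k) \<le> K * wt (1 - d) k"
    and t: "\<And>k. k < 0 \<Longrightarrow> t k = 0" "\<And>k. cmod (t k) \<le> K * wt (1 - d) k"
    and F: "\<And>z. cmod z < 1 \<Longrightarrow> (\<lambda>n. s (int n) * z ^ n) sums F z"
    and H: "\<And>z. cmod z < 1 \<Longrightarrow> (\<lambda>n. t (int n) * z ^ n) sums H z"
    and cont: "continuous_on (cball 0 1 - {1}) F" "continuous_on (cball 0 1 - {1}) H"
    and F_le: "\<And>z. z \<in> cball 0 1 - {1} \<Longrightarrow> cmod (F z) \<le> B * cmod (1 - z) powr (- d)"
    and H_le: "\<And>z. z \<in> cball 0 1 - {1} \<Longrightarrow> cmod (H z) \<le> B * cmod (1 - z) powr (- d)"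
begin

lemma B0: "0 \<le> B"
  using order_trans[OF norm_ge_zero F_le[of 0]] by simp

lemma circle_image:
  assumes "0 < r" "r \<le> 1" "\<theta> \<in> {-pi..pi} - {0}"
  shows "of_real r * cis \<theta> \<in> cball 0 1 - {1}"
proof -
  have n: "norm (of_real r * cis \<theta>) = r" using assms by (simp add: norm_mult)
  moreover have "of_real r * cis \<theta> \<noteq> 1"
  proof
    assume *: "of_real r * cis \<theta> = 1"
    then have "r = 1" using n by simp
    then have "cis \<theta> = 1" using * by simp
    then show False using norm_one_minus_cis_pos[OF assms(3)] by simp
  qed
  ultimately show ?thesis using assms by simp
qed

lemma cont_circle:
  assumes "0 < r" "r \<le> 1" "continuous_on (cball 0 1 - {1}) h"
  shows "continuous_on ({-pi..pi} - {0}) (\<lambda>\<theta>. h (of_real r * cis \<theta>))"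
  by (rule continuous_on_compose2[OF assms(3)])
    (use circle_image[OF assms(1,2)] in \<open>auto intro!: continuous_intros continuous_on_cis\<close>)

lemma product_le:
  assumes r: "0 < r" "r \<le> 1" and th: "\<theta> \<in> {-pi..pi} - {0}"
  shows "cmod (F (of_real r * cis \<theta>)) * cmod (H (of_real r * cis \<theta>)) \<le> (B * 4 powr d) * (B * 4 powr d) * \<bar>\<theta>\<bar> powr (- 2 * d)"
proof -
  define z where "z = of_real r * cis \<theta>"
  have nz: "norm z = r" using r by (simp add: z_def norm_mult)
  have zb: "z \<in> cball 0 1 - {1}" unfolding z_def using r th by (intro circle_image)
  have "cis \<theta> - z = of_real (1 - r) * cis \<theta>" by (simp add: z_def algebra_simps)
  then have "norm (cis \<theta> - z) = 1 - r" using r by (simp add: norm_mult del: of_real_diff)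
  moreover have "1 - r \<le> cmod (1 - z)" using norm_triangle_ineq2[of 1 z] nz by simp
  moreover have "cmod (1 - cis \<theta>) \<le> cmod (1 - z) + cmod (cis \<theta> - z)"
    using norm_triangle_ineq4[of "1 - z" "cis \<theta> - z"] by simp
  \<comment> \<open>One factor 2 is for arc against chord, the other for replacing
    \<open>cis \<theta>\<close> by \<open>z\<close>, which moves the point by
    \<open>1 - r \<le> cmod (1 - z)\<close>.\<close>
  ultimately have "\<bar>\<theta>\<bar> / 4 \<le> cmod (1 - z)"
    using norm_one_minus_cis_ge[of \<theta>] th by (auto simp: abs_le_iff)
  then have "cmod (1 - z) powr (- d) \<le> (\<bar>\<theta>\<bar> / 4) powr (- d)"
    using th d by (intro powr_mono2') auto
  also have "\<dots> = 4 powr d * \<bar>\<theta>\<bar> powr (- d)" by (simp add: powr_divide powr_minus field_simps)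
  finally have p: "B * cmod (1 - z) powr (- d) \<le> B * 4 powr d * \<bar>\<theta>\<bar> powr (- d)"
    using B0 by (simp add: mult.assoc mult_left_mono)
  have "cmod (F z) * cmod (H z) \<le> (B * 4 powr d * \<bar>\<theta>\<bar> powr (- d)) * (B * 4 powr d * \<bar>\<theta>\<bar> powr (- d))"
    using order_trans[OF F_le[OF zb] p] order_trans[OF H_le[OF zb] p] B0 by (intro mult_mono) auto
  also have "\<dots> = (B * 4 powr d) * (B * 4 powr d) * (\<bar>\<theta>\<bar> powr (- d) * \<bar>\<theta>\<bar> powr (- d))" by simp
  also have "\<bar>\<theta>\<bar> powr (- d) * \<bar>\<theta>\<bar> powr (- d) = \<bar>\<theta>\<bar> powr (- 2 * d)" by (simp add: powr_add[symmetric])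
  finally show ?thesis by (simp only: z_def)
qed

lemma integrable_dominant: "integrable circle (\<lambda>\<theta>. (B * 4 powr d) * (B * 4 powr d) * \<bar>\<theta>\<bar> powr (- 2 * d))"
  by (intro integrable_mult_right integrable_power_circle d)

lemma product_integrable:
  "integrable circle (\<lambda>\<theta>. exp (- \<i> * of_int k * of_real \<theta>) * (F (cis \<theta>) * cnj (H (cis \<theta>))))"
proof (rule Bochner_Integration.integrable_bound[OF integrable_dominant])
  show "(\<lambda>\<theta>. exp (- \<i> * of_int k * of_real \<theta>) * (F (cis \<theta>) * cnj (H (cis \<theta>)))) \<in> borel_measurable circle"
    using cont_circle[of 1, OF _ _ cont(1)] cont_circle[of 1, OF _ _ cont(2)]
    by (intro measurable_circle continuous_intros) simp_all
  show "AE \<theta> in circle. norm (exp (- \<i> * of_int k * of_real \<theta>) * (F (cis \<theta>) * cnj (H (cis \<theta>))))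
      \<le> norm ((B * 4 powr d) * (B * 4 powr d) * \<bar>\<theta>\<bar> powr (- 2 * d))"
  proof (intro AE_I2)
    fix \<theta> assume "\<theta> \<in> space circle"
    then show "norm (exp (- \<i> * of_int k * of_real \<theta>) * (F (cis \<theta>) * cnj (H (cis \<theta>))))
      \<le> norm ((B * 4 powr d) * (B * 4 powr d) * \<bar>\<theta>\<bar> powr (- 2 * d))"
      using product_le[of 1 \<theta>] B0 by (simp add: norm_mult space_restrict_space)
  qed
qed

lemma product_psum: "psum_le (\<lambda>m. cmod (s (m + k) * cnj (t m))) UNIV (K\<^sup>2 * (2 * ((2 - 2 * d) / (1 - 2 * d))))"
  using psum_le_mult_sq[OF psum_le_shift[OF psum_le_sq_wt[OF d(2) s(2)], of k] psum_le_sq_wt[OF d(2) t(2)]]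
  by (simp add: norm_mult)

lemma product_has_sum: "((\<lambda>m. s (m + k) * cnj (t m)) has_sum infsum (\<lambda>m. s (m + k) * cnj (t m)) UNIV) UNIV"
  by (rule has_sum_infsum, rule psum_le_summable[OF product_psum[of k]]) simp

lemma coefficient_integral:
  assumes r: "0 < r" "r < 1"
  shows "integral\<^sup>L circle (\<lambda>\<theta>. exp (- \<i> * of_int k * of_real \<theta>) * F (of_real r * cis \<theta>))
    = 2 * of_real pi * (s k * of_real r ^ nat k)"
proof -
  define P where "P N \<theta> = (\<Sum>n<N. s (int n) * of_real r ^ n * exp (\<i> * of_int (int n - k) * of_real \<theta>))" for N \<theta>
  have e: "exp (- \<i> * of_int k * of_real \<theta>) * (s (int n) * (of_real r * cis \<theta>) ^ n) = s (int n) * of_real r ^ n * exp (\<i> * of_int (int n - k) * of_real \<theta>)" for n \<theta>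
  proof -
    have "cis \<theta> ^ n = exp (\<i> * of_nat n * of_real \<theta>)"
      by (simp add: cis_conv_exp exp_of_nat_mult[symmetric] mult_ac)
    moreover have "exp (- \<i> * of_int k * of_real \<theta>) * exp (\<i> * of_nat n * of_real \<theta>) = exp (\<i> * of_int (int n - k) * of_real \<theta>)"
      by (simp add: exp_add[symmetric] algebra_simps)
    moreover have "b * (s (int n) * (of_real r * cis \<theta>) ^ n) = s (int n) * of_real r ^ n * (b * cis \<theta> ^ n)" for b
      by (simp add: power_mult_distrib)
    ultimately show ?thesis by (simp only:)
  qed
  have sm: "summable (\<lambda>n. norm (s (int n) * of_real r ^ n))"
    using r by (intro power_series_abs_summable) (auto intro: sums_summable[OF F])
  have lim: "(\<lambda>N. integral\<^sup>L circle (P N)) \<longlonglongrightarrow> integral\<^sup>L circle (\<lambda>\<theta>. exp (- \<i> * of_int k * of_real \<theta>) * F (of_real r * cis \<theta>))"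
  proof (rule integral_dominated_convergence)
    show "integrable circle (\<lambda>_. \<Sum>n. norm (s (int n) * of_real r ^ n))" by (rule integrable_const_circle)
    show "(\<lambda>\<theta>. exp (- \<i> * of_int k * of_real \<theta>) * F (of_real r * cis \<theta>)) \<in> borel_measurable circle"
      using r by (intro measurable_circle continuous_intros cont_circle cont; simp)
    show "P N \<in> borel_measurable circle" for N
      unfolding P_def by (intro measurable_circle continuous_intros)
    show "AE \<theta> in circle. (\<lambda>N. P N \<theta>) \<longlonglongrightarrow> exp (- \<i> * of_int k * of_real \<theta>) * F (of_real r * cis \<theta>)"
    proof (intro AE_I2)
      fix \<theta>
      have "(\<lambda>n. exp (- \<i> * of_int k * of_real \<theta>) * (s (int n) * (of_real r * cis \<theta>) ^ n)) sums (exp (- \<i> * of_int k * of_real \<theta>) * F (of_real r * cis \<theta>))"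
        using r by (intro sums_mult F) (simp add: norm_mult)
      then show "(\<lambda>N. P N \<theta>) \<longlonglongrightarrow> exp (- \<i> * of_int k * of_real \<theta>) * F (of_real r * cis \<theta>)"
        unfolding e sums_def P_def .
    qed
    show "AE \<theta> in circle. norm (P N \<theta>) \<le> (\<Sum>n. norm (s (int n) * of_real r ^ n))" for N
    proof (intro AE_I2)
      fix \<theta>
      have "norm (P N \<theta>) \<le> (\<Sum>n<N. norm (s (int n) * of_real r ^ n))"
        unfolding P_def by (intro sum_norm_le) (simp add: norm_mult)
      also have "\<dots> \<le> (\<Sum>n. norm (s (int n) * of_real r ^ n))"
        by (intro sum_le_suminf sm) auto
      finally show "norm (P N \<theta>) \<le> (\<Sum>n. norm (s (int n) * of_real r ^ n))" .
    qed
  qed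
  have "\<forall>\<^sub>F N in sequentially. integral\<^sup>L circle (P N) = 2 * of_real pi * (s k * of_real r ^ nat k)"
    unfolding eventually_sequentially
  proof (intro exI allI impI)
    fix N assume N: "nat k + 1 \<le> N"
    have ic: "integrable circle (\<lambda>\<theta>. exp (\<i> * of_int j * of_real \<theta>))" for j
    proof (rule Bochner_Integration.integrable_bound[OF integrable_const_circle[of 1]])
      show "(\<lambda>\<theta>. exp (\<i> * of_int j * of_real \<theta>)) \<in> borel_measurable circle"
        by (intro measurable_circle continuous_intros)
    qed simp
    have "integral\<^sup>L circle (P N) = (\<Sum>n<N. integral\<^sup>L circle (\<lambda>\<theta>. s (int n) * of_real r ^ n * exp (\<i> * of_int (int n - k) * of_real \<theta>)))"
      unfolding P_def by (rule Bochner_Integration.integral_sum) (intro integrable_mult_right ic)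
    also have "\<dots> = (\<Sum>n<N. s (int n) * of_real r ^ n * (if int n - k = 0 then 2 * of_real pi else 0))"
      by (simp only: integral_mult_right_zero integral_exp_circle)
    \<comment> \<open>For negative \<open>k\<close> no index matches on the left;
      \<open>nat k\<close> is then 0 on the right, but the term vanishes because
      \<open>s k = 0\<close>.\<close>
    also have "\<dots> = (\<Sum>n<N. if n = nat k then 2 * of_real pi * (s k * of_real r ^ nat k) else 0)"
    proof (rule sum.cong)
      fix n show "s (int n) * of_real r ^ n * (if int n - k = 0 then 2 * of_real pi else 0) = (if n = nat k then 2 * of_real pi * (s k * of_real r ^ nat k) else 0)"
      proof (cases "int n = k")
        case True
        then show ?thesis by auto
      next
        case False
        then have "n = nat k \<Longrightarrow> k < 0" by linarith
        then show ?thesis using False s(1)[of k] by auto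
      qed
    qed simp
    also have "\<dots> = 2 * of_real pi * (s k * of_real r ^ nat k)" using N by simp
    finally show "integral\<^sup>L circle (P N) = 2 * of_real pi * (s k * of_real r ^ nat k)" .
  qed
  from LIMSEQ_unique[OF lim tendsto_eventually[OF this]] show ?thesis .
qed

text \<open>Only the conjugated series is expanded; each of its terms then picks out one coefficient
  of \<open>F\<close> by \<open>coefficient_integral\<close>.\<close>

lemma product_integral_inside:
  assumes r: "0 < r" "r < 1"
  shows "(\<lambda>l. 2 * of_real pi * (s (int l + k) * cnj (t (int l)) * of_real r ^ (l + nat (int l + k))))
    sums integral\<^sup>L circle (\<lambda>\<theta>. exp (- \<i> * of_int k * of_real \<theta>) * (F (of_real r * cis \<theta>) * cnj (H (of_real r * cis \<theta>))))"
proof -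
  define C where "C = B * (1 - r) powr (- d)"
  have bF: "cmod (F z) \<le> C" if "cmod z = r" for z
  proof -
    have "cmod (F z) \<le> B * cmod (1 - z) powr (- d)" using that r by (intro F_le) auto
    also have "\<dots> \<le> C"
      unfolding C_def using that r d B0 norm_triangle_ineq2[of 1 z]
      by (intro mult_left_mono powr_mono2') auto
    finally show ?thesis .
  qed
  define h where "h l \<theta> = cnj (t (int l)) * of_real r ^ l * (exp (- \<i> * of_int (int l + k) * of_real \<theta>) * F (of_real r * cis \<theta>))" for l \<theta>
  have sm: "summable (\<lambda>n. norm (t (int n) * of_real r ^ n))"
    using r by (intro power_series_abs_summable) (auto intro: sums_summable[OF H])
  have hi: "integrable circle (h l)" for l
  proof (rule Bochner_Integration.integrable_bound[OF integrable_const_circle[of "norm (t (int l)) * r ^ l * C"]])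
    show "h l \<in> borel_measurable circle"
      unfolding h_def using r by (intro measurable_circle continuous_intros cont_circle cont; simp)
    show "AE \<theta> in circle. norm (h l \<theta>) \<le> norm (norm (t (int l)) * r ^ l * C)"
    proof (intro AE_I2)
      fix \<theta>
      have "norm (h l \<theta>) = norm (t (int l)) * r ^ l * norm (F (of_real r * cis \<theta>))"
        using r by (simp add: h_def norm_mult norm_power)
      also have "\<dots> \<le> norm (t (int l)) * r ^ l * C"
        using r by (intro mult_left_mono bF) (auto simp: norm_mult)
      finally show "norm (h l \<theta>) \<le> norm (norm (t (int l)) * r ^ l * C)" by simp
    qed
  qed
  have lim: "(\<lambda>N. integral\<^sup>L circle (\<lambda>\<theta>. \<Sum>l<N. h l \<theta>)) \<longlonglongrightarrow> integral\<^sup>L circle (\<lambda>\<theta>. exp (- \<i> * of_int k * of_real \<theta>) * (F (of_real r * cis \<theta>) * cnj (H (of_real r * cis \<theta>))))"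
  proof (rule integral_dominated_convergence)
    show "integrable circle (\<lambda>_. (\<Sum>n. norm (t (int n) * of_real r ^ n)) * C)" by (rule integrable_const_circle)
    show "(\<lambda>\<theta>. exp (- \<i> * of_int k * of_real \<theta>) * (F (of_real r * cis \<theta>) * cnj (H (of_real r * cis \<theta>)))) \<in> borel_measurable circle"
      using r by (intro measurable_circle continuous_intros cont_circle cont; simp)
    show "(\<lambda>\<theta>. \<Sum>l<N. h l \<theta>) \<in> borel_measurable circle" for N
      using hi by (intro borel_measurable_sum) auto
    show "AE \<theta> in circle. (\<lambda>N. \<Sum>l<N. h l \<theta>) \<longlonglongrightarrow> exp (- \<i> * of_int k * of_real \<theta>) * (F (of_real r * cis \<theta>) * cnj (H (of_real r * cis \<theta>)))"
    proof (intro AE_I2)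
      fix \<theta>
      have "(\<lambda>l. cnj (t (int l) * (of_real r * cis \<theta>) ^ l)) sums cnj (H (of_real r * cis \<theta>))"
        using r by (subst sums_cnj) (intro H, simp add: norm_mult)
      then have "(\<lambda>l. (exp (- \<i> * of_int k * of_real \<theta>) * F (of_real r * cis \<theta>)) * cnj (t (int l) * (of_real r * cis \<theta>) ^ l)) sums
         ((exp (- \<i> * of_int k * of_real \<theta>) * F (of_real r * cis \<theta>)) * cnj (H (of_real r * cis \<theta>)))"
        by (rule sums_mult)
      moreover have "(exp (- \<i> * of_int k * of_real \<theta>) * F (of_real r * cis \<theta>)) * cnj (t (int l) * (of_real r * cis \<theta>) ^ l) = h l \<theta>" for l
      proof -
        have "cnj (cis \<theta> ^ l) = exp (- \<i> * of_nat l * of_real \<theta>)"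
          unfolding complex_cnj_power cis_cnj by (simp add: cis_conv_exp exp_of_nat_mult[symmetric] mult_ac)
        moreover have "exp (- \<i> * of_int k * of_real \<theta>) * exp (- \<i> * of_nat l * of_real \<theta>) = exp (- \<i> * of_int (int l + k) * of_real \<theta>)"
          by (simp add: exp_add[symmetric] algebra_simps)
        moreover have "(a * b) * cnj (t (int l) * (of_real r * cis \<theta>) ^ l) = cnj (t (int l)) * of_real r ^ l * ((a * cnj (cis \<theta> ^ l)) * b)" for a b
          by (simp add: power_mult_distrib)
        ultimately show ?thesis by (simp only: h_def)
      qed
      ultimately show "(\<lambda>N. \<Sum>l<N. h l \<theta>) \<longlonglongrightarrow> exp (- \<i> * of_int k * of_real \<theta>) * (F (of_real r * cis \<theta>) * cnj (H (of_real r * cis \<theta>)))"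
        by (simp add: sums_def mult.assoc)
    qed
    show "AE \<theta> in circle. norm (\<Sum>l<N. h l \<theta>) \<le> (\<Sum>n. norm (t (int n) * of_real r ^ n)) * C" for N
    proof (intro AE_I2)
      fix \<theta>
      have C0: "0 \<le> C" using B0 by (simp add: C_def)
      have "norm (\<Sum>l<N. h l \<theta>) \<le> (\<Sum>l<N. norm (t (int l) * of_real r ^ l) * C)"
      proof (rule sum_norm_le)
        fix l
        have "norm (h l \<theta>) = norm (t (int l) * of_real r ^ l) * norm (F (of_real r * cis \<theta>))"
          by (simp add: h_def norm_mult)
        also have "\<dots> \<le> norm (t (int l) * of_real r ^ l) * C"
          using r by (intro mult_left_mono bF) (auto simp: norm_mult)
        finally show "norm (h l \<theta>) \<le> norm (t (int l) * of_real r ^ l) * C" .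
      qed
      also have "\<dots> = (\<Sum>l<N. norm (t (int l) * of_real r ^ l)) * C" by (simp add: sum_distrib_right)
      also have "\<dots> \<le> (\<Sum>n. norm (t (int n) * of_real r ^ n)) * C"
        using C0 by (intro mult_right_mono sum_le_suminf sm) auto
      finally show "norm (\<Sum>l<N. h l \<theta>) \<le> (\<Sum>n. norm (t (int n) * of_real r ^ n)) * C" .
    qed
  qed
  have "integral\<^sup>L circle (\<lambda>\<theta>. \<Sum>l<N. h l \<theta>) = (\<Sum>l<N. 2 * of_real pi * (s (int l + k) * cnj (t (int l)) * of_real r ^ (l + nat (int l + k))))" for N
  proof -
    have "integral\<^sup>L circle (h l) = 2 * of_real pi * (s (int l + k) * cnj (t (int l)) * of_real r ^ (l + nat (int l + k)))" for l
      unfolding h_def integral_mult_right_zero coefficient_integral[OF r] by (simp add: power_add)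
    then show ?thesis using hi by (subst Bochner_Integration.integral_sum) auto
  qed
  then show ?thesis using lim by (simp add: sums_def)
qed

text \<open>Dominated convergence as the radius tends to 1; on both sides the bound does not depend on the
  radius because \<open>cmod (1 - cis \<theta>) \<le> 2 * cmod (1 - r * cis \<theta>)\<close>.\<close>
lemma product_integral:
  "integral\<^sup>L circle (\<lambda>\<theta>. exp (- \<i> * of_int k * of_real \<theta>) * (F (cis \<theta>) * cnj (H (cis \<theta>))))
    = 2 * of_real pi * infsum (\<lambda>m. s (m + k) * cnj (t m)) UNIV"
proof -
  define r where "r n = 1 - 1 / (real n + 2)" for n :: nat
  have r: "0 < r n" "r n < 1" for n by (auto simp: r_def field_simps)
  have r1: "r \<longlonglongrightarrow> 1"
  proof -
    have "(\<lambda>n. 1 - inverse (real (Suc (Suc n)))) \<longlonglongrightarrow> 1 - 0"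
      by (intro tendsto_intros LIMSEQ_Suc[OF LIMSEQ_inverse_real_of_nat])
    then show ?thesis by (simp add: r_def[abs_def] inverse_eq_divide add_ac)
  qed
  define J where "J \<rho> \<theta> = exp (- \<i> * of_int k * of_real \<theta>) * (F (of_real \<rho> * cis \<theta>) * cnj (H (of_real \<rho> * cis \<theta>)))" for \<rho> \<theta>
  have L: "(\<lambda>n. integral\<^sup>L circle (J (r n))) \<longlonglongrightarrow> integral\<^sup>L circle (J 1)"
  proof (rule integral_dominated_convergence)
    show "integrable circle (\<lambda>\<theta>. (B * 4 powr d) * (B * 4 powr d) * \<bar>\<theta>\<bar> powr (- 2 * d))"
      by (rule integrable_dominant)
    show "J 1 \<in> borel_measurable circle" "J (r n) \<in> borel_measurable circle" for n
      unfolding J_def using r[of n] by (intro measurable_circle continuous_intros cont_circle cont; simp)+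
    show "AE \<theta> in circle. (\<lambda>n. J (r n) \<theta>) \<longlonglongrightarrow> J 1 \<theta>"
    proof (intro AE_I2)
      fix \<theta> assume "\<theta> \<in> space circle"
      then have th: "\<theta> \<in> {-pi..pi} - {0}" by (simp add: space_restrict_space)
      have c1: "cis \<theta> \<in> cball 0 1 - {1}" using norm_one_minus_cis_pos[OF th] by auto
      have tz: "(\<lambda>n. of_real (r n) * cis \<theta>) \<longlonglongrightarrow> cis \<theta>"
        using tendsto_mult[OF tendsto_of_real[OF r1] tendsto_const[of "cis \<theta>"]] by simp
      have inn: "of_real (r n) * cis \<theta> \<in> cball 0 1 - {1}" for n
        using r[of n] th by (intro circle_image) auto
      have lim: "(\<lambda>n. h (of_real (r n) * cis \<theta>)) \<longlonglongrightarrow> h (cis \<theta>)" if "continuous_on (cball 0 1 - {1}) h" for h :: "complex \<Rightarrow> complex"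
        by (rule continuous_on_tendsto_compose[OF that tz c1]) (use inn in simp)
      show "(\<lambda>n. J (r n) \<theta>) \<longlonglongrightarrow> J 1 \<theta>"
        unfolding J_def using lim[OF cont(1)] lim[OF cont(2)] by (auto intro!: tendsto_intros)
    qed
    show "AE \<theta> in circle. norm (J (r n) \<theta>) \<le> (B * 4 powr d) * (B * 4 powr d) * \<bar>\<theta>\<bar> powr (- 2 * d)" for n
    proof (intro AE_I2)
      fix \<theta> assume "\<theta> \<in> space circle"
      then have th: "\<theta> \<in> {-pi..pi} - {0}" by (simp add: space_restrict_space)
      then show "norm (J (r n) \<theta>) \<le> (B * 4 powr d) * (B * 4 powr d) * \<bar>\<theta>\<bar> powr (- 2 * d)"
        using product_le[of "r n" \<theta>] r[of n] by (simp add: J_def norm_mult)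
    qed
  qed
  define b where "b l = s (int l + k) * cnj (t (int l))" for l
  note hs = product_has_sum[of k] and ps = product_psum[of k]
  have bs: "b sums infsum (\<lambda>m. s (m + k) * cnj (t m)) UNIV"
    using hs unfolding b_def by (intro has_sum_imp_sums) (subst (asm) has_sum_int_nat, auto simp: t(1))
  have "(\<lambda>m. cmod (s (m + k) * cnj (t m))) summable_on UNIV"
    by (rule psum_le_real(1)[OF ps]) simp
  then have "((\<lambda>m. cmod (s (m + k) * cnj (t m))) has_sum infsum (\<lambda>m. cmod (s (m + k) * cnj (t m))) UNIV) UNIV" by (rule has_sum_infsum)
  then have bn: "summable (\<lambda>l. norm (b l))"
    unfolding b_def by (intro sums_summable[OF has_sum_imp_sums]) (subst (asm) has_sum_int_nat, auto simp: t(1))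
  \<comment> \<open>The products of coefficients are absolutely summable by square summability, so
    the powers of \<open>r n\<close> may be replaced by 1 termwise.\<close>
  have R: "(\<lambda>n. \<Sum>l. 2 * of_real pi * (b l * of_real (r n) ^ (l + nat (int l + k)))) \<longlonglongrightarrow> (\<Sum>l. 2 * of_real pi * b l)"
  proof (rule tannerys_theorem[THEN conjunct2, THEN conjunct2])
    show "summable (\<lambda>l. 2 * pi * norm (b l))" by (intro summable_mult bn)
    show "\<forall>\<^sub>F (l, n) in sequentially \<times>\<^sub>F sequentially. norm (2 * of_real pi * (b l * of_real (r n) ^ (l + nat (int l + k)))) \<le> 2 * pi * norm (b l)"
    proof (rule always_eventually, rule allI)
      fix x :: "nat \<times> nat"
      obtain l n where x: "x = (l, n)" by (cases x)
      have "r n ^ (l + nat (int l + k)) \<le> 1" using r[of n] by (intro power_le_one) auto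
      then have "norm (b l) * r n ^ (l + nat (int l + k)) \<le> norm (b l)" by (intro mult_left_le) auto
      then show "case x of (l, n) \<Rightarrow> norm (2 * of_real pi * (b l * of_real (r n) ^ (l + nat (int l + k)))) \<le> 2 * pi * norm (b l)"
        using r[of n] by (simp add: x norm_mult norm_power)
    qed
    show "(\<lambda>n. 2 * of_real pi * (b l * of_real (r n) ^ (l + nat (int l + k)))) \<longlonglongrightarrow> 2 * of_real pi * b l" for l
    proof -
      have "(\<lambda>n. 2 * of_real pi * (b l * of_real (r n) ^ (l + nat (int l + k)))) \<longlonglongrightarrow> 2 * of_real pi * (b l * of_real 1 ^ (l + nat (int l + k)))"
        by (intro tendsto_intros r1)
      then show ?thesis by simp
    qed
  qed simp
  moreover have "integral\<^sup>L circle (J (r n)) = (\<Sum>l. 2 * of_real pi * (b l * of_real (r n) ^ (l + nat (int l + k))))" for n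
    using sums_unique[OF product_integral_inside[OF r[of n] , of k]] by (simp add: J_def[abs_def] b_def)
  ultimately have "integral\<^sup>L circle (J 1) = (\<Sum>l. 2 * of_real pi * b l)"
    using L by (simp only: LIMSEQ_unique)
  also have "\<dots> = 2 * of_real pi * infsum (\<lambda>m. s (m + k) * cnj (t m)) UNIV"
    using sums_unique[OF sums_mult[OF bs, of "2 * of_real pi"]] by simp
  finally show ?thesis by (simp add: J_def[abs_def])
qed

end

section \<open>The coefficients of the two factorizations\<close>

lemma fourier_of_products:
  fixes w :: "complex \<Rightarrow> 'q::finite cmat"
  assumes P: "\<And>l. singular_pair d K B (s l) (t l) (F l) (H l)"
    and w: "\<And>u. norm u = 1 \<Longrightarrow> u \<noteq> 1 \<Longrightarrow> w u $ i $ j = (\<Sum>l\<in>(UNIV :: 'q set). F l u * cnj (H l u))"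
  shows "((\<lambda>m. \<Sum>l\<in>(UNIV :: 'q set). s l (m + k) * cnj (t l m)) has_sum fourier_coeff w k $ i $ j) UNIV"
proof -
  define f where "f l \<theta> = exp (- \<i> * of_int k * of_real \<theta>) * (F l (cis \<theta>) * cnj (H l (cis \<theta>)))" for l \<theta>
  have fi: "integrable circle (f l)" for l
    using singular_pair.product_integrable[OF P] by (simp add: f_def[abs_def])
  have e: "exp (- \<i> * of_int k * of_real \<theta>) * w (cis \<theta>) $ i $ j = (\<Sum>l\<in>UNIV. f l \<theta>)"
    if "\<theta> \<in> space circle" for \<theta>
  proof -
    have "\<theta> \<in> {-pi..pi} - {0}" using that by (simp add: space_restrict_space)
    then have "cis \<theta> \<noteq> 1" using norm_one_minus_cis_pos[of \<theta>] by auto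
    then show ?thesis by (simp add: w f_def sum_distrib_left)
  qed
  have "(\<lambda>\<theta>. \<Sum>l\<in>UNIV. f l \<theta>) \<in> borel_measurable circle"
    using fi by (intro borel_measurable_sum) auto
  then have "(\<lambda>\<theta>. exp (- \<i> * of_int k * of_real \<theta>) * w (cis \<theta>) $ i $ j) \<in> borel_measurable circle"
    by (subst measurable_cong[OF e])
  then have "(LBINT \<theta>:{-pi..pi}. exp (- \<i> * of_int k * of_real \<theta>) * w (cis \<theta>) $ i $ j)
      = integral\<^sup>L circle (\<lambda>\<theta>. exp (- \<i> * of_int k * of_real \<theta>) * w (cis \<theta>) $ i $ j)"
    by (rule set_integral_circle)
  also have "\<dots> = integral\<^sup>L circle (\<lambda>\<theta>. \<Sum>l\<in>UNIV. f l \<theta>)"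
    by (rule Bochner_Integration.integral_cong[OF refl e])
  also have "\<dots> = (\<Sum>l\<in>UNIV. integral\<^sup>L circle (f l))"
    by (rule Bochner_Integration.integral_sum) (rule fi)
  also have "\<dots> = (\<Sum>l\<in>UNIV. 2 * of_real pi * infsum (\<lambda>m. s l (m + k) * cnj (t l m)) UNIV)"
    using singular_pair.product_integral[OF P] by (simp add: f_def[abs_def])
  finally have "fourier_coeff w k $ i $ j = (\<Sum>l\<in>UNIV. infsum (\<lambda>m. s l (m + k) * cnj (t l m)) UNIV)"
    by (simp add: fourier_coeff_def sum_distrib_left[symmetric])
  then show ?thesis
    using has_sum_finite_sum[of UNIV "\<lambda>l m. s l (m + k) * cnj (t l m)"] singular_pair.product_has_sum[OF P] by simp
qed

lemma rational_continuous:
  fixes g :: "complex \<Rightarrow> 'q::finite cmat"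
  assumes "rational_nopole_closed_disk g"
  shows "continuous_on (cball 0 1) (\<lambda>z. g z $ i $ j)"
proof -
  obtain p r where pr: "\<And>z. z \<in> cball 0 1 \<Longrightarrow> poly r z \<noteq> 0 \<and> g z $ i $ j = poly p z / poly r z"
    using assms unfolding rational_nopole_closed_disk_def by meson
  have "continuous_on (cball 0 1) (\<lambda>z. poly p z / poly r z)"
    using pr by (intro continuous_intros) auto
  then show ?thesis using pr by (subst continuous_on_cong[OF refl]) auto
qed

lemma rational_bounded:
  fixes g :: "complex \<Rightarrow> 'q::finite cmat"
  assumes "rational_nopole_closed_disk g"
  shows "\<exists>B. \<forall>z\<in>cball 0 1. \<forall>i j. cmod (g z $ i $ j) \<le> B"
proof -
  have "\<exists>b. \<forall>z\<in>cball 0 1. cmod (g z $ i $ j) \<le> b" for i j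
    using compact_imp_bounded[OF compact_continuous_image[OF rational_continuous[OF assms, of i j] compact_cball]]
    by (auto simp: bounded_iff)
  then obtain b where b: "\<And>i j z. z \<in> cball 0 1 \<Longrightarrow> cmod (g z $ i $ j) \<le> b i j" by metis
  have "cmod (g z $ i $ j) \<le> (\<Sum>i\<in>UNIV. \<Sum>j\<in>UNIV. \<bar>b i j\<bar>)" if "z \<in> cball 0 1" for z i j
  proof -
    have "cmod (g z $ i $ j) \<le> \<bar>b i j\<bar>" using b[OF that, of i j] by linarith
    also have "\<dots> \<le> (\<Sum>j\<in>UNIV. \<bar>b i j\<bar>)" by (rule member_le_sum) auto
    also have "\<dots> \<le> (\<Sum>i\<in>UNIV. \<Sum>j\<in>UNIV. \<bar>b i j\<bar>)"
      by (rule member_le_sum[where f = "\<lambda>i. \<Sum>j\<in>UNIV. \<bar>b i j\<bar>"]) (auto intro: sum_nonneg)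
    finally show ?thesis .
  qed
  then show ?thesis by blast
qed

lemma cmod_mat_nth_le: "cmod (A $ i $ j) \<le> norm (A :: 'q::finite cmat)"
  by (meson Finite_Cartesian_Product.norm_nth_le order_trans)

lemma singular_pair_entries:
  fixes g :: "complex \<Rightarrow> 'q::finite cmat"
  assumes d: "0 < d" "d < 1 / 2" and g: "rational_nopole_closed_disk g"
    and G: "series_of G g (cball 0 1)" "psum_le (\<lambda>l. wt (- 2) l * norm (G l)) UNIV D"
  shows "\<exists>K B. \<forall>i j i' j'. singular_pair d K B (\<lambda>k. bconv d G k $ i $ j) (\<lambda>k. bconv d G k $ i' $ j')
    (\<lambda>z. cscale ((1 - z) powr (- of_real d)) (g z) $ i $ j) (\<lambda>z. cscale ((1 - z) powr (- of_real d)) (g z) $ i' $ j')"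
proof -
  obtain B where B: "\<And>z i j. z \<in> cball 0 1 \<Longrightarrow> cmod (g z $ i $ j) \<le> B"
    using rational_bounded[OF g] by blast
  have ser: "series_of (bconv d G) (\<lambda>z. cscale ((1 - z) powr (- of_real d)) (g z)) (ball 0 1)"
    by (rule bconv_series[OF G(1)])
  have c: "continuous_on (cball 0 1 - {1}) (\<lambda>z. cscale ((1 - z) powr (- of_real d)) (g z) $ i $ j)" for i j
  proof -
    \<comment> \<open>Away from 1, \<open>1 - z\<close> lies in the closed right half plane without
      0, off the cut of the principal branch, so the power is continuous up to the rest of the
      circle.\<close>
    have "0 \<le> Re (1 - z)" if "z \<in> cball 0 1 - {1}" for z
      using that complex_Re_le_cmod[of z] by auto
    then have "continuous_on (cball 0 1 - {1}) (\<lambda>z. (1 - z) powr (- complex_of_real d))"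
      by (intro continuous_on_powr_complex continuous_intros) auto
    moreover have "continuous_on (cball 0 1 - {1}) (\<lambda>z. g z $ i $ j)"
      by (rule continuous_on_subset[OF rational_continuous[OF g]]) auto
    ultimately have "continuous_on (cball 0 1 - {1}) (\<lambda>z. (1 - z) powr (- complex_of_real d) * g z $ i $ j)"
      by (rule continuous_on_mult)
    then show ?thesis by (simp add: cscale_def)
  qed
  have b: "cmod (cscale ((1 - z) powr (- of_real d)) (g z) $ i $ j) \<le> B * cmod (1 - z) powr (- d)"
    if "z \<in> cball 0 1 - {1}" for z i j
  proof -
    have "cmod (cscale ((1 - z) powr (- of_real d)) (g z) $ i $ j) = cmod (1 - z) powr (- d) * cmod (g z $ i $ j)"
      using norm_powr_real_powr'[of "- of_real d" "1 - z"] by (simp add: cscale_def norm_mult)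
    also have "\<dots> \<le> cmod (1 - z) powr (- d) * B" using that by (intro mult_left_mono B) auto
    finally show ?thesis by (simp add: mult.commute)
  qed
  have "singular_pair d D B (\<lambda>k. bconv d G k $ i $ j) (\<lambda>k. bconv d G k $ i' $ j')
    (\<lambda>z. cscale ((1 - z) powr (- of_real d)) (g z) $ i $ j) (\<lambda>z. cscale ((1 - z) powr (- of_real d)) (g z) $ i' $ j')" for i j i' j'
    by unfold_locales
      (use d c b ser in \<open>auto simp: series_of_def intro: order_trans[OF cmod_mat_nth_le norm_bconv_le[OF d G(2)]]\<close>)
  then show ?thesis by blast
qed

lemma has_sum_mat_nth: "(f has_sum S) A \<Longrightarrow> ((\<lambda>m. f m $ i $ j) has_sum S $ i $ j) A"
  for S :: "'q::finite cmat"
  by (rule has_sum_bounded_linear[OF bounded_linear_vec_nth has_sum_bounded_linear[OF bounded_linear_vec_nth]])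

lemma gram_summable:
  fixes c c' :: "int \<Rightarrow> 'q::finite cmat"
  assumes d: "d < 1 / 2" and "\<And>k. norm (c k) \<le> K * wt (1 - d) k" "\<And>k. norm (c' k) \<le> K * wt (1 - d) k"
  shows "(\<lambda>m. c (m + k) ** c' m) summable_on UNIV"
  by (rule psum_le_summable[OF psum_le_mult_sq[OF psum_le_shift[OF psum_le_sq_wt[OF assms(1,2)]] psum_le_sq_wt[OF assms(1,3)]]])
    (rule norm_mat_mult_le', auto)

lemma powr_times_cnj:
  fixes u :: complex
  shows "(1 - u) powr (- of_real d) * cnj ((1 - u) powr (- of_real d)) = of_real (norm (1 - u) powr (- 2 * d))"
proof -
  have "(1 - u) powr (- of_real d) * cnj ((1 - u) powr (- of_real d)) = of_real ((norm ((1 - u) powr (- of_real d)))\<^sup>2)"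
    by (simp add: complex_norm_square[symmetric] del: of_real_power)
  also have "norm ((1 - u) powr (- of_real d)) = norm (1 - u) powr (- d)"
    using norm_powr_real_powr'[of "- of_real d" "1 - u"] by simp
  also have "(norm (1 - u) powr (- d))\<^sup>2 = norm (1 - u) powr (- 2 * d)"
    by (simp add: power2_eq_square powr_add[symmetric])
  finally show ?thesis .
qed

lemma fourier_coeff_right:
  fixes g :: "complex \<Rightarrow> 'q::finite cmat"
  assumes d: "0 < d" "d < 1 / 2" and g: "rational_nopole_closed_disk g"
    and G: "series_of G g (cball 0 1)" "psum_le (\<lambda>l. wt (- 2) l * norm (G l)) UNIV D"
    and w: "\<And>u. norm u = 1 \<Longrightarrow> u \<noteq> 1 \<Longrightarrow>
              w u = cscale (of_real (norm (1 - u) powr (- 2 * d))) (g u ** herm (g u))"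
  shows "fourier_coeff w k = infsum (\<lambda>m. bconv d G (m + k) ** herm (bconv d G m)) UNIV"
proof -
  obtain K B where P: "\<And>i j i' j'. singular_pair d K B (\<lambda>k. bconv d G k $ i $ j) (\<lambda>k. bconv d G k $ i' $ j')
    (\<lambda>z. cscale ((1 - z) powr (- of_real d)) (g z) $ i $ j) (\<lambda>z. cscale ((1 - z) powr (- of_real d)) (g z) $ i' $ j')"
    using singular_pair_entries[OF d g G] by blast
  have s: "(\<lambda>m. bconv d G (m + k) ** herm (bconv d G m)) summable_on UNIV"
    using norm_bconv_le[OF d G(2)] by (intro gram_summable[OF d(2), of _ D]) auto
  show ?thesis
  proof (rule vec_eq_iff[THEN iffD2, rule_format], rule vec_eq_iff[THEN iffD2, rule_format])
    fix i j
    have "((\<lambda>m. \<Sum>l\<in>UNIV. bconv d G (m + k) $ i $ l * cnj (bconv d G m $ j $ l)) has_sum fourier_coeff w k $ i $ j) UNIV"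
    proof (rule fourier_of_products[OF P])
      fix u :: complex assume u: "norm u = 1" "u \<noteq> 1"
      show "w u $ i $ j = (\<Sum>l\<in>UNIV. cscale ((1 - u) powr (- of_real d)) (g u) $ i $ l * cnj (cscale ((1 - u) powr (- of_real d)) (g u) $ j $ l))"
        unfolding w[OF u] powr_times_cnj[symmetric]
        by (simp add: cscale_def matrix_matrix_mult_def herm_def sum_distrib_left mult_ac)
    qed
    moreover have "((\<lambda>m. (bconv d G (m + k) ** herm (bconv d G m)) $ i $ j) has_sum infsum (\<lambda>m. bconv d G (m + k) ** herm (bconv d G m)) UNIV $ i $ j) UNIV"
      by (rule has_sum_mat_nth, rule has_sum_infsum[OF s])
    ultimately show "fourier_coeff w k $ i $ j = infsum (\<lambda>m. bconv d G (m + k) ** herm (bconv d G m)) UNIV $ i $ j"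
      by (simp add: matrix_matrix_mult_def herm_def has_sum_unique)
  qed
qed

lemma fourier_coeff_left:
  fixes g :: "complex \<Rightarrow> 'q::finite cmat"
  assumes d: "0 < d" "d < 1 / 2" and g: "rational_nopole_closed_disk g"
    and G: "series_of G g (cball 0 1)" "psum_le (\<lambda>l. wt (- 2) l * norm (G l)) UNIV D"
    and w: "\<And>u. norm u = 1 \<Longrightarrow> u \<noteq> 1 \<Longrightarrow>
              w u = cscale (of_real (norm (1 - u) powr (- 2 * d))) (herm (g u) ** g u)"
  shows "fourier_coeff w k = infsum (\<lambda>m. herm (bconv d G m) ** bconv d G (m + k)) UNIV"
proof -
  obtain K B where P: "\<And>i j i' j'. singular_pair d K B (\<lambda>k. bconv d G k $ i $ j) (\<lambda>k. bconv d G k $ i' $ j')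
    (\<lambda>z. cscale ((1 - z) powr (- of_real d)) (g z) $ i $ j) (\<lambda>z. cscale ((1 - z) powr (- of_real d)) (g z) $ i' $ j')"
    using singular_pair_entries[OF d g G] by blast
  have "(\<lambda>m. herm (bconv d G (m + k)) ** bconv d G m) summable_on UNIV"
    using norm_bconv_le[OF d G(2)] by (intro gram_summable[OF d(2), of "\<lambda>m. herm (bconv d G m)" D]) auto
  from summable_on_bounded_linear[OF bounded_linear_herm this]
  have s: "(\<lambda>m. herm (bconv d G m) ** bconv d G (m + k)) summable_on UNIV"
    by (simp add: herm_mult)
  show ?thesis
  proof (rule vec_eq_iff[THEN iffD2, rule_format], rule vec_eq_iff[THEN iffD2, rule_format])
    fix i j
    have "((\<lambda>m. \<Sum>l\<in>UNIV. bconv d G (m + k) $ l $ j * cnj (bconv d G m $ l $ i)) has_sum fourier_coeff w k $ i $ j) UNIV"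
    proof (rule fourier_of_products[OF P])
      fix u :: complex assume u: "norm u = 1" "u \<noteq> 1"
      show "w u $ i $ j = (\<Sum>l\<in>UNIV. cscale ((1 - u) powr (- of_real d)) (g u) $ l $ j * cnj (cscale ((1 - u) powr (- of_real d)) (g u) $ l $ i))"
        unfolding w[OF u] powr_times_cnj[symmetric]
        by (simp add: cscale_def matrix_matrix_mult_def herm_def sum_distrib_left mult_ac)
    qed
    moreover have "((\<lambda>m. (herm (bconv d G m) ** bconv d G (m + k)) $ i $ j) has_sum infsum (\<lambda>m. herm (bconv d G m) ** bconv d G (m + k)) UNIV $ i $ j) UNIV"
      by (rule has_sum_mat_nth, rule has_sum_infsum[OF s])
    ultimately show "fourier_coeff w k $ i $ j = infsum (\<lambda>m. herm (bconv d G m) ** bconv d G (m + k)) UNIV $ i $ j"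
      by (simp add: matrix_matrix_mult_def herm_def has_sum_unique mult.commute)
  qed
qed

lemma matrix_inv_unique:
  fixes X Y :: "'q::finite cmat"
  assumes "X ** Y = mat 1" "Y ** X = mat 1"
  shows "matrix_inv X = Y"
proof -
  have "\<exists>Z. X ** Z = mat 1 \<and> Z ** X = mat 1" using assms by blast
  from someI_ex[OF this] have Z: "matrix_inv X ** X = mat 1" unfolding matrix_inv_def by auto
  have "matrix_inv X = matrix_inv X ** (X ** Y)" using assms by simp
  also have "\<dots> = Y" by (simp add: matrix_mul_assoc Z)
  finally show ?thesis .
qed

lemma cscale_mult: "cscale p A ** cscale q B = cscale (p * q) (A ** B)"
  by (simp add: cscale_def matrix_matrix_mult_def vec_eq_iff sum_distrib_left mult_ac)

lemma cscale_1 [simp]: "cscale 1 A = A"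
  by (simp add: cscale_def vec_eq_iff)

lemma powr_minus_cancel: "z \<in> ball 0 1 \<Longrightarrow> (1 - z) powr (- of_real d) * (1 - z) powr (of_real d) = (1 :: complex)"
  by (subst powr_add[symmetric]) auto

lemma h_inverse:
  fixes g :: "complex \<Rightarrow> 'q::finite cmat"
  assumes "det_nonzero_closed_disk g" "z \<in> ball 0 1"
  shows "cscale ((1 - z) powr (- of_real d)) (g z) ** cscale ((1 - z) powr (- of_real (- d))) (matrix_inv (g z)) = mat 1"
    "cscale ((1 - z) powr (- of_real (- d))) (matrix_inv (g z)) ** cscale ((1 - z) powr (- of_real d)) (g z) = mat 1"
proof -
  have "det (g z) \<noteq> 0" using assms by (auto simp: det_nonzero_closed_disk_def)
  note i = matrix_inv_mult[OF this]
  show "cscale ((1 - z) powr (- of_real d)) (g z) ** cscale ((1 - z) powr (- of_real (- d))) (matrix_inv (g z)) = mat 1"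
    "cscale ((1 - z) powr (- of_real (- d))) (matrix_inv (g z)) ** cscale ((1 - z) powr (- of_real d)) (g z) = mat 1"
    using powr_minus_cancel[OF assms(2), of d]
    by (simp_all add: cscale_mult i) (simp add: mult.commute)
qed

lemma mat_sums_iff: "(f sums S) \<longleftrightarrow> (\<forall>i j. (\<lambda>n. f n $ i $ j) sums S $ i $ j)"
  for f :: "nat \<Rightarrow> 'q::finite cmat"
proof
  show "f sums S \<Longrightarrow> \<forall>i j. (\<lambda>n. f n $ i $ j) sums S $ i $ j"
    by (intro allI bounded_linear.sums[OF bounded_linear_vec_nth])
  show "\<forall>i j. (\<lambda>n. f n $ i $ j) sums S $ i $ j \<Longrightarrow> f sums S"
    unfolding sums_def by (intro vec_tendstoI) (simp add: sum_component)
qed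

text \<open>The conjugation of the argument and the adjoint of the value undo each other on the
  powers of \<open>z\<close>, so only the coefficient matrices are replaced by their
  adjoints.\<close>

lemma a_tilde_eq:
  fixes g :: "complex \<Rightarrow> 'q::finite cmat"
  assumes g: "det_nonzero_closed_disk g" and R: "series_of R (\<lambda>z. matrix_inv (g z)) (cball 0 1)"
  shows "a_tilde d g = (\<lambda>k. - herm (bconv (- d) R (int k)))"
proof -
  let ?Y = "\<lambda>z. cscale ((1 - z) powr (- of_real (- d))) (matrix_inv (g z))"
  have ser: "series_of (bconv (- d) R) ?Y (ball 0 1)" by (rule bconv_series[OF R])
  have inv: "matrix_inv (h_tilde d g z) = herm (?Y (cnj z))" if "z \<in> ball 0 1" for z
  proof -
    have cz: "cnj z \<in> ball 0 1" using that by simp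
    have "h_tilde d g z = herm (cscale ((1 - cnj z) powr (- of_real d)) (g (cnj z)))"
      by (simp add: h_tilde_def h_sharp_def)
    then show ?thesis
      by (intro matrix_inv_unique) (simp_all only: herm_mult[symmetric] h_inverse[OF g cz] herm_mat_1)
  qed
  have s: "(\<lambda>k. cscale (z ^ k) (- herm (bconv (- d) R (int k)))) sums (- matrix_inv (h_tilde d g z))" if "z \<in> ball 0 1" for z
    unfolding mat_sums_iff
  proof (intro allI)
    fix i j
    have "(\<lambda>n. bconv (- d) R (int n) $ j $ i * cnj z ^ n) sums (?Y (cnj z) $ j $ i)"
      using ser that by (auto simp: series_of_def)
    then have "(\<lambda>n. - cnj (bconv (- d) R (int n) $ j $ i * cnj z ^ n)) sums (- cnj (?Y (cnj z) $ j $ i))"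
      by (intro sums_minus) (simp only: sums_cnj)
    then show "(\<lambda>n. cscale (z ^ n) (- herm (bconv (- d) R (int n))) $ i $ j) sums (- matrix_inv (h_tilde d g z)) $ i $ j"
      unfolding inv[OF that] by (simp add: herm_def cscale_def mult.commute)
  qed
  show ?thesis
    unfolding a_tilde_def
  proof (rule the_equality)
    show "\<forall>z\<in>ball 0 1. (\<lambda>k. cscale (z ^ k) (- herm (bconv (- d) R (int k)))) sums - matrix_inv (h_tilde d g z)"
      using s by blast
    fix a assume a: "\<forall>z\<in>ball 0 1. (\<lambda>k. cscale (z ^ k) (a k)) sums - matrix_inv (h_tilde d g z)"
    have "(\<lambda>k. a k $ i $ j) = (\<lambda>k. (- herm (bconv (- d) R (int k))) $ i $ j)" for i j
    proof (rule power_series_unique[where F = "\<lambda>z. (- matrix_inv (h_tilde d g z)) $ i $ j"])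
      fix z :: complex assume "norm z < 1"
      then have z: "z \<in> ball 0 1" by simp
      show "(\<lambda>k. a k $ i $ j * z ^ k) sums (- matrix_inv (h_tilde d g z)) $ i $ j"
        using bspec[OF a z] unfolding mat_sums_iff by (simp add: cscale_def mult.commute)
      show "(\<lambda>k. (- herm (bconv (- d) R (int k))) $ i $ j * z ^ k) sums (- matrix_inv (h_tilde d g z)) $ i $ j"
        using s[OF z] unfolding mat_sums_iff by (simp add: cscale_def mult.commute)
    qed
    from fun_cong[OF this] show "a = (\<lambda>k. - herm (bconv (- d) R (int k)))"
      by (simp add: fun_eq_iff vec_eq_iff)
  qed
qed

section \<open>The error bound\<close>

text \<open>The two minus signs cancel and the adjoints change places; causality permits the upper
  limit \<open>s\<close> used in the definition of \<open>T\<close>.\<close>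

lemma toeplitz_inf_inverse_eq:
  fixes g :: "complex \<Rightarrow> 'q::finite cmat"
  assumes g: "det_nonzero_closed_disk g" and R: "series_of R (\<lambda>z. matrix_inv (g z)) (cball 0 1)"
  shows "toeplitz_inf_inverse d g s t
    = (\<Sum>k\<in>{1..int s}. bconv (- d) R (int s - k) ** herm (bconv (- d) R (int t - k)))"
proof -
  have z: "bconv (- d) R k = 0" if "k < 0" for k
    using bconv_series[OF R, of "- d"] that by (simp add: series_of_def)
  have "toeplitz_inf_inverse d g s t = (\<Sum>l=1..min s t. bconv (- d) R (int (s - l)) ** herm (bconv (- d) R (int (t - l))))"
    unfolding toeplitz_inf_inverse_def a_tilde_eq[OF g R]
    by (simp add: herm_minus mat_simps)
  also have "\<dots> = (\<Sum>k\<in>{1..int (min s t)}. bconv (- d) R (int s - k) ** herm (bconv (- d) R (int t - k)))"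
    by (rule sum.reindex_bij_witness[of _ nat int]) (auto simp: of_nat_diff)
  also have "\<dots> = (\<Sum>k\<in>{1..int s}. bconv (- d) R (int s - k) ** herm (bconv (- d) R (int t - k)))"
    by (rule sum.mono_neutral_left) (auto simp: z mat_simps)
  finally show ?thesis .
qed

theorem solution_error:
  fixes d \<rho> :: real
    and w g g_sharp :: "complex \<Rightarrow> 'q::finite cmat"
    and y :: "nat \<Rightarrow> 'q cmat"
  assumes d: "0 < d" "d < 1/2"
    and g: "rational_nopole_closed_disk g" "det_nonzero_closed_disk g"
    and w: "\<And>u. norm u = 1 \<Longrightarrow> u \<noteq> 1 \<Longrightarrow>
              w u = cscale (of_real (norm (1 - u) powr (- 2 * d))) (g u ** herm (g u))"
    and g_sharp: "rational_nopole_closed_disk g_sharp" "det_nonzero_closed_disk g_sharp"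
      "\<And>u. norm u = 1 \<Longrightarrow> g u ** herm (g u) = herm (g_sharp u) ** g_sharp u"
    and \<rho>: "1 - 2 * d < \<rho>" "\<rho> < 1"
    and y: "\<And>t. 1 \<le> t \<Longrightarrow> norm (y t) \<le> Y * wt \<rho> (int t)"
  shows "\<exists>C n0. \<forall>n\<ge>n0. (\<Sum>k=1..n. norm (infinite_solution d g_sharp y k - finite_solution w y n k))
    \<le> C * (wt (\<rho> + 2 * d - 1) (int n) + wt d (int n) * (\<Sum>t\<in>{0..int n}. wt (\<rho> + d) t))"
proof -
  note gi = rational_nopole_inverse[OF g] and gsi = rational_nopole_inverse[OF g_sharp(1,2)]
  obtain G DG where G: "series_of G g (cball 0 1)" "psum_le (\<lambda>l. wt (- 2) l * norm (G l)) UNIV DG"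
    using rational_series[OF g(1)] by blast
  obtain Gs DGs where Gs: "series_of Gs g_sharp (cball 0 1)" "psum_le (\<lambda>l. wt (- 2) l * norm (Gs l)) UNIV DGs"
    using rational_series[OF g_sharp(1)] by blast
  obtain R DR where R: "series_of R (\<lambda>z. matrix_inv (g z)) (cball 0 1)" "psum_le (\<lambda>l. wt (- 2) l * norm (R l)) UNIV DR"
    using rational_series[OF gi] by blast
  obtain Rs DRs where Rs: "series_of Rs (\<lambda>z. matrix_inv (g_sharp z)) (cball 0 1)" "psum_le (\<lambda>l. wt (- 2) l * norm (Rs l)) UNIV DRs"
    using rational_series[OF gsi] by blast
  define D where "D = max (max DG DGs) (max DR DRs)"
  have w': "w u = cscale (of_real (norm (1 - u) powr (- 2 * d))) (herm (g_sharp u) ** g_sharp u)"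
    if "norm u = 1" "u \<noteq> 1" for u
    using w[OF that] g_sharp(3)[OF that(1)] by simp
  have "factor_coeffs d D G Gs R Rs (fourier_coeff w)"
  proof
    show "psum_le (\<lambda>l. wt (- 2) l * norm (G l)) UNIV D" by (rule psum_le_mono[OF G(2)]) (auto simp: D_def)
    show "psum_le (\<lambda>l. wt (- 2) l * norm (Gs l)) UNIV D" by (rule psum_le_mono[OF Gs(2)]) (auto simp: D_def)
    show "psum_le (\<lambda>l. wt (- 2) l * norm (R l)) UNIV D" by (rule psum_le_mono[OF R(2)]) (auto simp: D_def)
    show "psum_le (\<lambda>l. wt (- 2) l * norm (Rs l)) UNIV D" by (rule psum_le_mono[OF Rs(2)]) (auto simp: D_def)
    show "infsum (\<lambda>m. bconv (- d) R m ** bconv d G (k - m)) UNIV = (if k = 0 then mat 1 else 0)" for k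
      by (rule series_mult_inverse[OF bconv_series[OF R(1)] bconv_series[OF G(1)] h_inverse(2)[OF g(2)]])
    show "infsum (\<lambda>m. bconv d G m ** bconv (- d) R (k - m)) UNIV = (if k = 0 then mat 1 else 0)" for k
      by (rule series_mult_inverse[OF bconv_series[OF G(1)] bconv_series[OF R(1)] h_inverse(1)[OF g(2)]])
    show "infsum (\<lambda>m. bconv (- d) Rs m ** bconv d Gs (k - m)) UNIV = (if k = 0 then mat 1 else 0)" for k
      by (rule series_mult_inverse[OF bconv_series[OF Rs(1)] bconv_series[OF Gs(1)] h_inverse(2)[OF g_sharp(2)]])
    show "infsum (\<lambda>m. bconv d Gs m ** bconv (- d) Rs (k - m)) UNIV = (if k = 0 then mat 1 else 0)" for k
      by (rule series_mult_inverse[OF bconv_series[OF Gs(1)] bconv_series[OF Rs(1)] h_inverse(1)[OF g_sharp(2)]])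
    show "fourier_coeff w k = infsum (\<lambda>m. bconv d G (m + k) ** herm (bconv d G m)) UNIV" for k
      by (rule fourier_coeff_right[OF d g(1) G w])
    show "fourier_coeff w k = infsum (\<lambda>m. herm (bconv d Gs m) ** bconv d Gs (m + k)) UNIV" for k
      by (rule fourier_coeff_left[OF d g_sharp(1) Gs w'])
    show "herm (herm (infsum Rs UNIV) ** infsum G UNIV) ** (herm (infsum Rs UNIV) ** infsum G UNIV) = mat 1"
    proof -
      \<comment> \<open>The two factorizations are compared at the point 1 itself: since
        \<open>g 1 ** herm (g 1)\<close> equals \<open>herm (g_sharp 1) ** g_sharp 1\<close>, the
        phase there is unitary.\<close>
      define S where "S = matrix_inv (g_sharp 1)"
      have S: "g_sharp 1 ** S = mat 1" "S ** g_sharp 1 = mat 1"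
        using g_sharp(2) matrix_inv_mult[of "g_sharp 1"] by (auto simp: S_def det_nonzero_closed_disk_def)
      have "(herm S ** g 1) ** herm (herm S ** g 1) = herm S ** (g 1 ** herm (g 1)) ** S"
        by (simp add: herm_mult matrix_mul_assoc)
      also have "\<dots> = herm (g_sharp 1 ** S) ** (g_sharp 1 ** S)"
        using g_sharp(3)[of 1] by (simp add: herm_mult matrix_mul_assoc)
      also have "\<dots> = mat 1" by (simp add: S)
      finally have "herm (herm S ** g 1) ** (herm S ** g 1) = mat 1"
        by (simp only: matrix_left_right_inverse)
      then show ?thesis by (simp only: S_def series_at_1[OF G] series_at_1[OF Rs])
    qed
  qed (use d G Gs R Rs in \<open>auto simp: series_of_def\<close>)
  then interpret FC: factor_coeffs d D G Gs R Rs "fourier_coeff w" .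
  obtain K \<theta> n0 where "symbol_factors d (bconv d G) (bconv d Gs) (bconv (- d) R) (bconv (- d) Rs) (fourier_coeff w) FC.V K \<theta> n0"
    using FC.symbol_factors_ex by blast
  then interpret SF: symbol_factors d "bconv d G" "bconv d Gs" "bconv (- d) R" "bconv (- d) Rs" "fourier_coeff w" FC.V K \<theta> n0 .
  define y' where "y' t = y (nat t)" for t
  have y': "norm (y' t) \<le> Y * wt \<rho> t" if "1 \<le> t" for t
    using y[of "nat t"] that by (simp add: y'_def)
  obtain C where C: "\<And>N x. n0 \<le> N \<Longrightarrow> (\<forall>s\<in>{1..N}. (\<Sum>t\<in>{1..N}. fourier_coeff w (s - t) ** x t) = y' s) \<Longrightarrow>
    (\<Sum>s\<in>{1..N}. norm (infsum (\<lambda>t. SF.T s t ** y' t) {1..} - x s)) \<le>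
      C * (wt (\<rho> + 2 * d - 1) N + wt d N * (\<Sum>t\<in>{0..N}. wt (\<rho> + d) t))"
    using SF.finite_section_error[OF \<rho> y'] by blast
  have sum_int: "(\<Sum>t\<in>{1..int m}. f t) = (\<Sum>t=1..m. f (int t))" for f :: "int \<Rightarrow> 'b::comm_monoid_add" and m
    by (rule sum.reindex_bij_witness[of _ int nat]) auto
  have inj: "sections_injective n (toeplitz w)" for n
    unfolding sections_injective_def
  proof (intro allI impI ballI)
    fix m and x :: "nat \<Rightarrow> 'q cmat" and t
    assume x: "\<forall>s\<in>{1..m}. (\<Sum>t=1..m. toeplitz w s t ** x t) = 0" and t: "t \<in> {1..m}"
    have "x (nat (int t)) = 0"
    proof (rule SF.section_injective[of "int m" "\<lambda>t. x (nat t)"])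
      fix s assume s: "s \<in> {1..int m}"
      have "(\<Sum>t\<in>{1..int m}. fourier_coeff w (s - t) ** x (nat t)) = (\<Sum>t=1..m. toeplitz w (nat s) t ** x t)"
        unfolding sum_int using s by (simp add: toeplitz_def)
      also have "\<dots> = 0" using s by (intro x[rule_format]) auto
      finally show "(\<Sum>t\<in>{1..int m}. fourier_coeff w (s - t) ** x (nat t)) = 0" .
    qed (use t in auto)
    then show "x t = 0" by simp
  qed
  have inf: "infinite_solution d g_sharp y k = infsum (\<lambda>t. SF.T (int k) t ** y' t) {1..}" for k
  proof -
    have "infsum (\<lambda>t. SF.T (int k) t ** y' t) {1..} = infsum (\<lambda>t. SF.T (int k) (int t) ** y t) {1..}"
      by (rule infsum_reindex_bij_witness[of _ int nat]) (auto simp: y'_def)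
    then show ?thesis
      by (simp add: infinite_solution_def SF.T_def toeplitz_inf_inverse_eq[OF g_sharp(2) Rs(1)])
  qed
  have "(\<Sum>k=1..n. norm (infinite_solution d g_sharp y k - finite_solution w y n k))
    \<le> C * (wt (\<rho> + 2 * d - 1) (int n) + wt d (int n) * (\<Sum>t\<in>{0..int n}. wt (\<rho> + d) t))" if n: "nat n0 \<le> n" for n
  proof -
    have "(\<Sum>s\<in>{1..int n}. norm (infsum (\<lambda>t. SF.T s t ** y' t) {1..} - finite_solution w y n (nat s)))
      \<le> C * (wt (\<rho> + 2 * d - 1) (int n) + wt d (int n) * (\<Sum>t\<in>{0..int n}. wt (\<rho> + d) t))"
    proof (rule C)
      show "n0 \<le> int n" using n by simp
      show "\<forall>s\<in>{1..int n}. (\<Sum>t\<in>{1..int n}. fourier_coeff w (s - t) ** finite_solution w y n (nat t)) = y' s"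
      proof
        fix s assume s: "s \<in> {1..int n}"
        have "(\<Sum>t\<in>{1..int n}. fourier_coeff w (s - t) ** finite_solution w y n (nat t))
            = (\<Sum>t=1..n. toeplitz w (nat s) t ** finite_solution w y n t)"
          unfolding sum_int using s by (simp add: toeplitz_def)
        also have "\<dots> = y' s" unfolding y'_def using s by (intro finite_solution_solves[OF inj]) auto
        finally show "(\<Sum>t\<in>{1..int n}. fourier_coeff w (s - t) ** finite_solution w y n (nat t)) = y' s" .
      qed
    qed
    then show ?thesis by (simp add: sum_int inf)
  qed
  then show ?thesis by blast
qed

section \<open>From the weighted bound to the three rates\<close>

lemma wt_le_powr: "0 \<le> p \<Longrightarrow> 1 \<le> n \<Longrightarrow> wt p (int n) \<le> real n powr (- p)"
  unfolding wt_def by (intro powr_mono2') auto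

lemma powr_le_wt:
  assumes "0 \<le> p" "1 \<le> n"
  shows "real n powr (- p) \<le> 2 powr p * wt p (int n)"
proof -
  have "real n powr (- p) \<le> ((1 + real n) / 2) powr (- p)" using assms by (intro powr_mono2') auto
  then show ?thesis using half_powr_minus[of "1 + real n" p] by (simp add: wt_def)
qed

lemma sum_wt_1_le: "(\<Sum>t\<in>{0..int n}. wt 1 t) \<le> 1 + ln (1 + real n)"
proof (induction n)
  case (Suc n)
  have "{0..int (Suc n)} = insert (int (Suc n)) {0..int n}" by auto
  moreover have "wt 1 (int (Suc n)) \<le> ln (1 + real (Suc n)) - ln (1 + real n)"
  proof -
    define x where "x = 1 + real n"
    have x: "0 < x" by (simp add: x_def)
    have "1 / (x + 1) \<le> - ln (x / (x + 1))"
      using ln_le_minus_one[of "x / (x + 1)"] x by (simp add: field_simps)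
    also have "\<dots> = ln (x + 1) - ln x" using x by (simp add: ln_div)
    finally show ?thesis by (simp add: wt_1 x_def add_ac)
  qed
  ultimately show ?case using Suc by simp
qed simp

lemma bigo_tendsto_0:
  fixes f h :: "nat \<Rightarrow> real"
  assumes "f \<in> O(h)" "h \<longlonglongrightarrow> 0"
  shows "f \<longlonglongrightarrow> 0"
proof -
  obtain c where "eventually (\<lambda>n. norm (f n) \<le> c * norm (h n)) sequentially"
    using assms(1) by (elim landau_o.bigE)
  moreover have "(\<lambda>n. c * norm (h n)) \<longlonglongrightarrow> 0"
    using tendsto_mult[OF tendsto_const tendsto_norm_zero[OF assms(2)], of c] by simp
  ultimately show ?thesis by (rule Lim_null_comparison)
qed

lemma real_powr_minus_tendsto_0: "0 < p \<Longrightarrow> (\<lambda>n. real n powr (- p)) \<longlonglongrightarrow> 0"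
  by (rule tendsto_neg_powr[OF _ filterlim_real_sequentially]) simp

theorem theorem3p1:
  fixes d \<rho> :: real
    and w g g_sharp :: "complex \<Rightarrow> complex^'q::finite^'q"
    and y z :: "nat \<Rightarrow> complex^'q^'q"
    and zn :: "nat \<Rightarrow> nat \<Rightarrow> complex^'q^'q"
  assumes d: "0 < d" "d < 1/2"
    and g: "rational_nopole_closed_disk g" "det_nonzero_closed_disk g"
    and w: "\<And>u. norm u = 1 \<Longrightarrow> u \<noteq> 1 \<Longrightarrow>
              w u = cscale (of_real (norm (1 - u) powr (- 2 * d))) (g u ** herm (g u))"
    and g_sharp: "rational_nopole_closed_disk g_sharp" "det_nonzero_closed_disk g_sharp"
      "\<And>u. norm u = 1 \<Longrightarrow> g u ** herm (g u) = herm (g_sharp u) ** g_sharp u"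
    and \<rho>: "1 - 2 * d < \<rho>"
    and y: "bdd_above ((\<lambda>k. real k powr \<rho> * spectral_norm (y k)) ` {1..})"
    and z: "\<And>s. s \<ge> 1 \<Longrightarrow> z s = infinite_solution d g_sharp y s"
    and zn: "\<And>n s. s \<in> {1..n} \<Longrightarrow> zn n s = finite_solution w y n s"
  shows "(\<rho> < 1 - d \<longrightarrow>
            (\<lambda>n. \<Sum>k=1..n. spectral_norm (z k - zn n k)) \<in> O(\<lambda>n. real n powr (1 - 2 * d - \<rho>))) \<and>
         (\<rho> = 1 - d \<longrightarrow>
            (\<lambda>n. \<Sum>k=1..n. spectral_norm (z k - zn n k)) \<in> O(\<lambda>n. real n powr (- d) * ln (real n))) \<and>
         (\<rho> > 1 - d \<longrightarrow>
            (\<lambda>n. \<Sum>k=1..n. spectral_norm (z k - zn n k)) \<in> O(\<lambda>n. real n powr (- d))) \<and>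
         (\<lambda>n. \<Sum>k=1..n. spectral_norm (z k - zn n k)) \<longlonglongrightarrow> 0"
proof -
  define S where "S n = (\<Sum>k=1..n. spectral_norm (z k - zn n k))" for n
  obtain M where M: "\<And>k. 1 \<le> k \<Longrightarrow> real k powr \<rho> * spectral_norm (y k) \<le> M"
    using y by (auto simp: bdd_above_def)
  have S0: "0 \<le> S n" for n by (auto simp: S_def intro!: sum_nonneg)
  \<comment> \<open>\<open>solution_error\<close> requires an exponent below 1. Data that decay with
    exponent \<open>\<rho>\<close> also decay with every smaller \<open>r\<close>, so
    \<open>r\<close> is left free. The norms are compared in both directions, which costs the factor
    \<open>q\<close> in the data.\<close>
  have core: "\<exists>C\<ge>0. \<forall>\<^sub>F n in sequentially. S n \<le> C * (wt (r + 2 * d - 1) (int n) + wt d (int n) * (\<Sum>t\<in>{0..int n}. wt (r + d) t))"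
    if r: "1 - 2 * d < r" "r < 1" "r \<le> \<rho>" for r
  proof -
    have r0: "0 \<le> r" using r d by linarith
    have yr: "norm (y t) \<le> real CARD('q) * M * 2 powr r * wt r (int t)" if t: "1 \<le> t" for t
    proof -
      have "real t powr r * spectral_norm (y t) \<le> real t powr \<rho> * spectral_norm (y t)"
        using t r by (intro mult_right_mono powr_mono) auto
      also have "\<dots> \<le> M" by (rule M[OF t])
      finally have "spectral_norm (y t) \<le> M * real t powr (- r)"
        using t by (simp add: powr_minus field_simps)
      also have "\<dots> \<le> M * (2 powr r * wt r (int t))"
      proof (rule mult_left_mono[OF powr_le_wt[OF r0 t]])
        show "0 \<le> M" using order_trans[OF _ M[OF t]] by simp
      qed
      finally have "real CARD('q) * spectral_norm (y t) \<le> real CARD('q) * (M * (2 powr r * wt r (int t)))"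
        by (intro mult_left_mono) auto
      then show ?thesis using norm_le_spectral_norm[of "y t"] by (simp only: mult_ac)
    qed
    obtain C n0 where C: "\<And>n. n0 \<le> n \<Longrightarrow> (\<Sum>k=1..n. norm (infinite_solution d g_sharp y k - finite_solution w y n k))
      \<le> C * (wt (r + 2 * d - 1) (int n) + wt d (int n) * (\<Sum>t\<in>{0..int n}. wt (r + d) t))"
      using solution_error[OF d g w g_sharp r(1,2) yr] by blast
    have "S n \<le> \<bar>C\<bar> * (wt (r + 2 * d - 1) (int n) + wt d (int n) * (\<Sum>t\<in>{0..int n}. wt (r + d) t))" if n: "n0 \<le> n" for n
    proof -
      have "S n \<le> (\<Sum>k=1..n. norm (infinite_solution d g_sharp y k - finite_solution w y n k))"
        unfolding S_def using z zn by (intro sum_mono) (auto intro: order_trans[OF spectral_norm_le])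
      also have "\<dots> \<le> C * (wt (r + 2 * d - 1) (int n) + wt d (int n) * (\<Sum>t\<in>{0..int n}. wt (r + d) t))" by (rule C[OF n])
      also have "\<dots> \<le> \<bar>C\<bar> * (wt (r + 2 * d - 1) (int n) + wt d (int n) * (\<Sum>t\<in>{0..int n}. wt (r + d) t))"
        by (intro mult_right_mono add_nonneg_nonneg mult_nonneg_nonneg sum_nonneg) auto
      finally show ?thesis .
    qed
    then show ?thesis unfolding eventually_sequentially by (intro exI[of _ "\<bar>C\<bar>"]) auto
  qed
  have big: "S \<in> O(h)" if "\<forall>\<^sub>F n in sequentially. S n \<le> A * h n" "\<forall>\<^sub>F n in sequentially. 0 \<le> h n" for A and h :: "nat \<Rightarrow> real"
    by (rule bigoI[of _ A]) (use that in \<open>eventually_elim, use S0 in auto\<close>)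
  have small: "S \<in> O(\<lambda>n. real n powr (1 - 2 * d - \<rho>))" if r: "\<rho> < 1 - d"
  proof -
    obtain C where C: "0 \<le> C" "\<forall>\<^sub>F n in sequentially. S n \<le> C * (wt (\<rho> + 2 * d - 1) (int n) + wt d (int n) * (\<Sum>t\<in>{0..int n}. wt (\<rho> + d) t))"
      using core[of \<rho>] \<rho> r d by auto
    have "\<forall>\<^sub>F n in sequentially. S n \<le> C * (1 + 1 / (1 - (\<rho> + d))) * real n powr (1 - 2 * d - \<rho>)"
      using C(2) eventually_ge_at_top[of 1]
    proof eventually_elim
      case (elim n)
      have "wt d (int n) * (\<Sum>t\<in>{0..int n}. wt (\<rho> + d) t) \<le> wt d (int n) * (1 / (1 - (\<rho> + d)) * wt (\<rho> + d - 1) (int n))"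
        using \<rho> d r by (intro mult_left_mono sum_wt_le) auto
      also have "\<dots> = 1 / (1 - (\<rho> + d)) * wt (\<rho> + 2 * d - 1) (int n)"
        using wt_add[of d "\<rho> + d - 1" "int n"] by (simp add: algebra_simps)
      finally have "S n \<le> C * (wt (\<rho> + 2 * d - 1) (int n) + 1 / (1 - (\<rho> + d)) * wt (\<rho> + 2 * d - 1) (int n))"
        using elim C(1) by (meson add_left_mono mult_left_mono order_trans)
      also have "\<dots> = C * (1 + 1 / (1 - (\<rho> + d))) * wt (\<rho> + 2 * d - 1) (int n)" by (simp add: algebra_simps)
      also have "\<dots> \<le> C * (1 + 1 / (1 - (\<rho> + d))) * real n powr (- (\<rho> + 2 * d - 1))"
        using elim C(1) r \<rho> by (intro mult_left_mono wt_le_powr mult_nonneg_nonneg add_nonneg_nonneg) auto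
      finally show ?case by (simp add: algebra_simps)
    qed
    then show ?thesis by (rule big) simp
  qed
  have crit: "S \<in> O(\<lambda>n. real n powr (- d) * ln (real n))" if r: "\<rho> = 1 - d"
  proof -
    obtain C where C: "0 \<le> C" "\<forall>\<^sub>F n in sequentially. S n \<le> C * (wt (\<rho> + 2 * d - 1) (int n) + wt d (int n) * (\<Sum>t\<in>{0..int n}. wt (\<rho> + d) t))"
      using core[of \<rho>] \<rho> r d by auto
    have "\<forall>\<^sub>F n in sequentially. S n \<le> 4 * C * (real n powr (- d) * ln (real n))"
      using C(2) eventually_ge_at_top[of 3]
    proof eventually_elim
      case (elim n)
      \<comment> \<open>From \<open>n = 3\<close> on the logarithm is at least 1 and absorbs the
        constants and the first term of the bound.\<close>
      have "exp 1 \<le> real n" using exp_le elim(2) by linarith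
      then have l1: "1 \<le> ln (real n)" using elim(2) by (subst ln_ge_iff) auto
      have "ln (1 + real n) \<le> ln (real n * real n)" using elim(2) by (subst ln_le_cancel_iff) (auto simp: algebra_simps intro: order_trans[OF _ mult_right_mono[of 3 "real n"]])
      also have "\<dots> = 2 * ln (real n)" using elim(2) by (simp add: ln_mult)
      finally have "(\<Sum>t\<in>{0..int n}. wt (\<rho> + d) t) \<le> 3 * ln (real n)"
        using sum_wt_1_le[of n] l1 r by simp
      then have "wt d (int n) * (\<Sum>t\<in>{0..int n}. wt (\<rho> + d) t) \<le> wt d (int n) * (3 * ln (real n))"
        by (intro mult_left_mono) auto
      moreover have "wt (\<rho> + 2 * d - 1) (int n) \<le> wt d (int n) * ln (real n)"
        using l1 r mult_left_mono[OF l1, of "wt d (int n)"] by simp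
      ultimately have "wt (\<rho> + 2 * d - 1) (int n) + wt d (int n) * (\<Sum>t\<in>{0..int n}. wt (\<rho> + d) t) \<le> 4 * (wt d (int n) * ln (real n))"
        by linarith
      also have "\<dots> \<le> 4 * (real n powr (- d) * ln (real n))"
        using elim(2) d l1 by (intro mult_left_mono mult_right_mono wt_le_powr) auto
      finally have "C * (wt (\<rho> + 2 * d - 1) (int n) + wt d (int n) * (\<Sum>t\<in>{0..int n}. wt (\<rho> + d) t)) \<le> C * (4 * (real n powr (- d) * ln (real n)))"
        using C(1) by (rule mult_left_mono)
      then show ?case using elim(1) by simp
    qed
    moreover have "\<forall>\<^sub>F n in sequentially. 0 \<le> real n powr (- d) * ln (real n)"
      using eventually_ge_at_top[of 1] by eventually_elim auto
    ultimately show ?thesis by (rule big)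
  qed
  have large: "S \<in> O(\<lambda>n. real n powr (- d))" if r: "1 - d < \<rho>"
  proof -
    \<comment> \<open>Any exponent strictly between \<open>1 - d\<close> and 1 will do: the partial
      sums stay bounded and the first term is dominated by \<open>wt d\<close>. The value
      \<open>1 - d / 2\<close> caps \<open>\<rho>\<close> there.\<close>
    define r' where "r' = min \<rho> (1 - d / 2)"
    have r': "1 - d < r'" "r' < 1" "r' \<le> \<rho>" "1 - 2 * d < r'" using r d by (auto simp: r'_def)
    obtain C where C: "0 \<le> C" "\<forall>\<^sub>F n in sequentially. S n \<le> C * (wt (r' + 2 * d - 1) (int n) + wt d (int n) * (\<Sum>t\<in>{0..int n}. wt (r' + d) t))"
      using core[of r'] r' by auto
    define A where "A = 2 * ((r' + d) / (r' + d - 1))"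
    have A: "(\<Sum>t\<in>{0..int n}. wt (r' + d) t) \<le> A" for n
      unfolding A_def using psum_leD[OF psum_le_wt_UNIV[of "r' + d"], of "{0..int n}"] r' by simp
    have "\<forall>\<^sub>F n in sequentially. S n \<le> C * (1 + A) * real n powr (- d)"
      using C(2) eventually_ge_at_top[of 1]
    proof eventually_elim
      case (elim n)
      have A0: "0 \<le> A" using order_trans[OF sum_nonneg A[of n]] by simp
      have "wt (r' + 2 * d - 1) (int n) + wt d (int n) * (\<Sum>t\<in>{0..int n}. wt (r' + d) t) \<le> wt d (int n) + wt d (int n) * A"
        using r' by (intro add_mono mult_left_mono A wt_antimono_exp) auto
      also have "\<dots> = (1 + A) * wt d (int n)" by (simp add: algebra_simps)
      also have "\<dots> \<le> (1 + A) * real n powr (- d)"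
        using A0 d elim(2) by (intro mult_left_mono wt_le_powr) auto
      finally have "C * (wt (r' + 2 * d - 1) (int n) + wt d (int n) * (\<Sum>t\<in>{0..int n}. wt (r' + d) t)) \<le> C * ((1 + A) * real n powr (- d))"
        using C(1) by (rule mult_left_mono)
      then show ?case using elim(1) by (simp add: mult.assoc)
    qed
    then show ?thesis by (rule big) simp
  qed
  have "S \<longlonglongrightarrow> 0"
  proof -
    consider "\<rho> < 1 - d" | "\<rho> = 1 - d" | "1 - d < \<rho>" by linarith
    then show ?thesis
    proof cases
      case 1
      have "(\<lambda>n. real n powr (- (2 * d + \<rho> - 1))) \<longlonglongrightarrow> 0"
        using \<rho> by (intro real_powr_minus_tendsto_0) auto
      then show ?thesis using small[OF 1] by (intro bigo_tendsto_0[OF small[OF 1]]) (simp add: algebra_simps)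
    next
      case 2
      have "(\<lambda>n. real n powr (- d) * ln (real n)) \<longlonglongrightarrow> 0"
        using lim_ln_over_power[OF d(1)] by (simp add: powr_minus field_simps)
      then show ?thesis by (rule bigo_tendsto_0[OF crit[OF 2]])
    next
      case 3
      show ?thesis by (rule bigo_tendsto_0[OF large[OF 3] real_powr_minus_tendsto_0[OF d(1)]])
    qed
  qed
  then show ?thesis using small crit large by (auto simp: S_def[abs_def])
qed

end
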